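(* Let $(V,\omega,\tau)$ be fundamental algebraic data, $V=L\oplus L'$ the splitting induced by a Lagrangean splitting $V^\tau=L_0\oplus L_0'$, $M\subset(V,\omega,\gamma)$ a Lagrangean pseudo Kähler submanifold in general position, and $N=(T^*M,G)$ the associated pseudo hyper Kähler manifold with standard complex symplectic structure $\Omega$. Then the group $V^\tau\rtimes \mathrm{Aut}_{sd}(M)\hookrightarrow \mathrm{Aff}(V^\tau)$ acts naturally on $N$ by automorphisms of the pseudo hyper Kähler structure, i.e. by holomorphic isometries preserving the complex symplectic structure $\Omega$. The action of $\mathrm{Aut}_{sd}(M)$ is by point transformations of $N=T^*M$ (the natural lift to $T^*M$ of its action on $M$), and that of $V^\tau$, given for $v\in V^\tau$ by $$T^*_mM\ni\sigma\mapsto\sigma+\sqrt{-1}\,\psi_m(v)\in T^*_mM,$$ is fibre preserving and simply transitive on each fibre.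
   Context: Fundamental algebraic data $(V,\omega,\tau)$: a complex symplectic vector space $(V,\omega)$ of complex dimension $2n$ and a $\mathbb C$-antilinear involution $\tau$ such that $\omega|V^\tau$ is a real symplectic structure on the fixed point set $V^\tau$. $\gamma(u,v)=\sqrt{-1}\,\omega(u,\tau v)$. A complex submanifold $M\subset V$ is Lagrangean if each $T_mM$ is Lagrangean, and pseudo Kähler if $g:=\gamma|M$ is nondegenerate. A Lagrangean splitting $V^\tau=L_0\oplus L_0'$ (both Lagrangean) induces $V=L\oplus L'$ with $L=\tau L$, $L'=\tau L'$, $L^\tau=L_0$, $(L')^\tau=L_0'$. $M$ is in general position if the projection $p:V\to L$ along $L'$ induces an isomorphism of $M$ onto its image. The metric $G$: let $K^M(u)=\gamma(u,u)$. Let $\rho'$ be the $\mathbb C$-antilinear involution of $T_mM$ whose fixed set is mapped by $dp$ onto $L_0$, let $\rho$ be the dual real structure on $T_m^*M$, and let $g^{-1}$ be the Hermitian metric on $T^*M$ inverse to $g$. $G$ is the pseudo Kähler metric on $T^*M$ with pseudo Kähler potential $K(\sigma)=K^M(m)+g_m^{-1}(\sigma+\rho(\sigma),\sigma+\rho(\sigma))$, $\sigma\in T_m^*M$ (i.e. $G_{IJ}=\partial^2K/\partial z^I\partial\overline z^J$). The standard complex symplectic structure $\Omega$ of the holomorphic cotangent bundle $T^*M$ is parallel for $G$, so $(T^*M,G,\Omega)$ is pseudo hyper Kähler. $\mathrm{Aut}_{sd}(M)$ is the group of linear automorphisms $\varphi$ of $(V,\omega,\tau)$ such that $\varphi M=M$,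 $\varphi L=L$, $\varphi L'=L'$; by restriction it embeds in $Sp(V^\tau,\omega|V^\tau)\subset GL(V^\tau)$, and $V^\tau\rtimes \mathrm{Aut}_{sd}(M)\subset V^\tau\rtimes GL(V^\tau)=\mathrm{Aff}(V^\tau)$. $\psi_m:V^\tau\to T_m^*M$ is the isomorphism of real vector spaces obtained by composing $V^\tau\subset V\to V/T_mM$ with the isomorphism $V/T_mM\cong T_m^*M$ given by $\omega$, i.e. $\psi_m(v)=\omega(v,\cdot)|_{T_mM}$. In coordinates where $\omega=\sum dq^i\wedge dp_i$, $M$ is locally $p_i=\partial F/\partial q^i$, and $(z^i,w_i)$ are the induced coordinates on $T^*M$, the action of $v=(v^i,v_i)\in V^\tau$ is $\tilde z^i=z^i$, $\tilde w_i=w_i-\sqrt{-1}\,(v_i-\sum_jF_{ij}v^j)$, where $F_{ij}=\partial^2F/\partial z^i\partial z^j$. *)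

theory Defs
  imports "HOL-Analysis.Analysis" "HOL-Algebra.Group_Action"
begin

section \<open>Linear algebra\<close>

text \<open>
  The complex vector space \<open>V\<close> is \<open>complex ^ 'm\<close> with arbitrary \<open>\<omega>\<close> and \<open>\<tau>\<close>; no compatibility
  with the standard coordinates is assumed.
\<close>

definition antilinear :: "(complex ^ 'm \<Rightarrow> complex ^ 'm) \<Rightarrow> bool" where
  "antilinear \<tau> \<longleftrightarrow> (\<forall>u v. \<tau> (u + v) = \<tau> u + \<tau> v) \<and> (\<forall>c u. \<tau> (c *s u) = cnj c *s \<tau> u)"

definition complex_symplectic_form :: "(complex ^ 'm \<Rightarrow> complex ^ 'm \<Rightarrow> complex) \<Rightarrow> bool" where
  "complex_symplectic_form \<omega> \<longleftrightarrow>
     (\<forall>u. Vector_Spaces.linear (*s) (*) (\<lambda>v. \<omega> u v)) \<and>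
     (\<forall>v. Vector_Spaces.linear (*s) (*) (\<lambda>u. \<omega> u v)) \<and>
     (\<forall>u. \<omega> u u = 0) \<and>
     (\<forall>u. (\<forall>v. \<omega> u v = 0) \<longrightarrow> u = 0)"

definition fixset :: "('v \<Rightarrow> 'v) \<Rightarrow> 'v set" where
  "fixset \<tau> = {v. \<tau> v = v}"

text \<open>
  The restriction of \<open>\<omega>\<close> to the real vector space \<open>V\<^sup>\<tau>\<close> is automatically real bilinear and alternating,
  so being a real symplectic structure means being real valued and nondegenerate there.
\<close>

definition fundamental_data ::
    "(complex ^ 'm \<Rightarrow> complex ^ 'm \<Rightarrow> complex) \<Rightarrow> (complex ^ 'm \<Rightarrow> complex ^ 'm) \<Rightarrow> bool" where
  "fundamental_data \<omega> \<tau> \<longleftrightarrow>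
     complex_symplectic_form \<omega> \<and>
     antilinear \<tau> \<and> (\<forall>v. \<tau> (\<tau> v) = v) \<and>
     (\<forall>u\<in>fixset \<tau>. \<forall>v\<in>fixset \<tau>. \<omega> u v \<in> \<real>) \<and>
     (\<forall>u\<in>fixset \<tau>. (\<forall>v\<in>fixset \<tau>. \<omega> u v = 0) \<longrightarrow> u = 0)"

definition herm ::
    "(complex ^ 'm \<Rightarrow> complex ^ 'm \<Rightarrow> complex) \<Rightarrow> (complex ^ 'm \<Rightarrow> complex ^ 'm) \<Rightarrow>
     complex ^ 'm \<Rightarrow> complex ^ 'm \<Rightarrow> complex" where
  "herm \<omega> \<tau> u v = \<i> * \<omega> u (\<tau> v)"

definition lagrangean_subspace ::
    "(complex ^ 'm \<Rightarrow> complex ^ 'm \<Rightarrow> complex) \<Rightarrow> (complex ^ 'm) set \<Rightarrow> bool" where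
  "lagrangean_subspace \<omega> W \<longleftrightarrow> vec.subspace W \<and> W = {u. \<forall>w\<in>W. \<omega> u w = 0}"

definition real_lagrangean_subspace ::
    "(complex ^ 'm \<Rightarrow> complex ^ 'm \<Rightarrow> complex) \<Rightarrow> (complex ^ 'm \<Rightarrow> complex ^ 'm) \<Rightarrow>
     (complex ^ 'm) set \<Rightarrow> bool" where
  "real_lagrangean_subspace \<omega> \<tau> W \<longleftrightarrow> subspace W \<and> W = {u \<in> fixset \<tau>. \<forall>w\<in>W. \<omega> u w = 0}"

definition lagrangean_splitting ::
    "(complex ^ 'm \<Rightarrow> complex ^ 'm \<Rightarrow> complex) \<Rightarrow> (complex ^ 'm \<Rightarrow> complex ^ 'm) \<Rightarrow>
     (complex ^ 'm) set \<Rightarrow> (complex ^ 'm) set \<Rightarrow> bool" where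
  "lagrangean_splitting \<omega> \<tau> L0 L0' \<longleftrightarrow>
     real_lagrangean_subspace \<omega> \<tau> L0 \<and> real_lagrangean_subspace \<omega> \<tau> L0' \<and>
     L0 \<inter> L0' = {0} \<and> {a + b | a b. a \<in> L0 \<and> b \<in> L0'} = fixset \<tau>"

text \<open>The conditions \<open>L = \<tau> L\<close> and \<open>L\<^sup>\<tau> = L0\<close> say that \<open>L = L0 + \<i> L0\<close>, the complex span of \<open>L0\<close>.\<close>

abbreviation cspan :: "(complex ^ 'm) set \<Rightarrow> (complex ^ 'm) set" where
  "cspan \<equiv> vec.span"

definition proj_along :: "(complex ^ 'm) set \<Rightarrow> (complex ^ 'm) set \<Rightarrow> complex ^ 'm \<Rightarrow> complex ^ 'm" where
  "proj_along L L' u = (THE l. l \<in> L \<and> u - l \<in> L')"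


section \<open>Complex submanifolds of a complex vector space\<close>

definition holo_on :: "(complex ^ 'a \<Rightarrow> complex ^ 'b) \<Rightarrow> (complex ^ 'a) set \<Rightarrow> bool" where
  "holo_on f U \<longleftrightarrow>
     (\<forall>z\<in>U. \<exists>D. Vector_Spaces.linear (*s) (*s) D \<and> (f has_derivative D) (at z))"

text \<open>
  A local parametrization is the inverse of a local holomorphic chart of \<open>M\<close>; its coordinates
  are \<open>z\<^sup>i\<close>, \<open>i :: 'n\<close>.
\<close>

definition local_param ::
    "(complex ^ 'm) set \<Rightarrow> (complex ^ 'n) set \<Rightarrow> (complex ^ 'n \<Rightarrow> complex ^ 'm) \<Rightarrow> bool" where
  "local_param M U x \<longleftrightarrow>
     open U \<and> holo_on x U \<and> (\<forall>z\<in>U. inj (frechet_derivative x (at z))) \<and>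
     openin (top_of_set M) (x ` U) \<and> (\<exists>y. homeomorphism U (x ` U) x y)"

definition complex_submanifold :: "'n::finite itself \<Rightarrow> (complex ^ 'm) set \<Rightarrow> bool" where
  "complex_submanifold _ M \<longleftrightarrow>
     (\<forall>m\<in>M. \<exists>U (x :: complex ^ 'n \<Rightarrow> complex ^ 'm). local_param M U x \<and> m \<in> x ` U)"

definition tangent_space :: "(complex ^ 'm) set \<Rightarrow> complex ^ 'm \<Rightarrow> (complex ^ 'm) set" where
  "tangent_space M m =
     {v. \<exists>\<epsilon>>0. \<exists>c :: real \<Rightarrow> complex ^ 'm. (\<forall>t. \<bar>t\<bar> < \<epsilon> \<longrightarrow> c t \<in> M) \<and> c 0 = m \<and>
           (c has_vector_derivative v) (at 0)}"

definition holo_map ::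
    "'n::finite itself \<Rightarrow> (complex ^ 'a) set \<Rightarrow> (complex ^ 'a \<Rightarrow> complex ^ 'b) \<Rightarrow> bool" where
  "holo_map _ A f \<longleftrightarrow>
     (\<forall>U (x :: complex ^ 'n \<Rightarrow> complex ^ 'a). local_param A U x \<longrightarrow> holo_on (f \<circ> x) U)"

definition biholomorphism ::
    "'n::finite itself \<Rightarrow> (complex ^ 'a) set \<Rightarrow> (complex ^ 'b) set \<Rightarrow> (complex ^ 'a \<Rightarrow> complex ^ 'b) \<Rightarrow> bool" where
  "biholomorphism n A B f \<longleftrightarrow>
     complex_submanifold n A \<and> complex_submanifold n B \<and> bij_betw f A B \<and>
     holo_map n A f \<and> holo_map n B (the_inv_into A f)"

definition lagrangean_submanifold ::
    "'n::finite itself \<Rightarrow> (complex ^ 'm \<Rightarrow> complex ^ 'm \<Rightarrow> complex) \<Rightarrow> (complex ^ 'm) set \<Rightarrow> bool" where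
  "lagrangean_submanifold n \<omega> M \<longleftrightarrow>
     complex_submanifold n M \<and> (\<forall>m\<in>M. lagrangean_subspace \<omega> (tangent_space M m))"

definition pseudo_kaehler_submanifold ::
    "'n::finite itself \<Rightarrow> (complex ^ 'm \<Rightarrow> complex ^ 'm \<Rightarrow> complex) \<Rightarrow> (complex ^ 'm \<Rightarrow> complex ^ 'm) \<Rightarrow>
     (complex ^ 'm) set \<Rightarrow> bool" where
  "pseudo_kaehler_submanifold n \<omega> \<tau> M \<longleftrightarrow>
     complex_submanifold n M \<and>
     (\<forall>m\<in>M. \<forall>u\<in>tangent_space M m.
        (\<forall>v\<in>tangent_space M m. herm \<omega> \<tau> u v = 0) \<longrightarrow> u = 0)"

definition general_position ::
    "'n::finite itself \<Rightarrow> (complex ^ 'm) set \<Rightarrow> (complex ^ 'm) set \<Rightarrow> (complex ^ 'm) set \<Rightarrow> bool" where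
  "general_position n L L' M \<longleftrightarrow>
     biholomorphism n M (proj_along L L' ` M) (proj_along L L')"


section \<open>The cotangent bundle\<close>

text \<open>
  A covector at \<open>m\<close> is a complex linear functional on the tangent space, made extensional so
  that equality of covectors is equality of functions.
\<close>

definition cotangent_space :: "(complex ^ 'm) set \<Rightarrow> complex ^ 'm \<Rightarrow> (complex ^ 'm \<Rightarrow> complex) set" where
  "cotangent_space M m =
     {\<sigma> \<in> extensional (tangent_space M m).
        (\<forall>u\<in>tangent_space M m. \<forall>v\<in>tangent_space M m. \<sigma> (u + v) = \<sigma> u + \<sigma> v) \<and>
        (\<forall>c. \<forall>u\<in>tangent_space M m. \<sigma> (c *s u) = c * \<sigma> u)}"

type_synonym 'm covec = "(complex ^ 'm) \<times> (complex ^ 'm \<Rightarrow> complex)"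

definition cotangent_bundle ::
    "(complex ^ 'm) set \<Rightarrow> 'm covec set" where
  "cotangent_bundle M = Sigma M (cotangent_space M)"

text \<open>
  The parametrization of \<open>T\<^sup>*M\<close> induced by a parametrization \<open>x\<close> of \<open>M\<close>. The coordinates
  \<open>(z\<^sup>i, w\<^sub>i)\<close> form a vector indexed by \<open>'n + 'n\<close>: \<open>Inl i\<close> for \<open>z\<^sup>i\<close>, \<open>Inr i\<close> for \<open>w\<^sub>i\<close>.
\<close>

definition base_coord :: "complex ^ ('n + 'n) \<Rightarrow> complex ^ 'n" where
  "base_coord \<zeta> = (\<chi> i. \<zeta> $ Inl i)"

definition cot_dom :: "(complex ^ 'n) set \<Rightarrow> (complex ^ ('n + 'n)) set" where
  "cot_dom U = {\<zeta>. base_coord \<zeta> \<in> U}"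

definition cot_param ::
    "(complex ^ 'm) set \<Rightarrow> (complex ^ 'n \<Rightarrow> complex ^ 'm) \<Rightarrow> complex ^ ('n + 'n) \<Rightarrow>
     'm covec" where
  "cot_param M x \<zeta> =
     (x (base_coord \<zeta>),
      THE \<sigma>. \<sigma> \<in> cotangent_space M (x (base_coord \<zeta>)) \<and>
        (\<forall>i. \<sigma> (frechet_derivative x (at (base_coord \<zeta>)) (axis i 1)) = \<zeta> $ Inr i))"


section \<open>The metric \<open>G\<close> and the symplectic form \<open>\<Omega>\<close> on the cotangent bundle\<close>

definition tangent_conj ::
    "(complex ^ 'm) set \<Rightarrow> (complex ^ 'm) set \<Rightarrow> (complex ^ 'm) set \<Rightarrow> complex ^ 'm \<Rightarrow>
     complex ^ 'm \<Rightarrow> complex ^ 'm" where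
  "tangent_conj L0 L0' M m =
     (THE r. r \<in> extensional (tangent_space M m) \<and>
        (\<forall>u\<in>tangent_space M m. r u \<in> tangent_space M m \<and> r (r u) = u) \<and>
        (\<forall>u\<in>tangent_space M m. \<forall>v\<in>tangent_space M m. r (u + v) = r u + r v) \<and>
        (\<forall>c. \<forall>u\<in>tangent_space M m. r (c *s u) = cnj c *s r u) \<and>
        proj_along (cspan L0) (cspan L0') ` {u \<in> tangent_space M m. r u = u} = L0)"

definition cotangent_conj ::
    "(complex ^ 'm) set \<Rightarrow> (complex ^ 'm) set \<Rightarrow> (complex ^ 'm) set \<Rightarrow> complex ^ 'm \<Rightarrow>
     (complex ^ 'm \<Rightarrow> complex) \<Rightarrow> complex ^ 'm \<Rightarrow> complex" where
  "cotangent_conj L0 L0' M m \<sigma> =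
     (\<lambda>u\<in>tangent_space M m. cnj (\<sigma> (tangent_conj L0 L0' M m u)))"

text \<open>
  The inverse metric is transported from the tangent space by the antilinear isomorphism
  \<open>s \<mapsto> g(\<cdot>, s)\<close> onto the cotangent space. The swapped arguments make it linear in \<open>\<sigma>\<close>.
\<close>

definition sharp ::
    "(complex ^ 'm \<Rightarrow> complex ^ 'm \<Rightarrow> complex) \<Rightarrow> (complex ^ 'm \<Rightarrow> complex ^ 'm) \<Rightarrow>
     (complex ^ 'm) set \<Rightarrow> complex ^ 'm \<Rightarrow> (complex ^ 'm \<Rightarrow> complex) \<Rightarrow> complex ^ 'm" where
  "sharp \<omega> \<tau> M m \<sigma> =
     (THE s. s \<in> tangent_space M m \<and> (\<forall>u\<in>tangent_space M m. herm \<omega> \<tau> u s = \<sigma> u))"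

definition inverse_metric ::
    "(complex ^ 'm \<Rightarrow> complex ^ 'm \<Rightarrow> complex) \<Rightarrow> (complex ^ 'm \<Rightarrow> complex ^ 'm) \<Rightarrow>
     (complex ^ 'm) set \<Rightarrow> complex ^ 'm \<Rightarrow>
     (complex ^ 'm \<Rightarrow> complex) \<Rightarrow> (complex ^ 'm \<Rightarrow> complex) \<Rightarrow> complex" where
  "inverse_metric \<omega> \<tau> M m \<sigma> \<sigma>' = herm \<omega> \<tau> (sharp \<omega> \<tau> M m \<sigma>') (sharp \<omega> \<tau> M m \<sigma>)"

definition potential ::
    "(complex ^ 'm \<Rightarrow> complex ^ 'm \<Rightarrow> complex) \<Rightarrow> (complex ^ 'm \<Rightarrow> complex ^ 'm) \<Rightarrow>
     (complex ^ 'm) set \<Rightarrow> (complex ^ 'm) set \<Rightarrow> (complex ^ 'm) set \<Rightarrow>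
     'm covec \<Rightarrow> complex" where
  "potential \<omega> \<tau> L0 L0' M =
     (\<lambda>(m, \<sigma>). herm \<omega> \<tau> m m +
        (let \<eta> = (\<lambda>u\<in>tangent_space M m. \<sigma> u + cotangent_conj L0 L0' M m \<sigma> u)
         in inverse_metric \<omega> \<tau> M m \<eta> \<eta>))"

definition pderiv_along :: "(complex ^ 'k \<Rightarrow> complex) \<Rightarrow> complex ^ 'k \<Rightarrow> complex ^ 'k \<Rightarrow> complex" where
  "pderiv_along f e \<zeta> = vector_derivative (\<lambda>t::real. f (\<zeta> + t *\<^sub>R e)) (at 0)"

definition wirtinger :: "'k \<Rightarrow> (complex ^ 'k \<Rightarrow> complex) \<Rightarrow> complex ^ 'k \<Rightarrow> complex" where
  "wirtinger I f \<zeta> = (pderiv_along f (axis I 1) \<zeta> - \<i> * pderiv_along f (axis I \<i>) \<zeta>) / 2"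

definition wirtinger_bar :: "'k \<Rightarrow> (complex ^ 'k \<Rightarrow> complex) \<Rightarrow> complex ^ 'k \<Rightarrow> complex" where
  "wirtinger_bar I f \<zeta> = (pderiv_along f (axis I 1) \<zeta> + \<i> * pderiv_along f (axis I \<i>) \<zeta>) / 2"

text \<open>The Hermitian form \<open>G\<close> at the point with coordinates \<open>\<zeta>\<close> in the chart of \<open>T\<^sup>*M\<close> induced by \<open>x\<close>.\<close>

definition metric_G ::
    "(complex ^ 'm \<Rightarrow> complex ^ 'm \<Rightarrow> complex) \<Rightarrow> (complex ^ 'm \<Rightarrow> complex ^ 'm) \<Rightarrow>
     (complex ^ 'm) set \<Rightarrow> (complex ^ 'm) set \<Rightarrow> (complex ^ 'm) set \<Rightarrow>
     (complex ^ 'n \<Rightarrow> complex ^ 'm) \<Rightarrow> complex ^ ('n + 'n) \<Rightarrow>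
     complex ^ ('n + 'n) \<Rightarrow> complex ^ ('n + 'n) \<Rightarrow> complex" where
  "metric_G \<omega> \<tau> L0 L0' M x \<zeta> a b =
     (\<Sum>I\<in>UNIV. \<Sum>J\<in>UNIV.
        wirtinger I (wirtinger_bar J (potential \<omega> \<tau> L0 L0' M \<circ> cot_param M x)) \<zeta> * a $ I * cnj (b $ J))"

text \<open>\<open>\<Omega> = \<Sum> dz\<^sup>i \<and> dw\<^sub>i\<close> in every chart of \<open>T\<^sup>*M\<close> induced by a chart of \<open>M\<close>.\<close>

definition Omega_form :: "complex ^ ('n::finite + 'n) \<Rightarrow> complex ^ ('n + 'n) \<Rightarrow> complex" where
  "Omega_form a b = (\<Sum>i\<in>UNIV. a $ Inl i * b $ Inr i - a $ Inr i * b $ Inl i)"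

text \<open>
  Expressions of maps of \<open>T\<^sup>*M\<close> in induced charts. Openness of the domain for all charts
  expresses continuity. Applied to the identity map, the three conditions
  below say that the charts are holomorphically compatible and that \<open>G\<close> and \<open>\<Omega>\<close> do not
  depend on the chart.
\<close>

definition local_dom where
  "local_dom M U x W y \<Phi> =
     {\<zeta> \<in> cot_dom U. \<Phi> (cot_param M x \<zeta>) \<in> cot_param M y ` cot_dom W}"

definition local_expr where
  "local_expr M x W y \<Phi> \<zeta> = the_inv_into (cot_dom W) (cot_param M y) (\<Phi> (cot_param M x \<zeta>))"

definition holomorphic_on_bundle ::
    "'n::finite itself \<Rightarrow> (complex ^ 'm) set \<Rightarrow>
     ('m covec \<Rightarrow> 'm covec) \<Rightarrow> bool" where
  "holomorphic_on_bundle _ M \<Phi> \<longleftrightarrow>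
     (\<forall>U (x :: complex ^ 'n \<Rightarrow> complex ^ 'm) W (y :: complex ^ 'n \<Rightarrow> complex ^ 'm).
        local_param M U x \<and> local_param M W y \<longrightarrow>
        open (local_dom M U x W y \<Phi>) \<and> holo_on (local_expr M x W y \<Phi>) (local_dom M U x W y \<Phi>))"

definition preserves_G ::
    "'n::finite itself \<Rightarrow> (complex ^ 'm \<Rightarrow> complex ^ 'm \<Rightarrow> complex) \<Rightarrow> (complex ^ 'm \<Rightarrow> complex ^ 'm) \<Rightarrow>
     (complex ^ 'm) set \<Rightarrow> (complex ^ 'm) set \<Rightarrow> (complex ^ 'm) set \<Rightarrow>
     ('m covec \<Rightarrow> 'm covec) \<Rightarrow> bool" where
  "preserves_G _ \<omega> \<tau> L0 L0' M \<Phi> \<longleftrightarrow>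
     (\<forall>U (x :: complex ^ 'n \<Rightarrow> complex ^ 'm) W (y :: complex ^ 'n \<Rightarrow> complex ^ 'm).
        local_param M U x \<and> local_param M W y \<longrightarrow>
        (\<forall>\<zeta>\<in>local_dom M U x W y \<Phi>. \<forall>a b.
           (let f = local_expr M x W y \<Phi>; D = frechet_derivative f (at \<zeta>) in
            metric_G \<omega> \<tau> L0 L0' M y (f \<zeta>) (D a) (D b) = metric_G \<omega> \<tau> L0 L0' M x \<zeta> a b)))"

definition preserves_Omega ::
    "'n::finite itself \<Rightarrow> (complex ^ 'm) set \<Rightarrow>
     ('m covec \<Rightarrow> 'm covec) \<Rightarrow> bool" where
  "preserves_Omega _ M \<Phi> \<longleftrightarrow>
     (\<forall>U (x :: complex ^ 'n \<Rightarrow> complex ^ 'm) W (y :: complex ^ 'n \<Rightarrow> complex ^ 'm).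
        local_param M U x \<and> local_param M W y \<longrightarrow>
        (\<forall>\<zeta>\<in>local_dom M U x W y \<Phi>. \<forall>a b.
           (let D = frechet_derivative (local_expr M x W y \<Phi>) (at \<zeta>) in
            Omega_form (D a) (D b) = Omega_form a b)))"

text \<open>
  Automorphisms of the pseudo hyper Kaehler structure: holomorphic isometries preserving \<open>\<Omega>\<close>.
\<close>

definition pseudo_hyperkaehler_automorphism ::
    "'n::finite itself \<Rightarrow> (complex ^ 'm \<Rightarrow> complex ^ 'm \<Rightarrow> complex) \<Rightarrow> (complex ^ 'm \<Rightarrow> complex ^ 'm) \<Rightarrow>
     (complex ^ 'm) set \<Rightarrow> (complex ^ 'm) set \<Rightarrow> (complex ^ 'm) set \<Rightarrow>
     ('m covec \<Rightarrow> 'm covec) \<Rightarrow> bool" where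
  "pseudo_hyperkaehler_automorphism n \<omega> \<tau> L0 L0' M \<Phi> \<longleftrightarrow>
     bij_betw \<Phi> (cotangent_bundle M) (cotangent_bundle M) \<and>
     holomorphic_on_bundle n M \<Phi> \<and>
     holomorphic_on_bundle n M (the_inv_into (cotangent_bundle M) \<Phi>) \<and>
     preserves_G n \<omega> \<tau> L0 L0' M \<Phi> \<and>
     preserves_Omega n M \<Phi>"


section \<open>The group and its action\<close>

definition Aut_sd ::
    "(complex ^ 'm \<Rightarrow> complex ^ 'm \<Rightarrow> complex) \<Rightarrow> (complex ^ 'm \<Rightarrow> complex ^ 'm) \<Rightarrow>
     (complex ^ 'm) set \<Rightarrow> (complex ^ 'm) set \<Rightarrow> (complex ^ 'm) set \<Rightarrow>
     (complex ^ 'm \<Rightarrow> complex ^ 'm) set" where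
  "Aut_sd \<omega> \<tau> L L' M =
     {\<phi>. Vector_Spaces.linear (*s) (*s) \<phi> \<and> bij \<phi> \<and>
         (\<forall>u v. \<omega> (\<phi> u) (\<phi> v) = \<omega> u v) \<and> (\<forall>u. \<phi> (\<tau> u) = \<tau> (\<phi> u)) \<and>
         \<phi> ` M = M \<and> \<phi> ` L = L \<and> \<phi> ` L' = L'}"

definition sd_group ::
    "(complex ^ 'm \<Rightarrow> complex ^ 'm \<Rightarrow> complex) \<Rightarrow> (complex ^ 'm \<Rightarrow> complex ^ 'm) \<Rightarrow>
     (complex ^ 'm) set \<Rightarrow> (complex ^ 'm) set \<Rightarrow> (complex ^ 'm) set \<Rightarrow>
     ((complex ^ 'm) \<times> (complex ^ 'm \<Rightarrow> complex ^ 'm)) monoid" where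
  "sd_group \<omega> \<tau> L L' M =
     \<lparr>carrier = fixset \<tau> \<times> Aut_sd \<omega> \<tau> L L' M,
      mult = (\<lambda>(v, \<phi>) (v', \<phi>'). (v + \<phi> v', \<phi> \<circ> \<phi>')),
      one = (0, id)\<rparr>"

text \<open>
  The affine group of a real subspace \<open>X\<close>. Every linear automorphism of \<open>X\<close> is the restriction of
  a real linear map of the ambient space.
\<close>

definition Aff_group :: "('v::real_vector) set \<Rightarrow> ('v \<Rightarrow> 'v) monoid" where
  "Aff_group X = (BijGroup X)
     \<lparr>carrier := {\<lambda>x\<in>X. A x + v | A v. linear A \<and> bij_betw A X X \<and> v \<in> X}\<rparr>"

definition sd_to_Aff ::
    "('v::real_vector \<Rightarrow> 'v) \<Rightarrow> 'v \<times> ('v \<Rightarrow> 'v) \<Rightarrow> 'v \<Rightarrow> 'v" where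
  "sd_to_Aff \<tau> = (\<lambda>(v, \<phi>). \<lambda>x\<in>fixset \<tau>. \<phi> x + v)"

definition psi ::
    "(complex ^ 'm \<Rightarrow> complex ^ 'm \<Rightarrow> complex) \<Rightarrow> (complex ^ 'm) set \<Rightarrow> complex ^ 'm \<Rightarrow>
     complex ^ 'm \<Rightarrow> complex ^ 'm \<Rightarrow> complex" where
  "psi \<omega> M m v = (\<lambda>u\<in>tangent_space M m. \<omega> v u)"

definition fibre_translation ::
    "(complex ^ 'm \<Rightarrow> complex ^ 'm \<Rightarrow> complex) \<Rightarrow> (complex ^ 'm) set \<Rightarrow> complex ^ 'm \<Rightarrow>
     'm covec \<Rightarrow> 'm covec" where
  "fibre_translation \<omega> M v =
     restrict (\<lambda>(m, \<sigma>). (m, \<lambda>u\<in>tangent_space M m. \<sigma> u + \<i> * psi \<omega> M m v u)) (cotangent_bundle M)"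

text \<open>
  The natural lift of \<open>\<phi>|M\<close> to the cotangent bundle, \<open>\<sigma> \<mapsto> \<sigma> \<circ> (d\<phi>)\<^sup>-\<^sup>1\<close>; since \<open>\<phi>\<close> is
  linear, \<open>d\<phi>\<close> is \<open>\<phi>\<close> itself.
\<close>

definition point_transformation ::
    "(complex ^ 'm) set \<Rightarrow> (complex ^ 'm \<Rightarrow> complex ^ 'm) \<Rightarrow>
     'm covec \<Rightarrow> 'm covec" where
  "point_transformation M \<phi> =
     restrict (\<lambda>(m, \<sigma>). (\<phi> m, \<lambda>u\<in>tangent_space M (\<phi> m). \<sigma> (inv_into UNIV \<phi> u))) (cotangent_bundle M)"

definition sd_action ::
    "(complex ^ 'm \<Rightarrow> complex ^ 'm \<Rightarrow> complex) \<Rightarrow> (complex ^ 'm) set \<Rightarrow>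
     (complex ^ 'm) \<times> (complex ^ 'm \<Rightarrow> complex ^ 'm) \<Rightarrow>
     'm covec \<Rightarrow> 'm covec" where
  "sd_action \<omega> M =
     (\<lambda>(v, \<phi>). compose (cotangent_bundle M) (fibre_translation \<omega> M v) (point_transformation M \<phi>))"

end

theory Submission
  imports Defs "HOL-Complex_Analysis.Cauchy_Integral_Formula"
begin

text \<open>
  Let \<open>P v\<close> be the vector of \<open>T\<^sub>mM\<close> with the same projection to \<open>L\<close> as \<open>v\<close>. The real structure of
  \<open>T\<^sub>mM\<close> is \<open>u \<mapsto> P (\<tau> u)\<close>, and the potential at \<open>\<sigma>\<close> is \<open>\<gamma>(m, m) + \<gamma>(s, s)\<close>, where \<open>s\<close> is
  dual to \<open>\<sigma> + \<rho>(\<sigma>)\<close>. As \<open>T\<^sub>mM\<close> and \<open>L'\<close> are Lagrangean, the translation by \<open>v\<close> replaces \<open>s\<close> by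
  \<open>s - P v\<close> and adds to the potential the real part of \<open>- 4 \<sigma>(P v) - 2 \<i> \<omega>(v, P v)\<close>. This function
  is holomorphic on \<open>T\<^sup>*M\<close>, so \<open>G\<close> does not change. \<open>\<Omega>\<close> does not change because the translation
  adds the closed form \<open>\<i> d(\<omega>(v, \<cdot>))\<close>, that is, because the second derivatives of holomorphic
  functions are symmetric. An automorphism \<open>\<phi>\<close> preserves the potential and turns a chart \<open>x\<close> into
  the chart \<open>\<phi> \<circ> x\<close>, so in charts only the translations have to be examined. If \<open>\<gamma>(\<cdot>, t) = \<sigma> - \<sigma>'\<close>
  with \<open>t \<in> T\<^sub>mM\<close>, then the translation by \<open>t + \<tau> t\<close> takes \<open>\<sigma>\<close> to \<open>\<sigma>'\<close>.
\<close>

section \<open>Holomorphic functions of several variables\<close>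

text \<open>The hypotheses give holomorphy as complex differentiability at each point, whereas
  \<open>metric_G\<close> consists of iterated partial derivatives of a potential whose ingredients
  are all defined implicitly. Before the chain rule can be used, the potential must be shown to be
  twice differentiable in every induced chart. To this end the lift and the dual vector are written
  as solutions of square linear systems and found by Cramer's rule. The systems are square because
  \<open>L'\<close> is cut out by as many equations as \<open>T\<^sub>mM\<close> has complex
  dimensions; they are invertible because general position makes \<open>T\<^sub>mM\<close> meet
  \<open>L'\<close> in 0 only, respectively because \<gamma> is nondegenerate on
  \<open>T\<^sub>mM\<close>. Holomorphy of first derivatives and symmetry of second ones come from
  Cauchy theory on complex lines. The form with the coefficients of \<open>metric_G\<close> is
  handled as a combination of four values of the real second derivative. In this combination every
  complex bilinear contribution cancels, be it the Hessian of a holomorphic summand or the second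
  derivative of a holomorphic change of coordinates.\<close>

abbreviation fd :: "('a::real_normed_vector \<Rightarrow> 'b::real_normed_vector) \<Rightarrow> 'a \<Rightarrow> 'a \<Rightarrow> 'b" where
  "fd f z \<equiv> frechet_derivative f (at z)"

lemma fd_eq: "(f has_derivative D) (at z) \<Longrightarrow> fd f z = D"
  by (metis frechet_derivative_at)

lemma fd_works: "f differentiable (at z) \<Longrightarrow> (f has_derivative fd f z) (at z)"
  by (simp add: frechet_derivative_works)

lemma scaleR_eq_smult: "r *\<^sub>R (a :: complex ^ 'k) = complex_of_real r *s a"
  unfolding vec_eq_iff vector_scaleR_component vector_smult_component
  by (simp add: scaleR_conv_of_real)

lemma norm_smult: "norm (c *s (a :: complex ^ 'k)) = cmod c * norm a"
  by (simp add: norm_vec_def norm_mult L2_set_right_distrib)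

lemma smult_complex_eq: "c *s (a :: complex ^ 'k) = Re c *\<^sub>R a + Im c *\<^sub>R (\<i> *s a)"
proof -
  have "c * x = complex_of_real (Re c) * x + complex_of_real (Im c) * (\<i> * x)" for x
    by (subst complex_eq[of c]) (simp add: algebra_simps)
  then show ?thesis
    unfolding vec_eq_iff vector_scaleR_component vector_add_component vector_smult_component
    by (simp add: scaleR_conv_of_real)
qed

lemma complex_homogeneous_scalar:
  fixes D :: "complex ^ 'k \<Rightarrow> complex"
  assumes "linear D" "\<And>a. D (\<i> *s a) = \<i> * D a"
  shows "D (c *s a) = c * D a"
proof -
  have "D (c *s a) = Re c *\<^sub>R D a + Im c *\<^sub>R (\<i> * D a)"
    using assms by (subst smult_complex_eq) (simp add: linear_add linear_cmul)
  also have "\<dots> = c * D a" by (subst (3) complex_eq[of c]) (simp add: scaleR_conv_of_real algebra_simps)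
  finally show ?thesis .
qed

lemma complex_linear_vec:
  fixes D :: "complex ^ 'k \<Rightarrow> complex ^ 'l"
  shows "Vector_Spaces.linear (*s) (*s) D \<longleftrightarrow> linear D \<and> (\<forall>a. D (\<i> *s a) = \<i> *s D a)"
proof
  assume *: "Vector_Spaces.linear (*s) (*s) D"
  have "linear D"
    by (rule linearI) (simp_all add: scaleR_eq_smult vec.linear_add[OF *] vec.linear_scale[OF *])
  then show "linear D \<and> (\<forall>a. D (\<i> *s a) = \<i> *s D a)" by (simp add: vec.linear_scale[OF *])
next
  assume *: "linear D \<and> (\<forall>a. D (\<i> *s a) = \<i> *s D a)"
  have "D (c *s a) = c *s D a" for c a
  proof -
    have "D (c *s a) = Re c *\<^sub>R D a + Im c *\<^sub>R (\<i> *s D a)"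
      using * by (subst smult_complex_eq) (simp add: linear_add linear_cmul)
    then show ?thesis by (subst (2) smult_complex_eq)
  qed
  with * show "Vector_Spaces.linear (*s) (*s) D"
    by (auto simp: Vector_Spaces.linear_iff linear_add vec.vector_space_axioms)
qed

lemma complex_linear_scalar:
  fixes D :: "complex ^ 'k \<Rightarrow> complex"
  shows "Vector_Spaces.linear (*s) (*) D \<longleftrightarrow>
    (\<forall>a b. D (a + b) = D a + D b) \<and> (\<forall>c a. D (c *s a) = c * D a)"
  by (auto simp: Vector_Spaces.linear_iff vec.vector_space_axioms
      intro!: vector_space.intro algebra_simps)

text \<open>Only multiplication by i is tested, because a Frechet derivative is already real linear.
  For vector-valued maps \<open>holo_on\<close> reduces to this property componentwise.\<close>

definition holo_fun :: "(complex ^ 'k \<Rightarrow> complex) \<Rightarrow> (complex ^ 'k) set \<Rightarrow> bool" where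
  "holo_fun f S \<longleftrightarrow>
     (\<forall>z\<in>S. f differentiable (at z) \<and> (\<forall>a. fd f z (\<i> *s a) = \<i> * fd f z a))"

lemma holo_funI:
  assumes "\<And>z. z \<in> S \<Longrightarrow> \<exists>D. (f has_derivative D) (at z) \<and> (\<forall>a. D (\<i> *s a) = \<i> * D a)"
  shows "holo_fun f S"
  unfolding holo_fun_def using assms fd_eq by (metis differentiableI)

lemma holo_fun_differentiable: "holo_fun f S \<Longrightarrow> z \<in> S \<Longrightarrow> f differentiable (at z)"
  by (simp add: holo_fun_def)

lemma holo_fun_has_derivative: "holo_fun f S \<Longrightarrow> z \<in> S \<Longrightarrow> (f has_derivative fd f z) (at z)"
  by (simp add: holo_fun_def fd_works)

lemma holo_fun_ii: "holo_fun f S \<Longrightarrow> z \<in> S \<Longrightarrow> fd f z (\<i> *s a) = \<i> * fd f z a"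
  by (simp add: holo_fun_def)

lemma holo_fun_linear: "holo_fun f S \<Longrightarrow> z \<in> S \<Longrightarrow> linear (fd f z)"
  by (simp add: holo_fun_def linear_frechet_derivative)

lemma holo_fun_scale: "holo_fun f S \<Longrightarrow> z \<in> S \<Longrightarrow> fd f z (c *s a) = c * fd f z a"
  by (rule complex_homogeneous_scalar[OF holo_fun_linear holo_fun_ii])

lemma holo_fun_subset: "holo_fun f S \<Longrightarrow> T \<subseteq> S \<Longrightarrow> holo_fun f T"
  by (auto simp: holo_fun_def)

lemma holo_fun_cong:
  assumes "open S" "\<And>z. z \<in> S \<Longrightarrow> f z = g z" "holo_fun f S" shows "holo_fun g S"
proof (rule holo_funI)
  fix z assume "z \<in> S"
  then show "\<exists>D. (g has_derivative D) (at z) \<and> (\<forall>a. D (\<i> *s a) = \<i> * D a)"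
    using has_derivative_transform_within_open[OF holo_fun_has_derivative[OF assms(3)] assms(1)] assms
    by (metis holo_fun_ii)
qed

lemma holo_fun_continuous_on: "holo_fun f S \<Longrightarrow> continuous_on S f"
  by (intro differentiable_imp_continuous_on)
     (auto simp: holo_fun_def differentiable_on_def intro: differentiable_at_withinI)

lemma holo_fun_const [simp]: "holo_fun (\<lambda>z. c) S"
  by (simp add: holo_fun_def)

lemma holo_fun_nth [simp]: "holo_fun (\<lambda>z. z $ i) S"
  by (rule holo_funI, rule exI[of _ "\<lambda>a. a $ i"], rule conjI,
      rule bounded_linear_imp_has_derivative[OF bounded_linear_vec_nth]) simp

lemma holo_fun_add: "holo_fun f S \<Longrightarrow> holo_fun g S \<Longrightarrow> holo_fun (\<lambda>z. f z + g z) S"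
  by (rule holo_funI, rule exI, rule conjI, rule has_derivative_add)
     (auto intro: holo_fun_has_derivative simp: holo_fun_ii algebra_simps)

lemma holo_fun_mult: "holo_fun f S \<Longrightarrow> holo_fun g S \<Longrightarrow> holo_fun (\<lambda>z. f z * g z) S"
  by (rule holo_funI, rule exI, rule conjI, rule has_derivative_mult)
     (auto intro: holo_fun_has_derivative simp: holo_fun_ii algebra_simps)

lemma holo_fun_inverse:
  "holo_fun f S \<Longrightarrow> (\<And>z. z \<in> S \<Longrightarrow> f z \<noteq> 0) \<Longrightarrow> holo_fun (\<lambda>z. inverse (f z)) S"
  by (rule holo_funI, rule exI, rule conjI, rule Deriv.has_derivative_inverse)
     (auto intro: holo_fun_has_derivative simp: holo_fun_ii algebra_simps)

lemma holo_fun_sum: "(\<And>i. i \<in> I \<Longrightarrow> holo_fun (f i) S) \<Longrightarrow> holo_fun (\<lambda>z. \<Sum>i\<in>I. f i z) S"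
  by (induction I rule: infinite_finite_induct) (auto intro: holo_fun_add)

lemma holo_fun_cmult: "holo_fun f S \<Longrightarrow> holo_fun (\<lambda>z. c * f z) S"
  by (intro holo_fun_mult holo_fun_const)

lemma has_derivative_vec:
  "(\<And>i. ((\<lambda>z. f z $ i) has_derivative (\<lambda>a. D a $ i)) (at z)) \<Longrightarrow> (f has_derivative D) (at z)"
  for f :: "'a::real_normed_vector \<Rightarrow> complex ^ 'l"
proof (subst has_derivative_componentwise_within, rule ballI)
  fix b :: "complex ^ 'l"
  assume *: "\<And>i. ((\<lambda>z. f z $ i) has_derivative (\<lambda>a. D a $ i)) (at z)" and "b \<in> Basis"
  then obtain i u where b: "b = axis i u" by (auto simp: Basis_vec_def)
  show "((\<lambda>x. f x \<bullet> b) has_derivative (\<lambda>x. D x \<bullet> b)) (at z)"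
    unfolding b inner_axis by (rule has_derivative_inner_left[OF *])
qed

lemma has_derivative_nth:
  "(f has_derivative D) F \<Longrightarrow> ((\<lambda>z. f z $ i) has_derivative (\<lambda>a. D a $ i)) F"
  by (rule bounded_linear.has_derivative[OF bounded_linear_vec_nth])

lemma holo_on_iff: "holo_on f U \<longleftrightarrow> (\<forall>i. holo_fun (\<lambda>z. f z $ i) U)"
proof
  assume *: "holo_on f U"
  show "\<forall>i. holo_fun (\<lambda>z. f z $ i) U"
  proof (intro allI holo_funI)
    fix i z assume "z \<in> U"
    with * obtain D where "Vector_Spaces.linear (*s) (*s) D" "(f has_derivative D) (at z)"
      by (auto simp: holo_on_def)
    then show "\<exists>D. ((\<lambda>z. f z $ i) has_derivative D) (at z) \<and> (\<forall>a. D (\<i> *s a) = \<i> * D a)"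
      by (intro exI[of _ "\<lambda>a. D a $ i"]) (auto simp: complex_linear_vec has_derivative_nth)
  qed
next
  assume *: "\<forall>i. holo_fun (\<lambda>z. f z $ i) U"
  show "holo_on f U" unfolding holo_on_def
  proof
    fix z assume z: "z \<in> U"
    define D where "D a = (\<chi> i. fd (\<lambda>z. f z $ i) z a)" for a
    have D: "(f has_derivative D) (at z)"
      using * z by (intro has_derivative_vec) (auto simp: D_def intro: holo_fun_has_derivative)
    moreover have "D (\<i> *s a) = \<i> *s D a" for a
      using * z by (auto simp: D_def vec_eq_iff intro: holo_fun_ii)
    ultimately show "\<exists>D. Vector_Spaces.linear (*s) (*s) D \<and> (f has_derivative D) (at z)"
      by (intro exI[of _ D]) (auto simp: complex_linear_vec dest: has_derivative_linear)
  qed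
qed

lemma holo_on_has_derivative:
  "holo_on f U \<Longrightarrow> z \<in> U \<Longrightarrow> (f has_derivative fd f z) (at z)"
  by (auto simp: holo_on_def fd_eq)

lemma holo_on_linear:
  "holo_on f U \<Longrightarrow> z \<in> U \<Longrightarrow> Vector_Spaces.linear (*s) (*s) (fd f z)"
  by (auto simp: holo_on_def fd_eq)

lemma holo_on_continuous_on: "holo_on f U \<Longrightarrow> continuous_on U f"
  by (meson continuous_at_imp_continuous_on has_derivative_continuous holo_on_has_derivative)

lemma fd_nth: "f differentiable (at z) \<Longrightarrow> fd (\<lambda>z. f z $ i) z a = fd f z a $ i"
  by (metis fd_eq fd_works has_derivative_nth)

lemma holo_on_compose:
  assumes "holo_on f U" "holo_on g W" "f ` U \<subseteq> W" shows "holo_on (\<lambda>z. g (f z)) U"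
  unfolding holo_on_def
proof
  fix z assume z: "z \<in> U"
  then have fz: "f z \<in> W" using assms by auto
  have "((\<lambda>z. g (f z)) has_derivative (\<lambda>a. fd g (f z) (fd f z a))) (at z)"
    by (rule has_derivative_compose[OF holo_on_has_derivative[OF assms(1) z] holo_on_has_derivative[OF assms(2) fz]])
  moreover have "Vector_Spaces.linear (*s) (*s) (\<lambda>a. fd g (f z) (fd f z a))"
    using holo_on_linear[OF assms(1) z] holo_on_linear[OF assms(2) fz]
    by (auto simp: Vector_Spaces.linear_iff)
  ultimately show "\<exists>D. Vector_Spaces.linear (*s) (*s) D \<and> ((\<lambda>z. g (f z)) has_derivative D) (at z)" by blast
qed

text \<open>The passage to one complex variable, through which Cauchy's inequality and the
  one-variable limit theorem become applicable in every direction.\<close>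

lemma holo_fun_line:
  assumes "holo_fun f S" "z + w *s a \<in> S"
  shows "((\<lambda>w. f (z + w *s a)) has_field_derivative fd f (z + w *s a) a) (at w)"
proof -
  have "bounded_linear (\<lambda>w::complex. w *s a)"
    by (intro linear_conv_bounded_linear[THEN iffD1] linearI) (auto simp: vec_eq_iff algebra_simps)
  then have "((\<lambda>w. z + w *s a) has_derivative (\<lambda>h. h *s a)) (at w)"
    by (auto intro!: derivative_eq_intros bounded_linear_imp_has_derivative)
  from has_derivative_compose[OF this holo_fun_has_derivative[OF assms]]
  have "((\<lambda>w. f (z + w *s a)) has_derivative (\<lambda>h. fd f (z + w *s a) (h *s a))) (at w)" .
  also have "(\<lambda>h. fd f (z + w *s a) (h *s a)) = (*) (fd f (z + w *s a) a)"
    by (rule ext) (simp add: holo_fun_scale[OF assms] mult.commute)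
  finally show ?thesis by (simp add: has_field_derivative_def)
qed

section \<open>Uniform limits of holomorphic functions and holomorphy of derivatives\<close>

lemma holo_fun_local:
  assumes "\<And>z. z \<in> S \<Longrightarrow> \<exists>T. z \<in> T \<and> holo_fun f T" shows "holo_fun f S"
  using assms by (auto simp: holo_fun_def)

text \<open>The radius \<open>r / norm a\<close> keeps the displacement \<open>w *s a\<close> at
  norm at most \<open>r\<close>, whatever the length of \<open>a\<close>.\<close>

lemma line_in_cball:
  fixes y a :: "complex ^ 'k" and w :: complex
  assumes "y \<in> ball z0 r" "w \<in> cball 0 (r / norm a)" "a \<noteq> 0"
  shows "y + w *s a \<in> cball z0 (2 * r)"
proof -
  have "cmod w * norm a \<le> r" using assms by (simp add: field_simps)
  then have "dist y (y + w *s a) \<le> r" by (simp add: dist_norm norm_smult)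
  with dist_triangle[of z0 "y + w *s a" y] assms(1) show ?thesis by simp
qed

text \<open>Weierstrass's theorem in several variables. On each complex line the one-variable
  theorem gives a directional derivative of \<open>g\<close>. Cauchy's inequality makes the
  convergence of the derivatives uniform on a ball around \<open>z0\<close>, and this uniformity
  turns directional derivatives into a Frechet derivative.\<close>

lemma holo_fun_uniform_limit_aux:
  fixes F :: "nat \<Rightarrow> complex ^ 'k \<Rightarrow> complex"
  assumes S: "open S" and F: "\<And>n. holo_fun (F n) S" and lim: "uniform_limit S F g sequentially"
    and z0: "z0 \<in> S"
  shows "\<exists>D. (g has_derivative D) (at z0) \<and> (\<forall>a. D (\<i> *s a) = \<i> * D a) \<and>
    (\<forall>a. (\<lambda>n. fd (F n) z0 a) \<longlonglongrightarrow> D a)"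
proof -
  obtain r0 where "r0 > 0" and r0: "cball z0 r0 \<subseteq> S" using S z0 open_contains_cball by blast
  define r where "r = r0 / 2"
  then have r: "r > 0" "cball z0 (2 * r) \<subseteq> S" using \<open>r0 > 0\<close> r0 by auto
  define B where "B = ball z0 r"
  have BS: "B \<subseteq> S" using r by (intro order_trans[OF _ r(2)]) (auto simp: B_def)
  have line: "y + w *s a \<in> S" if "y \<in> B" "w \<in> cball 0 (r / norm a)" "a \<noteq> 0" for y w a
    using line_in_cball that r(2) B_def by blast
  \<comment> \<open>The candidate for the Frechet derivative. Its linearity is not known yet; it
    comes out of \<open>has_derivative_sequence\<close>.\<close>
  define G where "G y a = deriv (\<lambda>w. g (y + w *s a)) 0" for y a
  have cont: "continuous_on (cball 0 (r / norm a)) (\<lambda>w. F n (y + w *s a))" if "y \<in> B" "a \<noteq> 0" for n y a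
    by (intro continuous_at_imp_continuous_on ballI DERIV_isCont[OF holo_fun_line[OF F]] line that)
  have claim1: "(\<forall>w\<in>ball 0 (r / norm a). (\<lambda>w. g (y + w *s a)) field_differentiable (at w)) \<and>
      continuous_on (cball 0 (r / norm a)) (\<lambda>w. g (y + w *s a)) \<and>
      (\<lambda>n. fd (F n) y a) \<longlonglongrightarrow> G y a" if y: "y \<in> B" and a: "a \<noteq> 0" for y a
  proof -
    have pos: "r / norm a > 0" using r a by simp
    have ev: "\<forall>\<^sub>F n in sequentially. continuous_on (cball 0 (r / norm a)) (\<lambda>w. F n (y + w *s a)) \<and>
        (\<forall>w\<in>ball 0 (r / norm a). ((\<lambda>w. F n (y + w *s a)) has_field_derivative fd (F n) (y + w *s a) a) (at w))"
      by (intro always_eventually allI conjI cont ballI holo_fun_line[OF F] y a line) auto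
    have ul: "uniform_limit (cball 0 (r / norm a)) (\<lambda>n w. F n (y + w *s a)) (\<lambda>w. g (y + w *s a)) sequentially"
      by (rule uniform_limitI, drule uniform_limitD[OF lim], erule eventually_mono) (use line[OF y _ a] in blast)
    obtain g' where g': "continuous_on (cball 0 (r / norm a)) (\<lambda>w. g (y + w *s a))"
      "\<And>w. w \<in> ball 0 (r / norm a) \<Longrightarrow> ((\<lambda>w. g (y + w *s a)) has_field_derivative (g' w)) (at w) \<and>
         ((\<lambda>n. fd (F n) (y + w *s a) a) \<longlongrightarrow> g' w) sequentially"
      using has_complex_derivative_uniform_limit[OF ev ul _ pos] by auto
    have "G y a = g' 0" unfolding G_def using g'(2)[of 0] pos by (auto intro: DERIV_imp_deriv)
    then show ?thesis using g'(1) pos g'(2)[of 0] g'(2) unfolding field_differentiable_def by auto blast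
  qed
  have G0: "G y 0 = 0" for y by (simp add: G_def)
  have fd0: "fd (F n) y 0 = 0" if "y \<in> B" for n y
    using holo_fun_scale[OF F, of y n 0 0] line[of y 0 "axis undefined 1"] that r by (simp add: axis_eq_0_iff)
  \<comment> \<open>Cauchy's inequality for \<open>F n - g\<close> on the disc of radius
    \<open>r / norm a\<close>. The bound is proportional to \<open>norm a\<close> and independent of
    \<open>y\<close>, as \<open>has_derivative_sequence\<close> demands. The direction 0 has no such
    disc and is settled separately.\<close>
  have claim2: "cmod (fd (F n) y a - G y a) \<le> e / r * norm a"
    if y: "y \<in> B" and e: "\<And>x. x \<in> S \<Longrightarrow> cmod (F n x - g x) \<le> e" for n y a e
  proof (cases "a = 0")
    case True then show ?thesis using fd0 G0 y by simp
  next
    case False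
    define \<phi> where "\<phi> w = F n (y + w *s a) - g (y + w *s a)" for w
    have pos: "r / norm a > 0" using r False by simp
    have c1: "continuous_on (cball 0 (r / norm a)) \<phi>"
      unfolding \<phi>_def using claim1[OF y False] cont[OF y False] by (intro continuous_intros) auto
    have fl: "((\<lambda>w. F n (y + w *s a)) has_field_derivative fd (F n) (y + w *s a) a) (at w)" if "w \<in> ball 0 (r / norm a)" for w
      using that by (intro holo_fun_line[OF F] line y False) auto
    have c2: "\<phi> holomorphic_on ball 0 (r / norm a)"
      unfolding \<phi>_def using claim1[OF y False] fl
      by (intro holomorphic_on_diff; unfold holomorphic_on_open[OF open_ball])
         (blast, simp add: field_differentiable_def)
    have "cmod ((deriv ^^ 1) \<phi> 0) \<le> fact 1 * e / (r / norm a) ^ 1"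
      by (rule Cauchy_inequality[OF c2 c1 pos]) (auto simp: \<phi>_def intro!: e line y False)
    moreover have "deriv \<phi> 0 = fd (F n) y a - G y a"
    proof -
      have "(\<lambda>w. g (y + w *s a)) field_differentiable (at 0)" using claim1[OF y False] pos by auto
      moreover have "((\<lambda>w. F n (y + w *s a)) has_field_derivative fd (F n) y a) (at 0)" using fl[of 0] pos by simp
      ultimately show ?thesis unfolding \<phi>_def G_def
        by (subst deriv_diff) (auto simp: field_differentiable_def DERIV_imp_deriv)
    qed
    ultimately show ?thesis by (simp add: field_simps)
  qed
  have "\<exists>g2. \<forall>x\<in>B. (\<lambda>n. F n x) \<longlonglongrightarrow> g2 x \<and> (g2 has_derivative G x) (at x within B)"
  proof (rule has_derivative_sequence)
    show "convex B" by (simp add: B_def)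
    show "(F n has_derivative fd (F n) x) (at x within B)" if "x \<in> B" for n x
      by (rule has_derivative_at_withinI[OF holo_fun_has_derivative[OF F subsetD[OF BS that]]])
    show "z0 \<in> B" using r by (simp add: B_def)
    show "(\<lambda>n. F n z0) \<longlonglongrightarrow> g z0" by (rule tendsto_uniform_limitI[OF lim z0])
    fix e :: real assume "e > 0"
    \<comment> \<open>The values are made closer than \<open>e * r\<close> because
      \<open>claim2\<close> divides by \<open>r\<close>.\<close>
    then have "e * r > 0" using r by simp
    then have "\<forall>\<^sub>F n in sequentially. \<forall>x\<in>S. dist (F n x) (g x) < e * r" by (rule uniform_limitD[OF lim])
    then show "\<forall>\<^sub>F n in sequentially. \<forall>x\<in>B. \<forall>h. cmod (fd (F n) x h - G x h) \<le> e * norm h"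
    proof (rule eventually_mono, intro ballI allI)
      fix n x h assume *: "\<forall>x\<in>S. dist (F n x) (g x) < e * r" and x: "x \<in> B"
      have "cmod (F n y - g y) \<le> e * r" if "y \<in> S" for y
        using * that by (simp add: dist_norm less_imp_le)
      note c = claim2[OF x this]
      have eq: "e * r / r = e" using r by simp
      show "cmod (fd (F n) x h - G x h) \<le> e * norm h" by (rule c[of h, unfolded eq])
    qed
  qed
  then obtain g2 where g2: "\<And>x. x \<in> B \<Longrightarrow> (\<lambda>n. F n x) \<longlonglongrightarrow> g2 x"
    "\<And>x. x \<in> B \<Longrightarrow> (g2 has_derivative G x) (at x within B)" by blast
  have zB: "z0 \<in> B" using r by (simp add: B_def)
  have "g2 x = g x" if "x \<in> B" for x
    using g2(1)[OF that] tendsto_uniform_limitI[OF lim, of x] subsetD[OF BS that]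
    by (intro LIMSEQ_unique) auto
  moreover have "(g2 has_derivative G z0) (at z0)"
    using g2(2)[OF zB] zB at_within_open[of z0 B] by (simp add: B_def)
  ultimately have D: "(g has_derivative G z0) (at z0)"
    using has_derivative_transform_within_open[of g2 "G z0" z0 UNIV B g] zB by (simp add: B_def)
  have conv: "(\<lambda>n. fd (F n) z0 a) \<longlonglongrightarrow> G z0 a" for a
    using claim1[OF zB] G0 fd0[OF zB] by (cases "a = 0") auto
  have "G z0 (\<i> *s a) = \<i> * G z0 a" for a
    by (rule LIMSEQ_unique[OF conv[of "\<i> *s a", unfolded holo_fun_ii[OF F z0]] tendsto_mult_left[OF conv[of a]]])
  with D conv show ?thesis by blast
qed

lemma holo_fun_uniform_limit:
  assumes "open S" "\<And>n. holo_fun (F n) S" "uniform_limit S F g sequentially"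
  shows "holo_fun g S" and "z \<in> S \<Longrightarrow> (\<lambda>n. fd (F n) z a) \<longlonglongrightarrow> fd g z a"
proof -
  note * = holo_fun_uniform_limit_aux[OF assms]
  show "holo_fun g S" by (rule holo_funI) (use * in blast)
  show "(\<lambda>n. fd (F n) z a) \<longlonglongrightarrow> fd g z a" if "z \<in> S"
    using *[OF that] by (auto dest: fd_eq)
qed

text \<open>This exhibits a directional derivative as a uniform limit of holomorphic functions, so
  that the limit theorem can make it holomorphic. The error of the quotient is governed by the
  second derivative along the line, which Cauchy's inequality bounds uniformly in the base
  point.\<close>

lemma uniform_limit_difference_quotient:
  fixes f :: "complex ^ 'k \<Rightarrow> complex" and b :: "complex ^ 'k"
  assumes f: "holo_fun f S" and r: "r > 0" "cball z0 (4 * r) \<subseteq> S"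
    and h: "h \<longlonglongrightarrow> 0" "\<And>n. h n \<noteq> 0" "\<And>n. cmod (h n) \<le> r / (norm b + 1)"
  shows "uniform_limit (ball z0 r) (\<lambda>n z. (f (z + h n *s b) - f z) / h n) (\<lambda>z. fd f z b) sequentially"
proof -
  \<comment> \<open>Since \<open>\<delta> * norm b \<le> r\<close>, parameters up to
    \<open>2 * \<delta>\<close> stay within \<open>2 * r\<close> of \<open>z\<close>. This leaves
    room for Cauchy discs of radius \<delta> around every parameter of modulus at most \<delta>. The
    summand 1 covers \<open>b = 0\<close>.\<close>
  define \<delta> where "\<delta> = r / (norm b + 1)"
  have \<delta>: "\<delta> > 0" "\<delta> * norm b \<le> r" using r by (auto simp: \<delta>_def field_simps add_pos_nonneg)
  have line: "z + w *s b \<in> cball z0 (4 * r)" if "z \<in> ball z0 r" "cmod w \<le> 2 * \<delta>" for z w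
  proof -
    have "cmod w * norm b \<le> 2 * (\<delta> * norm b)" using mult_right_mono[OF that(2), of "norm b"] by simp
    then have "dist z (z + w *s b) \<le> 2 * r" using \<delta> by (simp add: dist_norm norm_smult)
    with dist_triangle[of z0 "z + w *s b" z] that(1) r show ?thesis by simp
  qed
  have "compact (f ` cball z0 (4 * r))"
    by (intro compact_continuous_image continuous_on_subset[OF holo_fun_continuous_on[OF f]] r compact_cball)
  then obtain K where K: "\<And>x. x \<in> cball z0 (4 * r) \<Longrightarrow> cmod (f x) \<le> K"
    using compact_imp_bounded bounded_iff by (metis imageI)
  \<comment> \<open>The bound of Cauchy's inequality for a second derivative on discs of radius
    \<delta>; the factor 2 is a factorial.\<close>
  define C where "C = 2 * K / \<delta>\<^sup>2"
  have est: "cmod ((f (z + w *s b) - f z) / w - fd f z b) \<le> C * cmod w"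
    if z: "z \<in> ball z0 r" and w: "cmod w \<le> \<delta>" "w \<noteq> 0" for z w
  proof -
    define \<phi> where "\<phi> u = f (z + u *s b)" for u
    have der: "(\<phi> has_field_derivative fd f (z + u *s b) b) (at u)" if "cmod u \<le> 2 * \<delta>" for u
      unfolding \<phi>_def using line[OF z that] r by (intro holo_fun_line[OF f]) auto
    have hol: "\<phi> holomorphic_on ball 0 (2 * \<delta>)"
      unfolding holomorphic_on_open[OF open_ball] using der by force
    have bd: "cmod ((deriv ^^ 2) \<phi> u) \<le> C" if u: "u \<in> cball 0 \<delta>" for u
    proof -
      have sub: "cmod x \<le> 2 * \<delta>" if "x \<in> cball u \<delta>" for x
        using that u norm_triangle_ineq[of u "x - u"] by (simp add: dist_norm norm_minus_commute)
      have "cmod ((deriv ^^ 2) \<phi> u) \<le> fact 2 * K / \<delta> ^ 2"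
      proof (rule Cauchy_inequality)
        show "continuous_on (cball u \<delta>) \<phi>"
          by (intro continuous_at_imp_continuous_on ballI DERIV_isCont[OF der] sub)
        show "\<phi> holomorphic_on ball u \<delta>"
          unfolding holomorphic_on_open[OF open_ball] using der sub by force
        show "\<delta> > 0" by (rule \<delta>)
        fix x assume "cmod (u - x) = \<delta>"
        then have "cmod x \<le> 2 * \<delta>" by (intro sub) (simp add: dist_norm)
        then show "cmod (\<phi> x) \<le> K" unfolding \<phi>_def by (intro K line z)
      qed
      then show ?thesis by (simp add: C_def)
    qed
    have dd: "((deriv ^^ i) \<phi> has_field_derivative (deriv ^^ Suc i) \<phi> x) (at x within cball 0 \<delta>)"
      if "x \<in> cball 0 \<delta>" for x i
    proof -
      have hi: "(deriv ^^ i) \<phi> holomorphic_on ball 0 (2 * \<delta>)"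
        by (rule holomorphic_higher_deriv[OF hol open_ball])
      have "x \<in> ball 0 (2 * \<delta>)" using that \<delta> by simp
      from holomorphic_derivI[OF hi open_ball this] show ?thesis by simp
    qed
    \<comment> \<open>Taylor's formula of order one. Dividing its quadratic remainder by
      \<open>w\<close> leaves one factor \<open>cmod w\<close>.\<close>
    have "cmod ((deriv ^^ 0) \<phi> w - (\<Sum>i\<le>1. (deriv ^^ i) \<phi> 0 * (w - 0) ^ i / fact i)) \<le> C * cmod (w - 0) ^ Suc 1 / fact 1"
    proof (rule complex_Taylor[of "cball 0 \<delta>" 1 "\<lambda>i. (deriv ^^ i) \<phi>"])
      show "cmod ((deriv ^^ Suc 1) \<phi> x) \<le> C" if "x \<in> cball 0 \<delta>" for x
        unfolding Suc_1 by (rule bd[OF that])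
      show "((deriv ^^ i) \<phi> has_field_derivative (deriv ^^ Suc i) \<phi> x) (at x within cball 0 \<delta>)"
        if "x \<in> cball 0 \<delta>" for i x by (rule dd[OF that])
    qed (use w \<delta> in auto)
    moreover have "deriv \<phi> 0 = fd f z b" using der[of 0] \<delta> by (auto intro: DERIV_imp_deriv)
    ultimately have "cmod (f (z + w *s b) - f z - fd f z b * w) \<le> C * cmod w ^ 2"
      by (simp add: \<phi>_def power2_eq_square algebra_simps)
    moreover have "(f (z + w *s b) - f z) / w - fd f z b = (f (z + w *s b) - f z - fd f z b * w) / w"
      using w by (simp add: field_simps)
    ultimately show ?thesis using w
      by (simp add: norm_divide divide_le_eq power2_eq_square mult.assoc)
  qed
  show ?thesis
  proof (rule uniform_limitI)
    fix e :: real assume "e > 0"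
    have "(\<lambda>n. C * cmod (h n)) \<longlonglongrightarrow> C * cmod 0" by (intro tendsto_intros h)
    then have "\<forall>\<^sub>F n in sequentially. C * cmod (h n) < e"
      using \<open>e > 0\<close> by (intro order_tendstoD(2)) auto
    then show "\<forall>\<^sub>F n in sequentially. \<forall>z\<in>ball z0 r. dist ((f (z + h n *s b) - f z) / h n) (fd f z b) < e"
    proof (rule eventually_mono, intro ballI)
      fix n z assume n: "C * cmod (h n) < e" and z: "z \<in> ball z0 r"
      show "dist ((f (z + h n *s b) - f z) / h n) (fd f z b) < e"
        using est[OF z h(3)[folded \<delta>_def] h(2), of n] n by (simp add: dist_norm)
    qed
  qed
qed

text \<open>Holomorphy of the derivative and the limit behind the symmetry of second derivatives
  come from the same difference quotients, so both are extracted together with the sequence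
  \<open>h\<close> of steps.\<close>

lemma holo_fun_fd_aux:
  fixes f :: "complex ^ 'k \<Rightarrow> complex"
  assumes f: "holo_fun f S" and S: "open S" and z0: "z0 \<in> S"
  obtains r h where "r > 0" "ball z0 r \<subseteq> S" "holo_fun (\<lambda>z. fd f z b) (ball z0 r)"
    "h \<longlonglongrightarrow> 0" "\<And>n. h n \<noteq> 0"
    "(\<lambda>n. (fd f (z0 + h n *s b) a - fd f z0 a) / h n) \<longlonglongrightarrow> fd (\<lambda>z. fd f z b) z0 a"
proof -
  obtain r0 where "r0 > 0" and r0: "cball z0 r0 \<subseteq> S" using S z0 open_contains_cball by blast
  define r where "r = r0 / 4"
  then have r: "r > 0" "cball z0 (4 * r) \<subseteq> S" using \<open>r0 > 0\<close> r0 by auto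
  \<comment> \<open>Nonzero steps that tend to 0 and have modulus at most
    \<open>r / (norm b + 1)\<close>, so that a shift by \<open>h n *s b\<close> moves a point by at
    most \<open>r\<close>.\<close>
  define h where "h n = complex_of_real (r / (norm b + 1) / (real n + 1))" for n
  define F where "F n z = (f (z + h n *s b) - f z) / h n" for n z
  have pos: "norm b + 1 > 0" by (rule add_nonneg_pos) simp_all
  have ch: "cmod (h n) = r / (norm b + 1) / (real n + 1)" for n unfolding h_def norm_of_real
    by (rule abs_of_nonneg) (use r pos in \<open>intro divide_nonneg_nonneg; simp\<close>)
  have h0: "h n \<noteq> 0" for n
  proof -
    have "0 < r / (norm b + 1) / (real n + 1)" using r pos by (intro divide_pos_pos) auto
    then show ?thesis using ch[of n] by (metis less_irrefl norm_zero)
  qed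
  have hle: "cmod (h n) \<le> r / (norm b + 1)" for n
    unfolding ch using divide_left_mono[of 1 "real n + 1" "r / (norm b + 1)"] divide_nonneg_pos[OF less_imp_le[OF r(1)] pos]
    by simp
  have hb: "cmod (h n) * norm b \<le> r" for n
  proof -
    have "cmod (h n) * norm b \<le> cmod (h n) * (norm b + 1)" by (intro mult_left_mono) auto
    also have "\<dots> \<le> r" using hle[of n] pos by (simp add: pos_le_divide_eq)
    finally show ?thesis .
  qed
  have "filterlim (\<lambda>n. real n + 1) at_top sequentially"
    using filterlim_tendsto_add_at_top[OF tendsto_const[of 1] filterlim_real_sequentially] by (simp add: add.commute)
  then have "(\<lambda>n. r / (norm b + 1) / (real n + 1)) \<longlonglongrightarrow> 0" by (rule real_tendsto_divide_at_top[OF tendsto_const])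
  then have hlim: "h \<longlonglongrightarrow> 0" unfolding h_def by (metis tendsto_of_real of_real_0)
  have shift: "z + h n *s b \<in> cball z0 (4 * r)" if "z \<in> ball z0 r" for z n
  proof -
    have "dist z (z + h n *s b) \<le> r" using hb by (simp add: dist_norm norm_smult)
    with dist_triangle[of z0 "z + h n *s b" z] that r show ?thesis by simp
  qed
  have sub: "ball z0 r \<subseteq> S" using r by (auto simp: subset_eq)
  have der: "(F n has_derivative (\<lambda>a. (fd f (z + h n *s b) a - fd f z a) / h n)) (at z)" if "z \<in> ball z0 r" for n z
  proof -
    have 1: "((\<lambda>z. z + h n *s b) has_derivative (\<lambda>a. a)) (at z)" by (auto intro!: derivative_eq_intros)
    have "(f has_derivative fd f (z + h n *s b)) (at (z + h n *s b))"
      using shift[OF that] r by (intro holo_fun_has_derivative[OF f]) auto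
    from has_derivative_compose[OF 1 this] holo_fun_has_derivative[OF f, of z] that sub
    have "((\<lambda>z. inverse (h n) * (f (z + h n *s b) - f z)) has_derivative (\<lambda>a. inverse (h n) * (fd f (z + h n *s b) a - fd f z a))) (at z)"
      by (intro has_derivative_mult_right has_derivative_diff) auto
    then show ?thesis unfolding F_def[abs_def] by (simp only: divide_inverse mult.commute)
  qed
  have F: "holo_fun (F n) (ball z0 r)" for n
  proof (rule holo_funI)
    fix z assume z: "z \<in> ball z0 r"
    then have "(fd f (z + h n *s b) (\<i> *s a) - fd f z (\<i> *s a)) / h n = \<i> * ((fd f (z + h n *s b) a - fd f z a) / h n)" for a
      using shift[OF z] r sub holo_fun_ii[OF f, of "z + h n *s b" a] holo_fun_ii[OF f, of z a]
      by (simp add: algebra_simps subset_eq)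
    with der[OF z] show "\<exists>D. (F n has_derivative D) (at z) \<and> (\<forall>a. D (\<i> *s a) = \<i> * D a)" by blast
  qed
  have ul: "uniform_limit (ball z0 r) F (\<lambda>z. fd f z b) sequentially"
    unfolding F_def by (rule uniform_limit_difference_quotient[OF f r hlim h0 hle])
  note lim = holo_fun_uniform_limit[OF open_ball F ul]
  have "(\<lambda>n. (fd f (z0 + h n *s b) a - fd f z0 a) / h n) \<longlonglongrightarrow> fd (\<lambda>z. fd f z b) z0 a"
    using lim(2)[of z0 a] fd_eq[OF der[of z0]] r by simp
  then show ?thesis using that[of r h] r sub lim(1) hlim h0 by blast
qed

lemma holo_fun_fd:
  assumes "holo_fun f S" "open S" shows "holo_fun (\<lambda>z. fd f z b) S"
proof (rule holo_fun_local)
  fix z assume "z \<in> S"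
  from holo_fun_fd_aux[OF assms this] obtain r
    where "r > 0" "holo_fun (\<lambda>z. fd f z b) (ball z r)" .
  then show "\<exists>T. z \<in> T \<and> holo_fun (\<lambda>z. fd f z b) T"
    by (intro exI[of _ "ball z r"]) simp
qed

text \<open>The quotient of \<open>fd f\<close> in direction \<open>a\<close> along the steps
  \<open>h n *s b\<close> tends to one iterated derivative because the derivatives of the difference
  quotients converge, and to the other one by the definition of a derivative.\<close>

lemma holo_fun_second_symmetric:
  assumes f: "holo_fun f S" and S: "open S" and z0: "z0 \<in> S"
  shows "fd (\<lambda>z. fd f z b) z0 a = fd (\<lambda>z. fd f z a) z0 b"
proof -
  obtain h where h: "h \<longlonglongrightarrow> 0" "\<And>n. h n \<noteq> 0"
    "(\<lambda>n. (fd f (z0 + h n *s b) a - fd f z0 a) / h n) \<longlonglongrightarrow> fd (\<lambda>z. fd f z b) z0 a"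
    by (rule holo_fun_fd_aux[OF assms, where a=a and b=b]) (rule that, assumption+)
  have "((\<lambda>w. fd f (z0 + w *s b) a) has_field_derivative fd (\<lambda>z. fd f z a) z0 b) (at 0)"
    using holo_fun_line[OF holo_fun_fd[OF f S], of z0 0 b a] z0 by simp
  then have "((\<lambda>w. (fd f (z0 + w *s b) a - fd f z0 a) / w) \<longlongrightarrow> fd (\<lambda>z. fd f z a) z0 b) (at 0)"
    by (simp add: DERIV_def)
  then have "(\<lambda>n. (fd f (z0 + h n *s b) a - fd f z0 a) / h n) \<longlonglongrightarrow> fd (\<lambda>z. fd f z a) z0 b"
    by (rule filterlim_compose) (use h in \<open>auto simp: filterlim_at\<close>)
  with h(3) show ?thesis by (rule LIMSEQ_unique)
qed

section \<open>Second derivatives and the Levi form\<close>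

lemma fd_cong:
  assumes "open S" "z \<in> S" "\<And>y. y \<in> S \<Longrightarrow> f y = g y" shows "fd f z = fd g z"
proof -
  have "(f has_derivative D) (at z) = (g has_derivative D) (at z)" for D
    using has_derivative_transform_within_open[of f D z UNIV S g]
      has_derivative_transform_within_open[of g D z UNIV S f] assms by auto
  then show ?thesis by (simp add: frechet_derivative_def)
qed

lemma differentiable_cong:
  assumes "open S" "z \<in> S" "\<And>y. y \<in> S \<Longrightarrow> f y = g y" "f differentiable (at z)"
  shows "g differentiable (at z)"
  using assms has_derivative_transform_within_open[of f _ z UNIV S g]
  unfolding differentiable_def by auto

text \<open>The class in which the potential lives: unlike the holomorphic functions, it is closed
  under conjugation. Differentiability of \<open>fd f y a\<close> is asked for one direction
  \<open>a\<close> at a time, which matches the way \<open>hess\<close> differentiates.\<close>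

definition twice_diff :: "('a::real_normed_vector \<Rightarrow> complex) \<Rightarrow> 'a set \<Rightarrow> bool" where
  "twice_diff f S \<longleftrightarrow>
     (\<forall>z\<in>S. f differentiable (at z) \<and> (\<forall>a. (\<lambda>y. fd f y a) differentiable (at z)))"

lemma twice_diffI:
  assumes "open S" "\<And>z. z \<in> S \<Longrightarrow> (f has_derivative D z) (at z)"
    "\<And>z a. z \<in> S \<Longrightarrow> (\<lambda>y. D y a) differentiable (at z)"
  shows "twice_diff f S"
  unfolding twice_diff_def
proof (intro ballI conjI allI)
  fix z a assume z: "z \<in> S"
  show "f differentiable (at z)" using assms(2)[OF z] by (rule differentiableI)
  show "(\<lambda>y. fd f y a) differentiable (at z)"
    by (rule differentiable_cong[OF assms(1) z _ assms(3)[OF z, of a]]) (simp add: fd_eq[OF assms(2)])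
qed

lemma twice_diff_has_derivative: "twice_diff f S \<Longrightarrow> z \<in> S \<Longrightarrow> (f has_derivative fd f z) (at z)"
  by (simp add: twice_diff_def fd_works)

lemma twice_diff_fd: "twice_diff f S \<Longrightarrow> z \<in> S \<Longrightarrow> (\<lambda>y. fd f y a) differentiable (at z)"
  by (simp add: twice_diff_def)

lemma twice_diff_differentiable: "twice_diff f S \<Longrightarrow> z \<in> S \<Longrightarrow> f differentiable (at z)"
  by (simp add: twice_diff_def)

lemma twice_diff_linear: "twice_diff f S \<Longrightarrow> z \<in> S \<Longrightarrow> linear (fd f z)"
  by (simp add: twice_diff_def linear_frechet_derivative)

lemma twice_diff_cong:
  assumes "open S" "twice_diff f S" "\<And>z. z \<in> S \<Longrightarrow> f z = g z" shows "twice_diff g S"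
proof (rule twice_diffI[OF assms(1), of _ "\<lambda>y. fd f y"])
  fix z assume z: "z \<in> S"
  show "(g has_derivative fd f z) (at z)"
    by (rule has_derivative_transform_within_open[OF twice_diff_has_derivative[OF assms(2) z] assms(1) z])
       (rule assms(3))
qed (rule twice_diff_fd[OF assms(2)])

lemma twice_diff_const: "twice_diff (\<lambda>z. c) S"
  by (simp add: twice_diff_def)

lemma twice_diff_add:
  assumes "open S" "twice_diff f S" "twice_diff g S" shows "twice_diff (\<lambda>z. f z + g z) S"
  by (rule twice_diffI[OF assms(1), of _ "\<lambda>z a. fd f z a + fd g z a"])
     (simp_all add: has_derivative_add twice_diff_has_derivative[OF assms(2)] twice_diff_has_derivative[OF assms(3)]
       differentiable_add twice_diff_fd[OF assms(2)] twice_diff_fd[OF assms(3)])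

lemma twice_diff_mult:
  assumes "open S" "twice_diff f S" "twice_diff g S" shows "twice_diff (\<lambda>z. f z * g z) S"
proof (rule twice_diffI[OF assms(1)])
  fix z assume z: "z \<in> S"
  note d = twice_diff_has_derivative[OF assms(2) z] twice_diff_has_derivative[OF assms(3) z]
    twice_diff_fd[OF assms(2) z] twice_diff_fd[OF assms(3) z]
  show "((\<lambda>z. f z * g z) has_derivative (\<lambda>a. f z * fd g z a + fd f z a * g z)) (at z)"
    by (rule has_derivative_mult[OF d(1,2)])
  show "(\<lambda>z. f z * fd g z a + fd f z a * g z) differentiable (at z)" for a
    by (intro differentiable_add differentiable_mult d differentiableI[OF d(1)] differentiableI[OF d(2)])
qed

lemma twice_diff_inverse:
  assumes "open S" "twice_diff f S" "\<And>z. z \<in> S \<Longrightarrow> f z \<noteq> 0" shows "twice_diff (\<lambda>z. inverse (f z)) S"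
proof (rule twice_diffI[OF assms(1)])
  fix z assume z: "z \<in> S"
  note d = twice_diff_has_derivative[OF assms(2) z] twice_diff_fd[OF assms(2) z]
  show "((\<lambda>z. inverse (f z)) has_derivative (\<lambda>a. - (inverse (f z) * fd f z a * inverse (f z)))) (at z)"
    by (rule Deriv.has_derivative_inverse[OF assms(3)[OF z] d(1)])
  show "(\<lambda>z. - (inverse (f z) * fd f z a * inverse (f z))) differentiable (at z)" for a
    by (intro differentiable_minus differentiable_mult differentiable_inverse d(2) differentiableI[OF d(1)] assms(3)[OF z])
qed

lemma twice_diff_cnj:
  assumes "open S" "twice_diff f S" shows "twice_diff (\<lambda>z. cnj (f z)) S"
proof (rule twice_diffI[OF assms(1)])
  fix z assume z: "z \<in> S"
  show "((\<lambda>z. cnj (f z)) has_derivative (\<lambda>a. cnj (fd f z a))) (at z)"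
    by (rule bounded_linear.has_derivative[OF bounded_linear_cnj twice_diff_has_derivative[OF assms(2) z]])
  show "(\<lambda>z. cnj (fd f z a)) differentiable (at z)" for a
    using bounded_linear.has_derivative[OF bounded_linear_cnj fd_works[OF twice_diff_fd[OF assms(2) z]]]
    by (rule differentiableI)
qed

lemma holo_fun_twice_diff: "holo_fun f S \<Longrightarrow> open S \<Longrightarrow> twice_diff f S"
  by (simp add: twice_diff_def holo_fun_differentiable[OF holo_fun_fd] holo_fun_differentiable)

lemma twice_diff_sum:
  assumes "open S" "\<And>i. i \<in> I \<Longrightarrow> twice_diff (f i) S" shows "twice_diff (\<lambda>z. \<Sum>i\<in>I. f i z) S"
  using assms(2) by (induction I rule: infinite_finite_induct) (auto intro: twice_diff_add twice_diff_const assms(1))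

definition hess :: "(complex ^ 'k \<Rightarrow> complex) \<Rightarrow> complex ^ 'k \<Rightarrow> complex ^ 'k \<Rightarrow> complex ^ 'k \<Rightarrow> complex" where
  "hess K z a b = fd (\<lambda>y. fd K y b) z a"

text \<open>
  \<open>levi K z\<close> is the Hermitian form with coefficients \<open>\<partial>\<^sup>2K/\<partial>z\<^sup>I\<partial>z-bar\<^sup>J\<close>, expressed by the real
  second derivative of \<open>K\<close>.
\<close>

definition levi :: "(complex ^ 'k \<Rightarrow> complex) \<Rightarrow> complex ^ 'k \<Rightarrow> complex ^ 'k \<Rightarrow> complex ^ 'k \<Rightarrow> complex" where
  "levi K z a b =
     (hess K z a b + \<i> * hess K z a (\<i> *s b) - \<i> * hess K z (\<i> *s a) b + hess K z (\<i> *s a) (\<i> *s b)) / 4"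

lemma levi_cong:
  assumes "open S" "z \<in> S" "\<And>y. y \<in> S \<Longrightarrow> f y = g y" shows "levi f z = levi g z"
proof -
  have "hess f z a b = hess g z a b" for a b
    unfolding hess_def
    by (rule fun_cong[OF fd_cong[OF assms(1,2)]]) (simp add: fd_cong[OF assms(1) _ assms(3)])
  then show ?thesis by (intro ext) (simp add: levi_def)
qed

lemma linear_hess_left: "twice_diff K S \<Longrightarrow> z \<in> S \<Longrightarrow> linear (\<lambda>a. hess K z a b)"
  unfolding hess_def by (intro linear_frechet_derivative twice_diff_fd)

lemma linear_hess_right:
  assumes "twice_diff K S" "open S" "z \<in> S" shows "linear (hess K z a)"
proof (rule linearI)
  fix b c
  have "((\<lambda>y. fd K y b + fd K y c) has_derivative (\<lambda>a. hess K z a b + hess K z a c)) (at z)"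
    unfolding hess_def by (intro has_derivative_add fd_works twice_diff_fd[OF assms(1,3)])
  moreover have "fd (\<lambda>y. fd K y (b + c)) z = fd (\<lambda>y. fd K y b + fd K y c) z"
    by (rule fd_cong[OF assms(2,3)]) (simp add: linear_add[OF twice_diff_linear[OF assms(1)]])
  ultimately show "hess K z a (b + c) = hess K z a b + hess K z a c"
    by (simp add: fd_eq hess_def)
next
  fix r b
  have "((\<lambda>y. r *\<^sub>R fd K y b) has_derivative (\<lambda>a. r *\<^sub>R hess K z a b)) (at z)"
    unfolding hess_def by (intro has_derivative_scaleR_right fd_works twice_diff_fd[OF assms(1,3)])
  moreover have "fd (\<lambda>y. fd K y (r *\<^sub>R b)) z = fd (\<lambda>y. r *\<^sub>R fd K y b) z"
    by (rule fd_cong[OF assms(2,3)]) (simp add: linear_cmul[OF twice_diff_linear[OF assms(1)]])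
  ultimately show "hess K z a (r *\<^sub>R b) = r *\<^sub>R hess K z a b"
    by (simp add: fd_eq hess_def)
qed

lemma ii_smult_ii: "\<i> *s (\<i> *s a) = - (a :: complex ^ 'k)"
  by (simp add: vec_eq_iff flip: mult.assoc)

lemma complex_linear_expand:
  fixes D :: "complex ^ 'k \<Rightarrow> complex"
  assumes "linear D" "\<And>a. D (\<i> *s a) = \<i> * D a"
  shows "D a = (\<Sum>I\<in>UNIV. a $ I * D (axis I 1))"
proof -
  have "D a = D (\<Sum>I\<in>UNIV. a $ I *s axis I 1)" by (simp add: basis_expansion)
  also have "\<dots> = (\<Sum>I\<in>UNIV. a $ I * D (axis I 1))"
    by (simp add: linear_sum[OF assms(1)] complex_homogeneous_scalar[OF assms])
  finally show ?thesis .
qed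

text \<open>The Hessian is only real bilinear. Multiplying an argument by i permutes the four terms
  of \<open>levi\<close> with the right factors, which makes \<open>levi\<close> linear in
  \<open>a\<close> and antilinear in \<open>b\<close>.\<close>

lemma levi_expand:
  assumes K: "twice_diff K S" "open S" "z \<in> S"
  shows "levi K z a b = (\<Sum>I\<in>UNIV. \<Sum>J\<in>UNIV. levi K z (axis I 1) (axis J 1) * a $ I * cnj (b $ J))"
proof -
  note l = linear_hess_left[OF K(1,3)] linear_hess_right[OF K]
  note s = linear_add[OF l(1)] linear_add[OF l(2)] linear_cmul[OF l(1)] linear_cmul[OF l(2)]
    linear_neg[OF l(1)] linear_neg[OF l(2)] ii_smult_ii
  have add: "\<i> *s (u + v) = \<i> *s u + \<i> *s v" "\<i> *s (r *\<^sub>R u) = r *\<^sub>R (\<i> *s u)" for r and u v :: "complex ^ 'a"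
    by (auto simp: vec_eq_iff algebra_simps)
  have sc: "r *\<^sub>R c = complex_of_real r * c" for r and c :: complex by (rule scaleR_conv_of_real)
  have 1: "levi K z a b = (\<Sum>I\<in>UNIV. a $ I * levi K z (axis I 1) b)" for a b
  proof (rule complex_linear_expand)
    show "linear (\<lambda>a. levi K z a b)"
      by (rule linearI) (simp_all add: levi_def add s algebra_simps sc add_divide_distrib diff_divide_distrib)
    show "levi K z (\<i> *s a) b = \<i> * levi K z a b" for a
      by (simp add: levi_def s algebra_simps)
  qed
  \<comment> \<open>Conjugation makes the antilinear second argument linear, so that the same
    expansion applies.\<close>
  have "cnj (levi K z a b) = (\<Sum>J\<in>UNIV. b $ J * cnj (levi K z a (axis J 1)))" for a b
  proof (rule complex_linear_expand)
    show "linear (\<lambda>b. cnj (levi K z a b))"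
      by (rule linearI) (simp_all add: levi_def add s algebra_simps sc add_divide_distrib diff_divide_distrib)
    show "cnj (levi K z a (\<i> *s b)) = \<i> * cnj (levi K z a b)" for b
    proof -
      have "levi K z a (\<i> *s b) = - (\<i> * levi K z a b)"
        by (simp add: levi_def s algebra_simps) (simp add: add_divide_distrib diff_divide_distrib algebra_simps)
      then show ?thesis by simp
    qed
  qed
  then have 2: "levi K z a b = (\<Sum>J\<in>UNIV. cnj (b $ J) * levi K z a (axis J 1))" for a b
    by (metis (mono_tags, lifting) complex_cnj_cnj cnj_sum complex_cnj_mult sum.cong)
  show ?thesis
    by (subst 1, rule sum.cong[OF refl], subst 2) (simp add: sum_distrib_left algebra_simps)
qed

lemma pderiv_along_eq:
  assumes "f differentiable (at z)" shows "pderiv_along f e z = fd f z e"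
proof -
  have 1: "((\<lambda>t::real. z + t *\<^sub>R e) has_derivative (\<lambda>t. t *\<^sub>R e)) (at 0)"
    by (auto intro!: derivative_eq_intros)
  have "(f has_derivative fd f z) (at (z + 0 *\<^sub>R e))" using fd_works[OF assms] by simp
  from has_derivative_compose[OF 1 this]
  have "((\<lambda>t::real. f (z + t *\<^sub>R e)) has_vector_derivative fd f z e) (at 0)"
    by (simp add: has_vector_derivative_def linear_cmul[OF linear_frechet_derivative[OF assms]])
  then show ?thesis unfolding pderiv_along_def by (rule vector_derivative_at)
qed

text \<open>The two Wirtinger operators expand into exactly the four terms of \<open>levi\<close>,
  the factor 1/4 being the product of their halves. This is the link from the definition of
  \<open>metric_G\<close> to Levi forms.\<close>

lemma wirtinger_wirtinger_bar:
  assumes K: "twice_diff K S" "open S" "z \<in> S"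
  shows "wirtinger I (wirtinger_bar J K) z = levi K z (axis I 1) (axis J 1)"
proof -
  define F where "F y = (fd K y (axis J 1) + \<i> * fd K y (axis J \<i>)) / 2" for y
  have eq: "wirtinger_bar J K y = F y" if "y \<in> S" for y
    unfolding wirtinger_bar_def F_def using twice_diff_differentiable[OF K(1) that] by (simp add: pderiv_along_eq)
  have F: "(F has_derivative (\<lambda>a. (hess K z a (axis J 1) + \<i> * hess K z a (axis J \<i>)) / 2)) (at z)"
    unfolding F_def hess_def
    using fd_works[OF twice_diff_fd[OF K(1,3)]]
    by (auto intro!: derivative_eq_intros)
  have W: "(wirtinger_bar J K has_derivative (\<lambda>a. (hess K z a (axis J 1) + \<i> * hess K z a (axis J \<i>)) / 2)) (at z)"
    by (rule has_derivative_transform_within_open[OF F K(2,3)]) (simp add: eq)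
  have ax: "axis L \<i> = \<i> *s axis L 1" for L :: 'a
    by (simp add: vec_eq_iff axis_def)
  show ?thesis
    unfolding wirtinger_def pderiv_along_eq[OF differentiableI[OF W]] fd_eq[OF W] levi_def ax
    by (simp add: field_simps)
qed

lemma levi_eq_wirtinger:
  assumes "twice_diff K S" "open S" "z \<in> S"
  shows "(\<Sum>I\<in>UNIV. \<Sum>J\<in>UNIV. wirtinger I (wirtinger_bar J K) z * a $ I * cnj (b $ J)) = levi K z a b"
  by (subst levi_expand[OF assms]) (simp add: wirtinger_wirtinger_bar[OF assms])

text \<open>Let B be the Hessian of \<open>h\<close> at \<open>a\<close>, \<open>b\<close>. Symmetry
  of second derivatives makes it complex linear in \<open>b\<close> as well as in \<open>a\<close>,
  so the four additional terms are Re B, i Re (i B), - i Re (i B) and Re (- B), whose sum is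
  0.\<close>

lemma levi_add_pluriharmonic:
  assumes K: "twice_diff K S" "open S" "z \<in> S" and h: "holo_fun h S"
  shows "levi (\<lambda>y. K y + complex_of_real (Re (h y))) z a b = levi K z a b"
proof -
  have fd1: "fd (\<lambda>y. K y + complex_of_real (Re (h y))) y b = fd K y b + complex_of_real (Re (fd h y b))" if y: "y \<in> S" for y b
    using fd_eq[OF has_derivative_add[OF twice_diff_has_derivative[OF K(1) y]
        has_derivative_of_real[OF bounded_linear.has_derivative[OF bounded_linear_Re holo_fun_has_derivative[OF h y]]]]]
    by simp
  have h2: "hess (\<lambda>y. K y + complex_of_real (Re (h y))) z a b = hess K z a b + complex_of_real (Re (hess h z a b))" for a b
  proof -
    have "fd (\<lambda>y. fd (\<lambda>y. K y + complex_of_real (Re (h y))) y b) z = fd (\<lambda>y. fd K y b + complex_of_real (Re (fd h y b))) z"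
      by (rule fd_cong[OF K(2,3)]) (rule fd1)
    also have "\<dots> = (\<lambda>a. hess K z a b + complex_of_real (Re (hess h z a b)))"
      unfolding hess_def
      by (intro fd_eq has_derivative_add has_derivative_of_real bounded_linear.has_derivative[OF bounded_linear_Re] fd_works
          twice_diff_fd[OF K(1,3)] holo_fun_differentiable[OF holo_fun_fd[OF h K(2)] K(3)])
    finally show ?thesis by (simp add: hess_def[of "\<lambda>y. K y + complex_of_real (Re (h y))"])
  qed
  have "hess h z (\<i> *s a) b = \<i> * hess h z a b" for a b
    unfolding hess_def by (rule holo_fun_ii[OF holo_fun_fd[OF h K(2)] K(3)])
  moreover have "hess h z a (\<i> *s b) = \<i> * hess h z a b" for a b
    unfolding hess_def holo_fun_second_symmetric[OF h K(2,3), of "\<i> *s b"] holo_fun_second_symmetric[OF h K(2,3), of b]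
    by (rule holo_fun_ii[OF holo_fun_fd[OF h K(2)] K(3)])
  ultimately show ?thesis unfolding levi_def h2 by (simp add: algebra_simps)
qed

text \<open>The chain rule contributes the first derivative of \<open>K\<close> applied to the
  second derivative of \<open>f\<close>. The latter is complex bilinear, so these contributions
  cancel in the four terms of \<open>levi\<close>, and the Hessian of \<open>K\<close> on the
  transported vectors remains.\<close>

lemma levi_pullback:
  fixes f :: "complex ^ 'k \<Rightarrow> complex ^ 'l"
  assumes f: "holo_on f S" and S: "open S" and fS: "f ` S \<subseteq> T" and T: "open T"
    and K: "twice_diff K T" and z: "z \<in> S"
  shows "levi (\<lambda>y. K (f y)) z a b = levi K (f z) (fd f z a) (fd f z b)"
proof -
  have comp: "holo_fun (\<lambda>y. f y $ j) S" for j using f by (simp add: holo_on_iff)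
  have fT: "f y \<in> T" if "y \<in> S" for y using fS that by auto
  define G where "G b a = (\<chi> j. hess (\<lambda>y. f y $ j) z a b)" for a b
  have G: "((\<lambda>y. fd f y b) has_derivative G b) (at z)" for b
  proof (rule has_derivative_vec)
    fix j
    have "((\<lambda>y. fd (\<lambda>x. f x $ j) y b) has_derivative (\<lambda>a. G b a $ j)) (at z)"
      unfolding G_def hess_def
      using holo_fun_has_derivative[OF holo_fun_fd[OF comp S] z] by simp
    then show "((\<lambda>y. fd f y b $ j) has_derivative (\<lambda>a. G b a $ j)) (at z)"
      by (rule has_derivative_transform_within_open[OF _ S z])
         (rule fd_nth[OF differentiableI[OF holo_on_has_derivative[OF f]]])
  qed
  have G1: "G b (\<i> *s a) = \<i> *s G b a" for a b
    unfolding G_def hess_def by (simp add: vec_eq_iff holo_fun_ii[OF holo_fun_fd[OF comp S] z])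
  have G2: "G (\<i> *s b) a = \<i> *s G b a" for a b
  proof -
    have "hess (\<lambda>y. f y $ j) z a (\<i> *s b) = \<i> * hess (\<lambda>y. f y $ j) z a b" for j
      unfolding hess_def holo_fun_second_symmetric[OF comp S z, where b="\<i> *s b"] holo_fun_second_symmetric[OF comp S z, where b=b]
      by (rule holo_fun_ii[OF holo_fun_fd[OF comp S] z])
    then show ?thesis by (simp add: G_def vec_eq_iff)
  qed
  have fl: "linear (fd f z)" "fd f z (\<i> *s a) = \<i> *s fd f z a" for a
    using holo_on_linear[OF f z] by (auto simp: complex_linear_vec)
  have Kl: "linear (fd K (f z))" by (rule twice_diff_linear[OF K fT[OF z]])
  have hess: "hess (\<lambda>y. K (f y)) z a b = hess K (f z) (fd f z a) (fd f z b) + fd K (f z) (G b a)" for a b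
  proof -
    \<comment> \<open>In \<open>fd K (f y) (fd f y b)\<close> both the point and the direction move
      with \<open>y\<close>, while \<open>twice_diff\<close> allows differentiation in a fixed
      direction. Expanding over a real basis separates the two.\<close>
    have rep: "L v = (\<Sum>e\<in>Basis. (v \<bullet> e) *\<^sub>R L e)" if "linear L" for L :: "complex ^ 'l \<Rightarrow> complex" and v
      by (subst euclidean_representation[of v, symmetric]) (simp only: linear_sum[OF that] linear_cmul[OF that])
    have 1: "fd (\<lambda>y. K (f y)) y b = (\<Sum>e\<in>Basis. (fd f y b \<bullet> e) *\<^sub>R fd K (f y) e)" if y: "y \<in> S" for y
      by (rule trans[OF fun_cong[OF fd_eq[OF has_derivative_compose[OF holo_on_has_derivative[OF f y]
            twice_diff_has_derivative[OF K fT[OF y]]]]] rep[OF twice_diff_linear[OF K fT[OF y]]]])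
    have "((\<lambda>y. \<Sum>e\<in>Basis. (fd f y b \<bullet> e) *\<^sub>R fd K (f y) e) has_derivative
        (\<lambda>a. \<Sum>e\<in>Basis. (fd f z b \<bullet> e) *\<^sub>R hess K (f z) (fd f z a) e + (G b a \<bullet> e) *\<^sub>R fd K (f z) e)) (at z)"
      unfolding hess_def
      by (intro has_derivative_sum has_derivative_scaleR has_derivative_inner_left G
          has_derivative_compose[OF holo_on_has_derivative[OF f z] fd_works[OF twice_diff_fd[OF K fT[OF z]]]])
    moreover have "fd (\<lambda>y. fd (\<lambda>y. K (f y)) y b) z = fd (\<lambda>y. \<Sum>e\<in>Basis. (fd f y b \<bullet> e) *\<^sub>R fd K (f y) e) z"
      by (rule fd_cong[OF S z 1])
    ultimately have "hess (\<lambda>y. K (f y)) z a b =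
        (\<Sum>e\<in>Basis. (fd f z b \<bullet> e) *\<^sub>R hess K (f z) (fd f z a) e + (G b a \<bullet> e) *\<^sub>R fd K (f z) e)"
      unfolding hess_def[of "\<lambda>y. K (f y)"] by (simp add: fd_eq)
    then show ?thesis
      unfolding sum.distrib rep[OF Kl, of "G b a", symmetric]
        rep[OF linear_hess_right[OF K T fT[OF z]], of "fd f z a" "fd f z b", symmetric] .
  qed
  show ?thesis unfolding levi_def hess G1 G2 fl ii_smult_ii linear_neg[OF Kl] by (simp add: algebra_simps)
qed

text \<open>Cramer's rule: the solution is a quotient of polynomials in the coefficients and
  right-hand sides. The property \<open>P\<close> stays abstract because the rule is applied to
  holomorphic functions and, where conjugates occur, to twice differentiable ones.\<close>

lemma linear_system_closed:
  fixes P :: "('z \<Rightarrow> complex) \<Rightarrow> bool" and A :: "'z \<Rightarrow> 'n::finite \<Rightarrow> 'n \<Rightarrow> complex"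
  assumes const: "\<And>c. P (\<lambda>_. c)"
    and add: "\<And>f g. P f \<Longrightarrow> P g \<Longrightarrow> P (\<lambda>z. f z + g z)"
    and mult: "\<And>f g. P f \<Longrightarrow> P g \<Longrightarrow> P (\<lambda>z. f z * g z)"
    and inv: "\<And>f. P f \<Longrightarrow> (\<And>z. z \<in> S \<Longrightarrow> f z \<noteq> 0) \<Longrightarrow> P (\<lambda>z. inverse (f z))"
    and cong: "\<And>f g. P f \<Longrightarrow> (\<And>z. z \<in> S \<Longrightarrow> f z = g z) \<Longrightarrow> P g"
    and A: "\<And>i j. P (\<lambda>z. A z i j)" and b: "\<And>i. P (\<lambda>z. b z i)"
    and inj: "\<And>z a. z \<in> S \<Longrightarrow> (\<And>i. (\<Sum>j\<in>UNIV. A z i j * a j) = 0) \<Longrightarrow> a = (\<lambda>_. 0)"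
    and sol: "\<And>z i. z \<in> S \<Longrightarrow> (\<Sum>j\<in>UNIV. A z i j * s z j) = b z i"
  shows "P (\<lambda>z. s z j)"
proof -
  have sum: "P (\<lambda>z. \<Sum>i\<in>I. f i z)" if "\<And>i. i \<in> I \<Longrightarrow> P (f i)" for I and f :: "'i \<Rightarrow> 'z \<Rightarrow> complex"
    using that by (induction I rule: infinite_finite_induct) (auto intro: add const)
  have prod: "P (\<lambda>z. \<Prod>i\<in>I. f i z)" if "\<And>i. i \<in> I \<Longrightarrow> P (f i)" for I and f :: "'i \<Rightarrow> 'z \<Rightarrow> complex"
    using that by (induction I rule: infinite_finite_induct) (auto intro: mult const)
  have det: "P (\<lambda>z. det (\<chi> i j. C z i j :: complex ^ 'n ^ 'n))" if "\<And>i j. P (\<lambda>z. C z i j)" for C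
    unfolding det_def by (auto intro!: sum prod mult const that)
  define M where "M z = (\<chi> i j. A z i j)" for z
  have nz: "det (M z) \<noteq> 0" if z: "z \<in> S" for z
  proof -
    have "x = 0" if "M z *v x = 0" for x
    proof -
      have "(\<Sum>j\<in>UNIV. A z i j * x $ j) = 0" for i
        using that by (simp add: M_def matrix_vector_mult_def vec_eq_iff)
      then have "(\<lambda>j. x $ j) = (\<lambda>_. 0)" by (rule inj[OF z])
      then show ?thesis by (metis vec_eq_iff zero_index)
    qed
    then have "\<exists>B. B ** M z = mat 1" by (simp add: matrix_left_invertible_ker)
    then show ?thesis using invertible_det_nz matrix_left_right_inverse unfolding invertible_def by blast
  qed
  have eq: "s z j = det (\<chi> i k. if k = j then b z i else A z i k) * inverse (det (M z))" if z: "z \<in> S" for z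
  proof -
    have "M z *v (\<chi> k. s z k) = (\<chi> i. b z i)"
      by (simp add: M_def matrix_vector_mult_def vec_eq_iff sol[OF z])
    then have "(\<chi> k. s z k) = (\<chi> k. det (\<chi> i l. if l = k then (\<chi> i. b z i) $ i else M z $ i $ l) / det (M z))"
      by (simp add: cramer[OF nz[OF z]])
    from arg_cong[OF this, of "\<lambda>v. v $ j"] show ?thesis by (simp add: divide_inverse M_def cong: if_cong)
  qed
  have "P (\<lambda>z. det (\<chi> i k. if k = j then b z i else A z i k) * inverse (det (M z)))"
  proof (intro mult inv)
    show "P (\<lambda>z. det (\<chi> i k. if k = j then b z i else A z i k))"
    proof (rule det)
      show "P (\<lambda>z. if k = j then b z i else A z i k)" for i k
        by (cases "k = j") (simp_all add: A b)
    qed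
    show "P (\<lambda>z. det (M z))" unfolding M_def by (rule det[OF A])
  qed (rule nz)
  then show ?thesis by (rule cong) (simp add: eq)
qed

section \<open>Lagrangean splittings\<close>

locale lagrangean_split =
  fixes \<omega> :: "complex ^ 'm \<Rightarrow> complex ^ 'm \<Rightarrow> complex"
    and \<tau> :: "complex ^ 'm \<Rightarrow> complex ^ 'm"
    and L0 L0' :: "(complex ^ 'm) set"
    and n :: "'n::finite itself"
  assumes dim: "CARD('m) = 2 * CARD('n)"
    and data: "fundamental_data \<omega> \<tau>"
    and split: "lagrangean_splitting \<omega> \<tau> L0 L0'"
begin

section \<open>Rules for \<omega>, \<tau> and \<gamma>\<close>

lemma w_add_left: "\<omega> (u + v) w = \<omega> u w + \<omega> v w"
  and w_add_right: "\<omega> w (u + v) = \<omega> w u + \<omega> w v"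
  and w_scale_left: "\<omega> (c *s u) w = c * \<omega> u w"
  and w_scale_right: "\<omega> w (c *s u) = c * \<omega> w u"
  and w_refl: "\<omega> u u = 0"
  and w_nondeg: "(\<And>v. \<omega> u v = 0) \<Longrightarrow> u = 0"
  using data by (auto simp: fundamental_data_def complex_symplectic_form_def complex_linear_scalar)

lemma w_zero_left [simp]: "\<omega> 0 w = 0" and w_zero_right [simp]: "\<omega> w 0 = 0"
  using w_scale_left[of 0 0 w] w_scale_right[of w 0 0] by auto

lemma w_antisym: "\<omega> v u = - \<omega> u v"
proof -
  have "\<omega> u v + \<omega> v u = 0" using w_refl[of "u + v"] unfolding w_add_left w_add_right by (simp add: w_refl add.commute)
  then show ?thesis by (simp add: eq_neg_iff_add_eq_0 add.commute)
qed

lemma w_minus_left: "\<omega> (- u) w = - \<omega> u w" and w_minus_right: "\<omega> w (- u) = - \<omega> w u"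
  using w_scale_left[of "-1" u w] w_scale_right[of w "-1" u] by auto

lemma w_diff_left: "\<omega> (u - v) w = \<omega> u w - \<omega> v w" and w_diff_right: "\<omega> w (u - v) = \<omega> w u - \<omega> w v"
  using w_add_left[of u "- v" w] w_add_right[of w u "- v"] by (auto simp: w_minus_left w_minus_right)

lemma w_sum_left: "\<omega> (\<Sum>i\<in>I. f i) w = (\<Sum>i\<in>I. \<omega> (f i) w)"
  and w_sum_right: "\<omega> w (\<Sum>i\<in>I. f i) = (\<Sum>i\<in>I. \<omega> w (f i))"
  by (induction I rule: infinite_finite_induct) (auto simp: w_add_left w_add_right)

lemma linear_w_right: "linear (\<omega> u)"
  by (rule linearI) (simp_all add: w_add_right scaleR_eq_smult w_scale_right scaleR_conv_of_real)

lemma linear_w_left: "linear (\<lambda>u. \<omega> u v)"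
  by (rule linearI) (simp_all add: w_add_left scaleR_eq_smult w_scale_left scaleR_conv_of_real)

lemma tau_add: "\<tau> (u + v) = \<tau> u + \<tau> v"
  and tau_scale: "\<tau> (c *s u) = cnj c *s \<tau> u"
  and tau_tau [simp]: "\<tau> (\<tau> u) = u"
  using data by (auto simp: fundamental_data_def antilinear_def)

lemma tau_minus: "\<tau> (- u) = - \<tau> u"
  using tau_scale[of "-1" u] by simp

lemma tau_diff: "\<tau> (u - v) = \<tau> u - \<tau> v"
  using tau_add[of u "- v"] by (simp add: tau_minus)

lemma tau_zero [simp]: "\<tau> 0 = 0"
  using tau_scale[of 0 0] by simp

lemma linear_tau: "linear \<tau>"
  by (rule linearI) (simp_all add: tau_add scaleR_eq_smult tau_scale)

lemma subspace_fixset: "subspace (fixset \<tau>)"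
  by (auto simp: subspace_def fixset_def tau_add linear_cmul[OF linear_tau])

lemma real_imag_decompose:
  obtains a b where "a \<in> fixset \<tau>" "b \<in> fixset \<tau>" "u = a + \<i> *s b" "\<tau> u = a - \<i> *s b"
proof
  show "(1/2) *s (u + \<tau> u) \<in> fixset \<tau>" "(-\<i>/2) *s (u - \<tau> u) \<in> fixset \<tau>"
    by (auto simp: fixset_def tau_scale tau_add tau_diff vec_eq_iff algebra_simps)
  show "u = (1/2) *s (u + \<tau> u) + \<i> *s ((-\<i>/2) *s (u - \<tau> u))"
    "\<tau> u = (1/2) *s (u + \<tau> u) - \<i> *s ((-\<i>/2) *s (u - \<tau> u))"
    by (auto simp: vec_eq_iff field_simps)
qed

lemma w_real: "u \<in> fixset \<tau> \<Longrightarrow> v \<in> fixset \<tau> \<Longrightarrow> cnj (\<omega> u v) = \<omega> u v"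
  using data by (auto simp: fundamental_data_def Reals_cnj_iff)

text \<open>Real and imaginary parts of both arguments lie in \<open>fixset \<tau>\<close>, where
  \<omega> is real.\<close>

lemma w_tau: "\<omega> (\<tau> u) (\<tau> v) = cnj (\<omega> u v)"
proof -
  obtain a b where u: "a \<in> fixset \<tau>" "b \<in> fixset \<tau>" "u = a + \<i> *s b" "\<tau> u = a - \<i> *s b"
    by (rule real_imag_decompose)
  obtain c d where v: "c \<in> fixset \<tau>" "d \<in> fixset \<tau>" "v = c + \<i> *s d" "\<tau> v = c - \<i> *s d"
    by (rule real_imag_decompose)
  show ?thesis unfolding u(4) v(4) unfolding u(3) v(3)
    by (simp add: w_add_left w_add_right w_diff_left w_diff_right w_scale_left w_scale_right w_real u v)
qed

abbreviation g where "g \<equiv> herm \<omega> \<tau>"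

lemma g_cnj: "cnj (g u v) = g v u"
  unfolding herm_def using w_tau[of u "\<tau> v"] w_antisym[of v "\<tau> u"] by simp

lemma g_add_left: "g (u + v) w = g u w + g v w"
  and g_add_right: "g w (u + v) = g w u + g w v"
  and g_scale_left: "g (c *s u) w = c * g u w"
  and g_scale_right: "g w (c *s u) = cnj c * g w u"
  and g_diff_left: "g (u - v) w = g u w - g v w"
  and g_diff_right: "g w (u - v) = g w u - g w v"
  by (auto simp: herm_def w_add_left w_add_right w_scale_left w_scale_right w_diff_left w_diff_right
      tau_add tau_scale tau_diff algebra_simps)

lemma g_zero_left [simp]: "g 0 w = 0" and g_zero_right [simp]: "g w 0 = 0"
  by (simp_all add: herm_def)

lemma g_sum_left: "g (\<Sum>i\<in>I. f i) w = (\<Sum>i\<in>I. g (f i) w)"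
  and g_sum_right: "g w (\<Sum>i\<in>I. f i) = (\<Sum>i\<in>I. g w (f i))"
  by (induction I rule: infinite_finite_induct) (auto simp: g_add_left g_add_right)

section \<open>The complexified splitting and its projection\<close>

lemma subspace_L0: "subspace L0" "subspace L0'"
  and L0_fixset: "L0 \<subseteq> fixset \<tau>" "L0' \<subseteq> fixset \<tau>"
  and L0'_isotropic: "a \<in> L0' \<Longrightarrow> b \<in> L0' \<Longrightarrow> \<omega> a b = 0"
  and L0'_maximal: "a \<in> fixset \<tau> \<Longrightarrow> (\<And>b. b \<in> L0' \<Longrightarrow> \<omega> a b = 0) \<Longrightarrow> a \<in> L0'"
  and L0_Int: "L0 \<inter> L0' = {0}" and L0_sum: "{a + b | a b. a \<in> L0 \<and> b \<in> L0'} = fixset \<tau>"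
  using split unfolding lagrangean_splitting_def real_lagrangean_subspace_def by blast+

lemma tau_L0: "a \<in> L0 \<Longrightarrow> \<tau> a = a" "a \<in> L0' \<Longrightarrow> \<tau> a = a"
  using L0_fixset by (auto simp: fixset_def)

abbreviation L where "L \<equiv> cspan L0"
abbreviation L' where "L' \<equiv> cspan L0'"

lemma cspan_real_subspace:
  assumes "subspace W"
  shows "cspan W = {a + \<i> *s b | a b. a \<in> W \<and> b \<in> (W :: (complex ^ 'm) set)}"
proof
  let ?S = "{a + \<i> *s b | a b. a \<in> W \<and> b \<in> W}"
  have "vec.subspace ?S"
  proof (rule vec.subspaceI)
    have "(0 :: complex ^ 'm) = 0 + \<i> *s 0" by simp
    then show "0 \<in> ?S" using subspace_0[OF assms] by blast
  next
    fix x y assume "x \<in> ?S" "y \<in> ?S"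
    then obtain a b c d where *: "x = a + \<i> *s b" "y = c + \<i> *s d" "a \<in> W" "b \<in> W" "c \<in> W" "d \<in> W" by blast
    then have "x + y = (a + c) + \<i> *s (b + d)" by (simp add: vec_eq_iff algebra_simps)
    then show "x + y \<in> ?S" using *(3-6) subspace_add[OF assms] by (intro CollectI exI conjI)
  next
    fix k x assume "x \<in> ?S"
    then obtain a b where *: "x = a + \<i> *s b" "a \<in> W" "b \<in> W" by blast
    have "k * (p + \<i> * q) = (Re k * p - Im k * q) + \<i> * (Im k * p + Re k * q)" for p q :: complex
      by (simp add: complex_eq_iff algebra_simps)
    then have "k *s x = (Re k *\<^sub>R a - Im k *\<^sub>R b) + \<i> *s (Im k *\<^sub>R a + Re k *\<^sub>R b)"
      unfolding * scaleR_eq_smult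
      unfolding vec_eq_iff vector_add_component vector_minus_component vector_smult_component by simp
    moreover have "Re k *\<^sub>R a - Im k *\<^sub>R b \<in> W" "Im k *\<^sub>R a + Re k *\<^sub>R b \<in> W"
      using *(2,3) by (simp_all add: subspace_add[OF assms] subspace_diff[OF assms] subspace_scale[OF assms])
    ultimately show "k *s x \<in> ?S" by blast
  qed
  moreover have "W \<subseteq> ?S"
  proof
    fix x assume "x \<in> W"
    moreover have "x = x + \<i> *s 0" by simp
    ultimately show "x \<in> ?S" using subspace_0[OF assms] by blast
  qed
  ultimately show "cspan W \<subseteq> ?S" by (rule vec.span_minimal[rotated])
  show "?S \<subseteq> cspan W" by (auto intro: vec.span_add vec.span_scale vec.span_base)
qed

lemma in_LE:
  assumes "u \<in> L" obtains a b where "a \<in> L0" "b \<in> L0" "u = a + \<i> *s b"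
  using assms cspan_real_subspace[OF subspace_L0(1)] by blast

lemma in_L'E:
  assumes "u \<in> L'" obtains a b where "a \<in> L0'" "b \<in> L0'" "u = a + \<i> *s b"
  using assms cspan_real_subspace[OF subspace_L0(2)] by blast

lemma tau_L: "u \<in> L \<Longrightarrow> \<tau> u \<in> L"
  by (erule in_LE) (simp add: tau_add tau_scale tau_L0 vec.span_base vec.span_diff vec.span_scale vec.span_neg vec.span_add)

lemma tau_L': "u \<in> L' \<Longrightarrow> \<tau> u \<in> L'"
  by (erule in_L'E) (simp add: tau_add tau_scale tau_L0 vec.span_base vec.span_diff vec.span_scale vec.span_neg vec.span_add)

lemma L'_isotropic: "u \<in> L' \<Longrightarrow> v \<in> L' \<Longrightarrow> \<omega> u v = 0"
  by (elim in_L'E) (simp add: w_add_left w_add_right w_scale_left w_scale_right L0'_isotropic)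

text \<open>Conjugating both representations of \<open>u\<close> separates real and imaginary parts,
  each of which then lies in \<open>L0\<close> and in \<open>L0'\<close>.\<close>

lemma L_Int_L': "u \<in> L \<Longrightarrow> u \<in> L' \<Longrightarrow> u = 0"
proof (elim in_LE in_L'E)
  fix a b c d assume *: "a \<in> L0" "b \<in> L0" "u = a + \<i> *s b" "c \<in> L0'" "d \<in> L0'" "u = c + \<i> *s d"
  have "a - \<i> *s b = \<tau> u" by (simp add: *(1,2,3) tau_add tau_scale tau_L0 vec_eq_iff)
  also have "\<dots> = c - \<i> *s d" by (simp add: *(4,5,6) tau_add tau_scale tau_L0 vec_eq_iff)
  finally have 1: "a - \<i> *s b = c - \<i> *s d" .
  from *(3,6) have 2: "a + \<i> *s b = c + \<i> *s d" by simp
  from arg_cong2[OF 1 2, of "(+)"] have "a = c" by (auto simp: vec_eq_iff)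
  moreover from this 2 have "b = d" by (auto simp: vec_eq_iff)
  ultimately have "a \<in> L0 \<inter> L0'" "b \<in> L0 \<inter> L0'" using * by auto
  then show "u = 0" using * unfolding L0_Int by simp
qed

text \<open>The \<open>L0'\<close> part of \<open>u\<close> is a difference of two vectors of
  \<open>L\<close>, so it lies in both complex spans and vanishes.\<close>

lemma L_fixset: "u \<in> L \<Longrightarrow> \<tau> u = u \<Longrightarrow> u \<in> L0"
proof -
  assume u: "u \<in> L" "\<tau> u = u"
  then have "u \<in> fixset \<tau>" by (simp add: fixset_def)
  then obtain a b where *: "u = a + b" "a \<in> L0" "b \<in> L0'" unfolding L0_sum[symmetric] by blast
  have eq: "b = u - a" using * by simp
  have "b \<in> L" unfolding eq using u * by (intro vec.span_diff) (auto intro: vec.span_base)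
  then have "b = 0" using * by (intro L_Int_L') (auto intro: vec.span_base)
  then show ?thesis using * by simp
qed

abbreviation p where "p \<equiv> proj_along L L'"

lemma ex_proj: "\<exists>l. l \<in> L \<and> u - l \<in> L'"
proof -
  obtain a b where u: "a \<in> fixset \<tau>" "b \<in> fixset \<tau>" "u = a + \<i> *s b" by (rule real_imag_decompose)
  obtain a1 a2 where a: "a = a1 + a2" "a1 \<in> L0" "a2 \<in> L0'" using u L0_sum by blast
  obtain b1 b2 where b: "b = b1 + b2" "b1 \<in> L0" "b2 \<in> L0'" using u L0_sum by blast
  have "u - (a1 + \<i> *s b1) = a2 + \<i> *s b2" using u a b by (simp add: vec_eq_iff algebra_simps)
  moreover have "a1 + \<i> *s b1 \<in> L" "a2 + \<i> *s b2 \<in> L'" using a b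
    by (auto intro: vec.span_base vec.span_add vec.span_scale)
  ultimately show ?thesis by metis
qed

lemma proj_unique: "l \<in> L \<Longrightarrow> u - l \<in> L' \<Longrightarrow> p u = l"
  unfolding proj_along_def
proof (rule the_equality)
  fix k assume l: "l \<in> L" "u - l \<in> L'" and k: "k \<in> L \<and> u - k \<in> L'"
  have "k - l \<in> L" using l k by (simp add: vec.span_diff)
  moreover have eq: "k - l = (u - l) - (u - k)" by simp
  have "k - l \<in> L'" unfolding eq by (rule vec.span_diff) (use l k in auto)
  ultimately show "k = l" using L_Int_L'[of "k - l"] by simp
qed simp

lemma proj_in: "p u \<in> L" "u - p u \<in> L'"
  using ex_proj[of u] proj_unique by auto

lemma proj_add: "p (u + v) = p u + p v"
proof (rule proj_unique)
  have "u + v - (p u + p v) = (u - p u) + (v - p v)" by simp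
  then show "u + v - (p u + p v) \<in> L'" using vec.span_add[OF proj_in(2) proj_in(2)] by metis
qed (intro vec.span_add proj_in)

lemma proj_scale: "p (c *s u) = c *s p u"
proof (rule proj_unique)
  show "c *s u - c *s p u \<in> L'" using vec.span_scale[OF proj_in(2)] by (metis vec.scale_right_diff_distrib)
qed (intro vec.span_scale proj_in)

lemma proj_eq_0_iff: "p u = 0 \<longleftrightarrow> u \<in> L'"
  using proj_in(2)[of u] proj_unique[of 0 u] vec.span_zero by auto

lemma proj_diff: "p (u - v) = p u - p v"
  using proj_add[of u "- v"] proj_scale[of "-1" v] by simp

lemma proj_eq_iff: "p u = p v \<longleftrightarrow> u - v \<in> L'"
  using proj_eq_0_iff[of "u - v"] by (simp add: proj_diff)

lemma proj_tau: "p (\<tau> u) = \<tau> (p u)"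
proof (rule proj_unique)
  show "\<tau> u - \<tau> (p u) \<in> L'" using tau_L'[OF proj_in(2)] by (simp add: tau_diff)
qed (intro tau_L proj_in)

lemma proj_has_derivative: "(p has_derivative p) (at u)"
  by (rule linear_imp_has_derivative, rule linearI) (simp_all add: proj_add scaleR_eq_smult proj_scale)

section \<open>Dimensions of the real Lagrangean subspaces and equations for
  \<open>L'\<close>\<close>

lemma dim_fixset: "dim (fixset \<tau>) = CARD('m)"
proof -
  have lin: "linear (\<lambda>v :: complex ^ 'm. \<i> *s v)"
    by (rule linearI) (auto simp: vec_eq_iff algebra_simps)
  have inj: "inj (\<lambda>v :: complex ^ 'm. \<i> *s v)" by (rule injI) (auto simp: vec_eq_iff)
  have "{x + y | x y. x \<in> fixset \<tau> \<and> y \<in> (\<lambda>v. \<i> *s v) ` fixset \<tau>} = UNIV"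
    using real_imag_decompose by (auto intro: image_eqI) (metis image_eqI)
  moreover have "fixset \<tau> \<inter> (\<lambda>v. \<i> *s v) ` fixset \<tau> \<subseteq> {0}"
  proof clarsimp
    fix v assume "\<i> *s v \<in> fixset \<tau>" "v \<in> fixset \<tau>"
    then have "- (\<i> *s v) = \<i> *s v" by (simp add: fixset_def tau_scale)
    then show "v = 0" by (auto simp: vec_eq_iff)
  qed
  then have "dim (fixset \<tau> \<inter> (\<lambda>v. \<i> *s v) ` fixset \<tau>) = 0"
    by (simp add: dim_eq_0)
  moreover have "dim ((\<lambda>v. \<i> *s v) ` fixset \<tau>) = dim (fixset \<tau>)"
    by (rule dim_image_eq[OF lin]) (rule inj_on_subset[OF inj], simp)
  ultimately show ?thesis
    using dim_sums_Int[OF subspace_fixset linear_subspace_image[OF lin subspace_fixset]]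
    by (simp add: dim_UNIV del: dim_eq_0)
qed

text \<open>A count of real dimensions. \<open>J\<close> represents the real part of \<omega> by the
  inner product, and maximality of \<open>W\<close> says that \<open>J\<close> maps it onto the part
  of \<open>J\<close> applied to \<open>fixset \<tau>\<close> that is orthogonal to
  \<open>W\<close>. A sum of subspaces fits into the whole space, which has twice the dimension of
  \<open>fixset \<tau>\<close>, and this bounds the intersection from below.\<close>

lemma dim_lagrangean:
  assumes W: "real_lagrangean_subspace \<omega> \<tau> W" shows "CARD('m) \<le> 2 * dim W"
proof -
  define J where "J a = (\<Sum>e\<in>Basis. Re (\<omega> a e) *\<^sub>R e)" for a
  have J: "J a \<bullet> w = Re (\<omega> a w)" for a w
  proof -
    have "Re (\<omega> a w) = Re (\<omega> a (\<Sum>e\<in>Basis. (w \<bullet> e) *\<^sub>R e))" by (simp add: euclidean_representation)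
    also have "\<dots> = (\<Sum>e\<in>Basis. (w \<bullet> e) * Re (\<omega> a e))"
      by (simp add: w_sum_right scaleR_eq_smult w_scale_right)
    finally show ?thesis unfolding J_def inner_sum_left by (simp add: inner_commute mult.commute)
  qed
  have lin: "linear J"
  proof (rule linearI)
    show "J (a + b) = J a + J b" for a b
      by (rule vector_eq_rdot[THEN iffD1]) (simp add: J inner_add_left w_add_left)
    show "J (r *\<^sub>R a) = r *\<^sub>R J a" for r a
      by (rule vector_eq_rdot[THEN iffD1]) (simp add: J linear_cmul[OF linear_w_left])
  qed
  have inj: "inj J"
  proof (subst linear_injective_0[OF lin], intro allI impI)
    fix a assume "J a = 0"
    then have z: "Re (\<omega> a w) = 0" for w using J[of a w] by simp
    have "\<omega> a w = 0" for w using z[of w] z[of "\<i> *s w"] by (simp add: w_scale_right complex_eq_iff)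
    then show "a = 0" by (rule w_nondeg)
  qed
  have WW: "subspace W" "W \<subseteq> fixset \<tau>" using W by (auto simp: real_lagrangean_subspace_def)
  define A where "A = J ` fixset \<tau>"
  define P where "P = {y. \<forall>x\<in>W. orthogonal x y}"
  have "dim A = CARD('m)"
    unfolding A_def using dim_image_eq[OF lin inj_on_subset[OF inj]] by (simp add: dim_fixset)
  moreover have "J ` W = A \<inter> P"
  proof -
    have "a \<in> W \<longleftrightarrow> (\<forall>w\<in>W. \<omega> a w = 0)" if "a \<in> fixset \<tau>" for a
      using W that unfolding real_lagrangean_subspace_def by blast
    moreover have "\<omega> a w = 0 \<longleftrightarrow> Re (\<omega> a w) = 0" if "a \<in> fixset \<tau>" "w \<in> W" for a w
      using w_real[OF that(1), of w] that WW by (auto simp: complex_eq_iff)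
    ultimately have "a \<in> W \<longleftrightarrow> J a \<in> P" if "a \<in> fixset \<tau>" for a
      using that by (auto simp: P_def orthogonal_def inner_commute[of _ "J a"] J)
    then show ?thesis using WW(2) by (auto simp: A_def)
  qed
  then have "dim (A \<inter> P) = dim W"
    using dim_image_eq[OF lin inj_on_subset[OF inj], of W] by simp
  moreover have "dim P + dim W = DIM(complex ^ 'm)"
    using dim_subspace_orthogonal_to_vectors[OF WW(1) subspace_UNIV] by (simp add: P_def dim_UNIV)
  moreover have "dim {x + y | x y. x \<in> A \<and> y \<in> P} + dim (A \<inter> P) = dim A + dim P"
  proof (rule dim_sums_Int)
    show "subspace A" unfolding A_def by (rule linear_subspace_image[OF lin subspace_fixset])
    show "subspace P" unfolding P_def by (rule subspace_orthogonal_to_vectors)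
  qed
  moreover have "dim {x + y | x y. x \<in> A \<and> y \<in> P} \<le> DIM(complex ^ 'm)" by (rule dim_subset_UNIV)
  ultimately show ?thesis by linarith
qed

text \<open>The dimensions of the two summands add up to \<open>CARD('m)\<close>, and each is at
  least half of it.\<close>

lemma dim_L0': "dim L0' = CARD('n)"
proof -
  have "dim L0 + dim L0' = CARD('m)"
    using dim_sums_Int[OF subspace_L0] by (simp add: L0_sum L0_Int dim_fixset)
  moreover have "CARD('m) \<le> 2 * dim L0" "CARD('m) \<le> 2 * dim L0'"
    using split by (auto simp: lagrangean_splitting_def intro: dim_lagrangean)
  ultimately show ?thesis using dim by linarith
qed

text \<open>The point is the number of equations. There are as many as \<open>M\<close> has complex
  dimensions, so transversality of a tangent space to \<open>L'\<close> becomes invertibility of a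
  square matrix.\<close>

lemma L'_annihilator:
  obtains e :: "'n \<Rightarrow> complex ^ 'm"
  where "\<And>i. e i \<in> L0'" "\<And>u. u \<in> L' \<longleftrightarrow> (\<forall>i. \<omega> u (e i) = 0)"
proof -
  obtain B where B: "B \<subseteq> L0'" "independent B" "L0' \<subseteq> span B" "card B = dim L0'"
    by (rule basis_exists)
  have "finite B" using B(2) by (rule independent_imp_finite)
  then obtain e where e: "bij_betw e (UNIV :: 'n set) B"
    using finite_same_card_bij[of "UNIV :: 'n set" B] B(4) dim_L0' by auto
  have eL: "e i \<in> L0'" for i using e B(1) by (auto simp: bij_betw_def)
  have "u \<in> L' \<longleftrightarrow> (\<forall>i. \<omega> u (e i) = 0)" for u
  proof
    assume "u \<in> L'" then show "\<forall>i. \<omega> u (e i) = 0" using L'_isotropic vec.span_base[OF eL] by blast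
  next
    assume *: "\<forall>i. \<omega> u (e i) = 0"
    have uB: "\<omega> u b = 0" if "b \<in> L0'" for b
    proof -
      have "b \<in> span B" using that B(3) by auto
      then show ?thesis
        by (rule linear_eq_0_on_span[OF linear_w_right, rotated]) (use * e in \<open>auto simp: bij_betw_def\<close>)
    qed
    obtain a b where ab: "a \<in> fixset \<tau>" "b \<in> fixset \<tau>" "u = a + \<i> *s b" by (rule real_imag_decompose)
    \<comment> \<open>Both pairings with a real vector are real, so the vanishing of
      \<open>\<omega> u w\<close> splits into the vanishing of its two parts.\<close>
    have z: "\<omega> a w = 0 \<and> \<omega> b w = 0" if "w \<in> L0'" for w
    proof -
      have w: "w \<in> fixset \<tau>" using that L0_fixset by auto
      have "\<omega> a w + \<i> * \<omega> b w = 0" using uB[OF that] ab by (simp add: w_add_left w_scale_left)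
      moreover have "Im (\<omega> a w) = 0" "Im (\<omega> b w) = 0"
        using w_real[OF ab(1) w] w_real[OF ab(2) w] by (auto simp: complex_eq_iff)
      ultimately show ?thesis by (auto simp: complex_eq_iff)
    qed
    have "a \<in> L0'" "b \<in> L0'" using z ab by (auto intro: L0'_maximal)
    then show "u \<in> L'" using ab by (auto intro: vec.span_base vec.span_add vec.span_scale)
  qed
  with eL show ?thesis by (rule that)
qed

end

section \<open>Parametrizations and tangent spaces\<close>

text \<open>A linear left inverse \<open>A\<close> of \<open>Y\<close> suggests that the derivative
  of \<open>c\<close> is \<open>A\<close> after \<open>C\<close>. The increment of \<open>c\<close>
  is first bounded by a multiple of \<open>norm (s - t)\<close>: continuity puts \<open>c s\<close>
  where \<open>y\<close> is nearly linear, and there the error can be absorbed. The true error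
  estimate then follows.\<close>

lemma has_derivative_immersion_cancel:
  fixes y :: "'b::euclidean_space \<Rightarrow> 'c::euclidean_space" and c :: "'a::real_normed_vector \<Rightarrow> 'b"
  assumes y: "(y has_derivative Y) (at (c t))" and inj: "inj Y" and cont: "isCont c t"
    and yc: "((\<lambda>s. y (c s)) has_derivative C) (at t)"
  obtains C' where "(c has_derivative C') (at t)" "\<And>a. Y (C' a) = C a"
proof -
  obtain A where A: "linear A" "A \<circ> Y = id"
    using linear_injective_left_inverse[OF has_derivative_linear[OF y] inj] by blast
  have AY: "A (Y u) = u" for u using A(2) by (metis comp_apply id_apply)
  obtain B where B: "B > 0" "\<And>u. norm (A u) \<le> norm u * B"
    using bounded_linear.pos_bounded[OF linear_linear[THEN iffD2, OF A(1)]] by blast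
  have C: "bounded_linear C" by (rule has_derivative_bounded_linear[OF yc])
  then obtain K where K: "K > 0" "\<And>u. norm (C u) \<le> norm u * K" using bounded_linear.pos_bounded by blast
  have "(c has_derivative (\<lambda>a. A (C a))) (at t)"
    unfolding has_derivative_at_alt
  proof (intro conjI allI impI)
    show "bounded_linear (\<lambda>a. A (C a))"
      by (rule bounded_linear_compose[OF linear_linear[THEN iffD2, OF A(1)] C])
    fix e :: real assume e: "e > 0"
    \<comment> \<open>Collects the constants of the last estimate, whose error comes out as
      \<open>d * q\<close>.\<close>
    define q where "q = B * (2 * B * (K + 1) + 1)"
    have q: "q > 0" using B K by (simp add: q_def add_pos_pos)
    \<comment> \<open>The bound \<open>1 / (2 * B)\<close> lets the term with
      \<open>d * norm u\<close> be absorbed into \<open>norm u\<close>, the bound 1 gives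
      \<open>norm v \<le> (K + 1) * norm (s - t)\<close>, and \<open>e / q\<close> produces the
      final \<open>e\<close>.\<close>
    define d where "d = min (1 / (2 * B)) (min 1 (e / q))"
    have d: "d > 0" "d \<le> 1" using B q e by (auto simp: d_def)
    have "d \<le> 1 / (2 * B)" "d \<le> e / q" by (auto simp: d_def)
    then have dB: "d * B \<le> 1 / 2" and dq: "d * q \<le> e"
      using B(1) q by (simp_all add: pos_le_divide_eq)
    obtain d1 where d1: "d1 > 0" "\<And>u. norm (u - c t) < d1 \<Longrightarrow> norm (y u - y (c t) - Y (u - c t)) \<le> d * norm (u - c t)"
      using y d(1) unfolding has_derivative_at_alt by blast
    obtain d2 where d2: "d2 > 0" "\<And>s. norm (s - t) < d2 \<Longrightarrow> norm (y (c s) - y (c t) - C (s - t)) \<le> d * norm (s - t)"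
      using yc d(1) unfolding has_derivative_at_alt by blast
    obtain d3 where d3: "d3 > 0" "\<And>s. dist s t < d3 \<Longrightarrow> dist (c s) (c t) < d1"
      using cont d1(1) unfolding continuous_at_eps_delta by blast
    show "\<exists>d>0. \<forall>s. norm (s - t) < d \<longrightarrow> norm (c s - c t - A (C (s - t))) \<le> e * norm (s - t)"
    proof (intro exI[of _ "min d2 d3"] conjI allI impI)
      fix s assume s: "norm (s - t) < min d2 d3"
      define u where "u = c s - c t"
      define v where "v = y (c s) - y (c t)"
      have 1: "norm (v - Y u) \<le> d * norm u"
        unfolding u_def v_def using s d3(2)[of s] by (intro d1(2)) (simp add: dist_norm)
      have 2: "norm (v - C (s - t)) \<le> d * norm (s - t)" unfolding v_def using s by (intro d2(2)) simp
      have "norm v \<le> norm (C (s - t)) + norm (v - C (s - t))" by (metis norm_triangle_sub add.commute)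
      then have v: "norm v \<le> (K + 1) * norm (s - t)"
        using K(2)[of "s - t"] 2 mult_right_mono[OF d(2) norm_ge_zero[of "s - t"]] by (simp add: algebra_simps)
      have "norm u \<le> norm (Y u) * B" using B(2)[of "Y u"] by (simp add: AY)
      also have "\<dots> \<le> (norm v + d * norm u) * B"
        using B(1) 1 norm_triangle_sub[of "Y u" v] by (intro mult_right_mono) (auto simp: norm_minus_commute)
      finally have "norm u \<le> 2 * B * norm v"
        using mult_right_mono[OF dB norm_ge_zero[of u]] by (simp add: algebra_simps)
      also have "\<dots> \<le> 2 * B * ((K + 1) * norm (s - t))" using v B(1) by (intro mult_left_mono) auto
      finally have u: "norm u \<le> 2 * B * (K + 1) * norm (s - t)" by (simp add: mult.assoc)
      have "norm (c s - c t - A (C (s - t))) \<le> norm (Y u - C (s - t)) * B"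
        using B(2)[of "Y u - C (s - t)"] by (simp add: linear_diff[OF A(1)] AY u_def)
      also have "\<dots> \<le> (d * (2 * B * (K + 1) * norm (s - t)) + d * norm (s - t)) * B"
      proof (rule mult_right_mono)
        show "norm (Y u - C (s - t)) \<le> d * (2 * B * (K + 1) * norm (s - t)) + d * norm (s - t)"
          using 1 2 mult_left_mono[OF u less_imp_le[OF d(1)]] norm_triangle_ineq4[of "v - C (s - t)" "v - Y u"] by simp
      qed (use B in simp)
      also have "\<dots> = d * q * norm (s - t)" by (simp add: q_def algebra_simps)
      also have "\<dots> \<le> e * norm (s - t)" by (rule mult_right_mono[OF dq norm_ge_zero])
      finally show "norm (c s - c t - A (C (s - t))) \<le> e * norm (s - t)" .
    qed (use d2 d3 in auto)
  qed
  \<comment> \<open>\<open>A\<close> is only a left inverse. That the values of \<open>C\<close> lie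
    in the range of \<open>Y\<close> follows from uniqueness of the derivative of \<open>y\<close>
    after \<open>c\<close>.\<close>
  moreover have "Y (A (C a)) = C a" for a
    using has_derivative_unique[OF yc has_derivative_compose[OF calculation y]] by metis
  ultimately show ?thesis by (rule that)
qed

lemma local_paramD:
  assumes "local_param M U x"
  shows "open U" "holo_on x U" "z \<in> U \<Longrightarrow> inj (fd x z)" "inj_on x U" "x ` U \<subseteq> M"
    "openin (top_of_set M) (x ` U)" "continuous_on (x ` U) (the_inv_into U x)"
proof -
  show "open U" "holo_on x U" "z \<in> U \<Longrightarrow> inj (fd x z)" "openin (top_of_set M) (x ` U)"
    using assms by (auto simp: local_param_def)
  then show "x ` U \<subseteq> M" by (auto dest: openin_imp_subset)
  obtain y where y: "homeomorphism U (x ` U) x y" using assms by (auto simp: local_param_def)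
  then show inj: "inj_on x U" by (metis homeomorphism_apply1 inj_on_inverseI)
  have "continuous_on (x ` U) y" using y by (simp add: homeomorphism_def)
  moreover have "y u = the_inv_into U x u" if "u \<in> x ` U" for u
    using that y inj by (auto simp: homeomorphism_def the_inv_into_f_f)
  ultimately show "continuous_on (x ` U) (the_inv_into U x)" by (metis (no_types, lifting) continuous_on_cong)
qed

text \<open>The inverse of a chart is known to be continuous on \<open>M\<close> only, but
  continuity suffices to cancel the immersion \<open>y\<close>. The domain of \<open>c\<close> is
  arbitrary because \<open>c\<close> will be a curve, another chart, or the inverse projection in a
  chart.\<close>

lemma param_inverse_has_derivative:
  fixes y :: "complex ^ 'n \<Rightarrow> complex ^ 'm" and c :: "'a::real_normed_vector \<Rightarrow> complex ^ 'm"
  assumes W: "local_param M W y" and w: "w \<in> W" and ct: "c t = y w"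
    and ev: "eventually (\<lambda>s. c s \<in> M) (at t)" and C: "(c has_derivative C) (at t)"
  obtains C' where "((\<lambda>s. the_inv_into W y (c s)) has_derivative C') (at t)" "\<And>a. fd y w (C' a) = C a"
proof -
  define k where "k = the_inv_into W y"
  note W' = local_paramD[OF W]
  have kw: "k (c t) = w" unfolding k_def ct by (rule the_inv_into_f_f[OF W'(4) w])
  obtain Q where Q: "open Q" "y ` W = M \<inter> Q" using W'(6) by (auto simp: openin_open)
  have ctO: "c t \<in> Q" using Q w ct by auto
  have cc: "(c \<longlongrightarrow> c t) (at t)" using has_derivative_continuous[OF C] by (simp add: continuous_at)
  have evW: "eventually (\<lambda>s. c s \<in> y ` W) (at t)"
    using topological_tendstoD[OF cc Q(1) ctO] ev by eventually_elim (use Q in auto)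
  have "((\<lambda>s. k (c s)) \<longlongrightarrow> k (c t)) (at t)"
    by (rule continuous_on_tendsto_compose[OF W'(7)[folded k_def] cc _ evW]) (use w ct in auto)
  then have cont: "isCont (\<lambda>s. k (c s)) t" by (simp add: continuous_at)
  have "((\<lambda>s. y (k (c s))) has_derivative C) (at t)"
  proof (rule has_derivative_transform_eventually[OF C])
    show "eventually (\<lambda>s. c s = y (k (c s))) (at t)"
      using evW by eventually_elim (simp add: k_def f_the_inv_into_f[OF W'(4)])
    show "c t = y (k (c t))" using kw ct by simp
  qed simp
  moreover have "(y has_derivative fd y w) (at (k (c t)))" unfolding kw by (rule holo_on_has_derivative[OF W'(2) w])
  ultimately show ?thesis
    using has_derivative_immersion_cancel[of y "fd y w" "\<lambda>s. k (c s)" t C thesis] W'(3)[OF w] cont that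
    unfolding k_def by blast
qed

text \<open>A curve in \<open>M\<close> is differentiable in the chart, and its velocity there is a
  preimage of \<open>v\<close>. Conversely, a straight segment in the chart gives a curve for each
  vector of the range.\<close>

lemma tangent_space_param:
  fixes x :: "complex ^ 'n \<Rightarrow> complex ^ 'm"
  assumes U: "local_param M U x" and z: "z \<in> U"
  shows "tangent_space M (x z) = range (fd x z)"
proof (intro equalityI subsetI)
  fix v assume "v \<in> tangent_space M (x z)"
  then obtain \<epsilon> c where c: "\<epsilon> > 0" "\<And>t. \<bar>t\<bar> < \<epsilon> \<Longrightarrow> c t \<in> M" "c 0 = x z" "(c has_vector_derivative v) (at 0)"
    by (auto simp: tangent_space_def)
  have "eventually (\<lambda>s. c s \<in> M) (at 0)"
    unfolding eventually_at using c(1,2) by (intro exI[of _ \<epsilon>]) (auto simp: dist_real_def)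
  then obtain C' where "\<And>a. fd x z (C' a) = a *\<^sub>R v"
    using param_inverse_has_derivative[where c=c and t=0 and C="\<lambda>t. t *\<^sub>R v", OF U z c(3)] c(4)
    unfolding has_vector_derivative_def by blast
  from this[of 1] show "v \<in> range (fd x z)" by (metis rangeI scaleR_one)
next
  note U' = local_paramD[OF U]
  fix v assume "v \<in> range (fd x z)"
  then obtain a where a: "v = fd x z a" by auto
  have 1: "((\<lambda>t::real. z + t *\<^sub>R a) has_derivative (\<lambda>t. t *\<^sub>R a)) (at 0)"
    by (auto intro!: derivative_eq_intros)
  have "(x has_derivative fd x z) (at (z + 0 *\<^sub>R a))" using holo_on_has_derivative[OF U'(2) z] by simp
  from has_derivative_compose[OF 1 this]
  have 2: "((\<lambda>t::real. x (z + t *\<^sub>R a)) has_vector_derivative v) (at 0)"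
    using linear_cmul[OF has_derivative_linear[OF holo_on_has_derivative[OF U'(2) z]]]
    by (simp add: has_vector_derivative_def a)
  have "((\<lambda>t::real. z + t *\<^sub>R a) \<longlongrightarrow> z + 0 *\<^sub>R a) (at 0)" by (intro tendsto_intros)
  then have "eventually (\<lambda>t::real. z + t *\<^sub>R a \<in> U) (at 0)"
    using topological_tendstoD[OF _ U'(1)] z by simp
  then obtain d where d: "d > 0" "\<And>t::real. t \<noteq> 0 \<Longrightarrow> \<bar>t\<bar> < d \<Longrightarrow> z + t *\<^sub>R a \<in> U"
    unfolding eventually_at by (auto simp: dist_real_def)
  show "v \<in> tangent_space M (x z)"
    unfolding tangent_space_def
  proof (intro CollectI exI[of _ d] conjI exI[of _ "\<lambda>t. x (z + t *\<^sub>R a)"] allI impI)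
    fix t :: real assume "\<bar>t\<bar> < d"
    then have "z + t *\<^sub>R a \<in> U" using d(2)[of t] z by (cases "t = 0") auto
    then show "x (z + t *\<^sub>R a) \<in> M" using U'(5) by auto
  qed (use d 2 in auto)
qed

lemma fd_param_linear:
  assumes "local_param M U x" "z \<in> U"
  shows "linear (fd x z)" "fd x z (a + b) = fd x z a + fd x z b" "fd x z (c *s a) = c *s fd x z a"
    "fd x z (a - b) = fd x z a - fd x z b" "fd x z 0 = 0"
proof -
  have *: "Vector_Spaces.linear (*s) (*s) (fd x z)" by (rule holo_on_linear[OF local_paramD(2)[OF assms(1)] assms(2)])
  show l: "linear (fd x z)" using * by (simp add: complex_linear_vec)
  show "fd x z (c *s a) = c *s fd x z a" by (rule vec.linear_scale[OF *])
  show "fd x z (a + b) = fd x z a + fd x z b" "fd x z (a - b) = fd x z a - fd x z b" "fd x z 0 = 0"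
    by (simp_all add: linear_add[OF l] linear_diff[OF l] linear_0[OF l])
qed

lemma fd_param_expand:
  assumes "local_param M U x" "z \<in> U"
  shows "fd x z a = (\<Sum>j\<in>UNIV. a $ j *s fd x z (axis j 1))"
proof -
  have "fd x z a = fd x z (\<Sum>j\<in>UNIV. a $ j *s axis j 1)" by (simp add: basis_expansion)
  also have "\<dots> = (\<Sum>j\<in>UNIV. a $ j *s fd x z (axis j 1))"
    by (simp add: linear_sum[OF fd_param_linear(1)[OF assms]] fd_param_linear(3)[OF assms])
  finally show ?thesis .
qed

text \<open>Differentiability of the change of chart comes from
  \<open>param_inverse_has_derivative\<close>. The derivative is complex linear because those of
  both charts are and that of \<open>y\<close> can be cancelled.\<close>

lemma transition:
  fixes x y :: "complex ^ 'n \<Rightarrow> complex ^ 'm"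
  assumes U: "local_param M U x" and W: "local_param M W y"
  defines "A \<equiv> {z\<in>U. x z \<in> y ` W}" and "h \<equiv> \<lambda>z. the_inv_into W y (x z)"
  shows "open A" "holo_on h A" "h ` A \<subseteq> W" "z \<in> A \<Longrightarrow> y (h z) = x z"
    "z \<in> A \<Longrightarrow> fd y (h z) (fd h z a) = fd x z a"
proof -
  note U' = local_paramD[OF U] and W' = local_paramD[OF W]
  obtain Q where Q: "open Q" "y ` W = M \<inter> Q" using W'(6) by (auto simp: openin_open)
  have "A = U \<inter> x -` Q" using U'(5) Q by (auto simp: A_def)
  then show "open A" using continuous_open_preimage[OF holo_on_continuous_on[OF U'(2)] U'(1) Q(1)] by simp
  show "h ` A \<subseteq> W" by (auto simp: A_def h_def the_inv_into_into[OF W'(4)] the_inv_into_f_f[OF W'(4)])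
  show yh: "y (h z) = x z" if "z \<in> A" for z
    using that by (simp add: A_def h_def f_the_inv_into_f[OF W'(4)])
  have main: "\<exists>H. (h has_derivative H) (at z) \<and> (\<forall>a. fd y (h z) (H a) = fd x z a)" if z: "z \<in> A" for z
  proof -
    have zU: "z \<in> U" and hz: "h z \<in> W" using z \<open>h ` A \<subseteq> W\<close> by (auto simp: A_def)
    have "eventually (\<lambda>s. s \<in> U) (at z)" by (rule eventually_at_in_open'[OF U'(1) zU])
    then have "eventually (\<lambda>s. x s \<in> M) (at z)" by eventually_elim (use U'(5) in auto)
    then show ?thesis
      using param_inverse_has_derivative[OF W hz yh[OF z, symmetric] _ holo_on_has_derivative[OF U'(2) zU]]
      unfolding h_def by blast
  qed
  show "fd y (h z) (fd h z a) = fd x z a" if "z \<in> A" using main[OF that] fd_eq by metis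
  show "holo_on h A" unfolding holo_on_def
  proof
    fix z assume z: "z \<in> A"
    then have zU: "z \<in> U" and hz: "h z \<in> W" using \<open>h ` A \<subseteq> W\<close> by (auto simp: A_def)
    obtain H where H: "(h has_derivative H) (at z)" "\<And>a. fd y (h z) (H a) = fd x z a" using main[OF z] by blast
    have "H (\<i> *s a) = \<i> *s H a" for a
    proof (rule injD[OF W'(3)[OF hz]])
      show "fd y (h z) (H (\<i> *s a)) = fd y (h z) (\<i> *s H a)"
        by (simp add: H(2) fd_param_linear(3)[OF U zU] fd_param_linear(3)[OF W hz])
    qed
    then show "\<exists>D. Vector_Spaces.linear (*s) (*s) D \<and> (h has_derivative D) (at z)"
      using H(1) by (intro exI[of _ H]) (auto simp: complex_linear_vec has_derivative_linear)
  qed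
qed

lemma tangent_space_subspace:
  fixes n :: "'n::finite itself"
  assumes "complex_submanifold n M" "m \<in> M"
  shows "vec.subspace (tangent_space M m)"
proof -
  obtain U and x :: "complex ^ 'n \<Rightarrow> complex ^ 'a" where U: "local_param M U x" and "m \<in> x ` U"
    using assms unfolding complex_submanifold_def by blast
  then obtain z where z: "z \<in> U" "m = x z" by auto
  note l = fd_param_linear[OF U z(1)]
  show ?thesis unfolding z(2) tangent_space_param[OF U z(1)]
  proof (rule vec.subspaceI)
    show "0 \<in> range (fd x z)" using l(5) by (metis rangeI)
  qed (auto simp: l(2,3)[symmetric])
qed

section \<open>Induced parametrizations of the cotangent bundle\<close>

definition fibre_coord :: "complex ^ ('n + 'n) \<Rightarrow> complex ^ 'n" where
  "fibre_coord Z = (\<chi> i. Z $ Inr i)"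

definition cot_coord :: "complex ^ 'n \<Rightarrow> complex ^ 'n \<Rightarrow> complex ^ ('n + 'n)" where
  "cot_coord z w = (\<chi> I. case I of Inl i \<Rightarrow> z $ i | Inr i \<Rightarrow> w $ i)"

lemma base_cot_coord [simp]: "base_coord (cot_coord z w) = z" "fibre_coord (cot_coord z w) = w"
  by (simp_all add: base_coord_def fibre_coord_def cot_coord_def vec_eq_iff)

lemma cot_coord_eqI: "base_coord Z = base_coord \<xi> \<Longrightarrow> fibre_coord Z = fibre_coord \<xi> \<Longrightarrow> Z = \<xi>"
  unfolding vec_eq_iff
proof
  fix I :: "'a + 'a" assume *: "\<forall>i. base_coord Z $ i = base_coord \<xi> $ i" "\<forall>i. fibre_coord Z $ i = fibre_coord \<xi> $ i"
  show "Z $ I = \<xi> $ I" using * by (cases I) (simp_all add: base_coord_def fibre_coord_def)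
qed

lemma fibre_coord_nth: "fibre_coord Z $ i = Z $ Inr i" and base_coord_nth: "base_coord Z $ i = Z $ Inl i"
  by (simp_all add: fibre_coord_def base_coord_def)

lemma holo_on_base_coord: "holo_on base_coord S"
  by (simp add: holo_on_iff base_coord_nth)

lemma base_coord_has_derivative: "(base_coord has_derivative base_coord) (at Z)"
  by (rule has_derivative_vec)
     (simp add: base_coord_nth bounded_linear_imp_has_derivative[OF bounded_linear_vec_nth])

lemma open_cot_dom: "open U \<Longrightarrow> open (cot_dom U)"
  using continuous_open_preimage[OF holo_on_continuous_on[OF holo_on_base_coord[of UNIV]] open_UNIV, of U]
  by (simp add: cot_dom_def vimage_def)

lemma sum_axis: "(\<Sum>j\<in>UNIV. axis i (1 :: complex) $ j * f j) = f (i :: 'n::finite)"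
proof -
  have "(\<Sum>j\<in>UNIV. axis i (1 :: complex) $ j * f j) = (\<Sum>j\<in>UNIV. if j = i then f j else 0)"
    by (rule sum.cong) (auto simp: axis_def)
  then show ?thesis by simp
qed

lemma cotangent_ext:
  assumes "\<sigma> \<in> cotangent_space M m" "\<sigma>' \<in> cotangent_space M m"
    "\<And>u. u \<in> tangent_space M m \<Longrightarrow> \<sigma> u = \<sigma>' u"
  shows "\<sigma> = \<sigma>'"
  using assms by (auto simp: cotangent_space_def intro: extensionalityI)

lemma cotangent_spaceD:
  assumes "\<sigma> \<in> cotangent_space M m"
  shows "\<sigma> \<in> extensional (tangent_space M m)"
    "u \<in> tangent_space M m \<Longrightarrow> v \<in> tangent_space M m \<Longrightarrow> \<sigma> (u + v) = \<sigma> u + \<sigma> v"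
    "u \<in> tangent_space M m \<Longrightarrow> \<sigma> (c *s u) = c * \<sigma> u"
  using assms by (auto simp: cotangent_space_def)

lemma cotangent_param_expand:
  assumes U: "local_param M U x" and z: "z \<in> U" and \<sigma>: "\<sigma> \<in> cotangent_space M (x z)"
  shows "\<sigma> (fd x z a) = (\<Sum>j\<in>UNIV. a $ j * \<sigma> (fd x z (axis j 1)))"
proof -
  note T = tangent_space_param[OF U z]
  have "\<sigma> (fd x z b) = (\<Sum>j\<in>UNIV. b $ j * \<sigma> (fd x z (axis j 1)))" for b
  proof (rule complex_linear_expand)
    show "linear (\<lambda>a. \<sigma> (fd x z a))"
      by (rule linearI)
         (simp_all add: scaleR_eq_smult fd_param_linear(2,3)[OF U z] cotangent_spaceD[OF \<sigma>] T scaleR_conv_of_real)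
    show "\<sigma> (fd x z (\<i> *s a)) = \<i> * \<sigma> (fd x z a)" for a
      by (simp add: fd_param_linear[OF U z] cotangent_spaceD[OF \<sigma>] T)
  qed
  then show ?thesis .
qed

text \<open>The partial derivatives of \<open>x\<close> span the tangent space, so the description
  in \<open>cot_param\<close> fits at most one covector.\<close>

lemma cot_param_eqI:
  fixes x :: "complex ^ 'n \<Rightarrow> complex ^ 'm"
  assumes U: "local_param M U x" and Z: "Z \<in> cot_dom U" and \<sigma>: "\<sigma> \<in> cotangent_space M (x (base_coord Z))"
    and eq: "\<And>i. \<sigma> (fd x (base_coord Z) (axis i 1)) = Z $ Inr i"
  shows "cot_param M x Z = (x (base_coord Z), \<sigma>)"
proof -
  have z: "base_coord Z \<in> U" using Z by (simp add: cot_dom_def)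
  have "(THE \<sigma>. \<sigma> \<in> cotangent_space M (x (base_coord Z)) \<and>
        (\<forall>i. \<sigma> (fd x (base_coord Z) (axis i 1)) = Z $ Inr i)) = \<sigma>"
  proof (rule the_equality)
    fix \<sigma>' assume *: "\<sigma>' \<in> cotangent_space M (x (base_coord Z)) \<and>
        (\<forall>i. \<sigma>' (fd x (base_coord Z) (axis i 1)) = Z $ Inr i)"
    show "\<sigma>' = \<sigma>"
    proof (rule cotangent_ext[OF conjunct1[OF *] \<sigma>])
      fix u assume "u \<in> tangent_space M (x (base_coord Z))"
      then obtain a where u: "u = fd x (base_coord Z) a" unfolding tangent_space_param[OF U z] by auto
      show "\<sigma>' u = \<sigma> u"
        using cotangent_param_expand[OF U z conjunct1[OF *], of a] cotangent_param_expand[OF U z \<sigma>, of a] * eq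
        by (simp add: u)
    qed
  qed (use \<sigma> eq in auto)
  then show ?thesis by (simp add: cot_param_def)
qed

text \<open>Existence for the description in \<open>cot_param\<close>: the derivative of
  \<open>x\<close> is injective and can be inverted on its range. Later proofs evaluate \<sigma>
  through the expansion given here.\<close>

lemma cot_param_cases:
  fixes x :: "complex ^ 'n \<Rightarrow> complex ^ 'm"
  assumes U: "local_param M U x" and Z: "Z \<in> cot_dom U"
  obtains \<sigma> where "\<sigma> \<in> cotangent_space M (x (base_coord Z))" "cot_param M x Z = (x (base_coord Z), \<sigma>)"
    "\<And>a. \<sigma> (fd x (base_coord Z) a) = (\<Sum>j\<in>UNIV. a $ j * Z $ Inr j)"
proof -
  define z where "z = base_coord Z"
  have z: "z \<in> U" using Z by (simp add: cot_dom_def z_def)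
  define X where "X = fd x z"
  note l = fd_param_linear[OF U z, folded X_def]
  have T: "tangent_space M (x z) = range X" using tangent_space_param[OF U z] by (simp add: X_def)
  have inv: "inv_into UNIV X (X a) = a" for a using local_paramD(3)[OF U z] by (simp add: X_def)
  define \<sigma> where "\<sigma> = (\<lambda>u\<in>range X. \<Sum>j\<in>UNIV. inv_into UNIV X u $ j * Z $ Inr j)"
  have \<sigma>X: "\<sigma> (X a) = (\<Sum>j\<in>UNIV. a $ j * Z $ Inr j)" for a by (simp add: \<sigma>_def inv)
  have mem: "\<sigma> \<in> cotangent_space M (x z)"
    unfolding cotangent_space_def T
  proof (intro CollectI conjI ballI allI)
    show "\<sigma> \<in> extensional (range X)" by (simp add: \<sigma>_def)
    show "\<sigma> (u + v) = \<sigma> u + \<sigma> v" if "u \<in> range X" "v \<in> range X" for u v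
      using that by (auto simp: l(2)[symmetric] \<sigma>X sum.distrib algebra_simps)
    show "\<sigma> (c *s u) = c * \<sigma> u" if "u \<in> range X" for u c
      using that by (auto simp: l(3)[symmetric] \<sigma>X sum_distrib_left algebra_simps)
  qed
  have "\<sigma> (X (axis i 1)) = Z $ Inr i" for i by (simp add: \<sigma>X sum_axis)
  then have "cot_param M x Z = (x z, \<sigma>)"
    using cot_param_eqI[OF U Z] mem by (simp add: z_def X_def)
  then show ?thesis using that[of \<sigma>] mem \<sigma>X by (simp add: z_def X_def)
qed

lemma cot_param_in_bundle:
  "local_param M U x \<Longrightarrow> Z \<in> cot_dom U \<Longrightarrow> cot_param M x Z \<in> cotangent_bundle M"
  using local_paramD(5)[of M U x] by (auto simp: cotangent_bundle_def cot_dom_def elim!: cot_param_cases)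

lemma cot_param_image:
  fixes x :: "complex ^ 'n \<Rightarrow> complex ^ 'm"
  assumes U: "local_param M U x"
  shows "cot_param M x ` cot_dom U = Sigma (x ` U) (cotangent_space M)"
proof (intro equalityI subsetI)
  fix P assume "P \<in> cot_param M x ` cot_dom U"
  then obtain Z where Z: "Z \<in> cot_dom U" "P = cot_param M x Z" by auto
  obtain \<sigma> where "\<sigma> \<in> cotangent_space M (x (base_coord Z))" "cot_param M x Z = (x (base_coord Z), \<sigma>)"
    by (rule cot_param_cases[OF U Z(1)]) (rule that, assumption+)
  then show "P \<in> Sigma (x ` U) (cotangent_space M)" using Z by (simp add: cot_dom_def)
next
  fix P assume "P \<in> Sigma (x ` U) (cotangent_space M)"
  then obtain z \<sigma> where z: "z \<in> U" "\<sigma> \<in> cotangent_space M (x z)" "P = (x z, \<sigma>)" by auto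
  define Z where "Z = cot_coord z (\<chi> i. \<sigma> (fd x z (axis i 1)))"
  have "base_coord Z = z" "Z $ Inr i = \<sigma> (fd x z (axis i 1))" for i
    by (simp_all add: Z_def flip: fibre_coord_nth)
  then have "Z \<in> cot_dom U" "cot_param M x Z = P"
    using z by (auto simp: cot_dom_def intro!: cot_param_eqI[OF U, THEN trans])
  then show "P \<in> cot_param M x ` cot_dom U" by blast
qed

lemma cot_param_inj:
  fixes x :: "complex ^ 'n \<Rightarrow> complex ^ 'm"
  assumes U: "local_param M U x"
  shows "inj_on (cot_param M x) (cot_dom U)"
proof (rule inj_onI)
  fix Z \<xi> assume *: "Z \<in> cot_dom U" "\<xi> \<in> cot_dom U" "cot_param M x Z = cot_param M x \<xi>"
  obtain \<sigma> where s: "cot_param M x Z = (x (base_coord Z), \<sigma>)"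
    "\<And>a. \<sigma> (fd x (base_coord Z) a) = (\<Sum>j\<in>UNIV. a $ j * Z $ Inr j)" by (rule cot_param_cases[OF U *(1)]) (rule that, assumption+)
  obtain \<sigma>' where s': "cot_param M x \<xi> = (x (base_coord \<xi>), \<sigma>')"
    "\<And>a. \<sigma>' (fd x (base_coord \<xi>) a) = (\<Sum>j\<in>UNIV. a $ j * \<xi> $ Inr j)" by (rule cot_param_cases[OF U *(2)]) (rule that, assumption+)
  have b: "base_coord Z = base_coord \<xi>"
    using *(3) s(1) s'(1) *(1,2) local_paramD(4)[OF U] by (auto simp: cot_dom_def dest: inj_onD)
  have "\<sigma> = \<sigma>'" using *(3) s(1) s'(1) by simp
  then have "(\<Sum>j\<in>UNIV. a $ j * Z $ Inr j) = (\<Sum>j\<in>UNIV. a $ j * \<xi> $ Inr j)" for a :: "complex ^ 'n"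
    using s(2)[of a] s'(2)[of a] b by simp
  from this[of "axis i 1" for i] have "Z $ Inr i = \<xi> $ Inr i" for i
    by (simp add: sum_axis)
  then show "Z = \<xi>" using b by (intro cot_coord_eqI) (simp_all add: vec_eq_iff fibre_coord_nth)
qed

section \<open>The potential\<close>

locale special_geometry = lagrangean_split \<omega> \<tau> L0 L0' n
  for \<omega> :: "complex ^ 'm \<Rightarrow> complex ^ 'm \<Rightarrow> complex" and \<tau> L0 L0' and n :: "'n::finite itself" +
  fixes M :: "(complex ^ 'm) set"
  assumes lagr: "lagrangean_submanifold n \<omega> M"
    and kaehler: "pseudo_kaehler_submanifold n \<omega> \<tau> M"
    and genpos: "general_position n (cspan L0) (cspan L0') M"
begin

abbreviation T where "T m \<equiv> tangent_space M m"
abbreviation Tstar where "Tstar \<equiv> cotangent_space M"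
abbreviation TM where "TM \<equiv> cotangent_bundle M"
abbreviation act where "act \<equiv> sd_action \<omega> M"
abbreviation tr where "tr \<equiv> fibre_translation \<omega> M"
abbreviation K where "K \<equiv> potential \<omega> \<tau> L0 L0' M"
abbreviation G where "G \<equiv> metric_G \<omega> \<tau> L0 L0' M"

section \<open>Tangent spaces of \<open>M\<close> and their position relative to
  \<open>L'\<close>\<close>

lemma submanifold: "complex_submanifold n M"
  using lagr by (simp add: lagrangean_submanifold_def)

lemma obtain_chart:
  assumes "m \<in> M"
  obtains U and x :: "complex ^ 'n \<Rightarrow> complex ^ 'm" and z where "local_param M U x" "z \<in> U" "m = x z"
  using submanifold assms unfolding complex_submanifold_def by blast

lemma T_subspace:
  assumes "m \<in> M"
  shows "vec.subspace (T m)" "u \<in> T m \<Longrightarrow> v \<in> T m \<Longrightarrow> u + v \<in> T m" "u \<in> T m \<Longrightarrow> c *s u \<in> T m"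
    "u \<in> T m \<Longrightarrow> v \<in> T m \<Longrightarrow> u - v \<in> T m" "0 \<in> T m"
proof -
  show s: "vec.subspace (T m)" by (rule tangent_space_subspace[OF submanifold assms])
  show "u \<in> T m \<Longrightarrow> v \<in> T m \<Longrightarrow> u + v \<in> T m" "u \<in> T m \<Longrightarrow> c *s u \<in> T m"
    "u \<in> T m \<Longrightarrow> v \<in> T m \<Longrightarrow> u - v \<in> T m" "0 \<in> T m"
    using s by (auto intro: vec.subspace_add vec.subspace_scale vec.subspace_diff vec.subspace_0)
qed

lemma T_lagrangean:
  assumes "m \<in> M"
  shows "u \<in> T m \<longleftrightarrow> (\<forall>w\<in>T m. \<omega> u w = 0)"
proof -
  have "T m = {u. \<forall>w\<in>T m. \<omega> u w = 0}"
    using lagr assms by (simp add: lagrangean_submanifold_def lagrangean_subspace_def)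
  then show ?thesis by blast
qed

lemma T_nondegenerate:
  assumes "m \<in> M" "u \<in> T m" "\<And>v. v \<in> T m \<Longrightarrow> g v u = 0"
  shows "u = 0"
proof -
  have "g u v = 0" if "v \<in> T m" for v using assms(3)[OF that] g_cnj[of v u] by simp
  then show ?thesis using kaehler assms(1,2) by (auto simp: pseudo_kaehler_submanifold_def)
qed

text \<open>General position makes the inverse of the projection holomorphic. In a chart
  \<open>y\<close> of the image it becomes \<open>k\<close>, and \<open>p\<close> after
  \<open>k\<close> is \<open>y\<close>, so \<open>p\<close> is injective on the range of the
  derivative of \<open>k\<close>. This range is the whole tangent space, because the charts of
  \<open>M\<close> and of its image have equally many coordinates.\<close>

lemma T_Int_L':
  assumes m: "m \<in> M" and u: "u \<in> T m" "u \<in> L'"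
  shows "u = 0"
proof -
  obtain U and x :: "complex ^ 'n \<Rightarrow> complex ^ 'm" and z
    where x: "local_param M U x" "z \<in> U" "m = x z" using obtain_chart[OF m] by metis
  have B: "complex_submanifold n (p ` M)" "inj_on p M" "holo_map n (p ` M) (the_inv_into M p)"
    using genpos by (auto simp: general_position_def biholomorphism_def bij_betw_def)
  have "\<exists>W (y :: complex ^ 'n \<Rightarrow> complex ^ 'm). local_param (p ` M) W y \<and> p m \<in> y ` W"
    using B(1) m unfolding complex_submanifold_def by blast
  then obtain W and y :: "complex ^ 'n \<Rightarrow> complex ^ 'm" and w
    where y: "local_param (p ` M) W y" "w \<in> W" "p m = y w" by blast
  note y' = local_paramD[OF y(1)]
  define k where "k = the_inv_into M p \<circ> y"
  have k: "holo_on k W" unfolding k_def using B(3) y(1) by (simp add: holo_map_def)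
  have kM: "k v \<in> M" and pk: "p (k v) = y v" if "v \<in> W" for v
    using y'(5) that the_inv_into_into[OF B(2), of "y v" M] f_the_inv_into_f[OF B(2), of "y v"]
    by (auto simp: k_def)
  have kw: "k w = x z" unfolding k_def comp_apply y(3)[symmetric] x(3)[symmetric] by (rule the_inv_into_f_f[OF B(2) m])
  note dk = holo_on_has_derivative[OF k y(2)]
  have "eventually (\<lambda>v. v \<in> W) (at w)" by (rule eventually_at_in_open'[OF y'(1) y(2)])
  then have "eventually (\<lambda>v. k v \<in> M) (at w)" by eventually_elim (rule kM)
  from param_inverse_has_derivative[OF x(1,2) kw this dk] obtain C' F
    where C': "(F has_derivative C') (at w)" "\<And>a. fd x z (C' a) = fd k w a" by metis
  have pD: "p (fd k w a) = fd y w a" for a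
  proof -
    have "((\<lambda>v. p (k v)) has_derivative (\<lambda>a. p (fd k w a))) (at w)"
      by (rule has_derivative_compose[OF dk proj_has_derivative])
    then have "(y has_derivative (\<lambda>a. p (fd k w a))) (at w)"
      by (rule has_derivative_transform_within_open[OF _ y'(1) y(2)]) (rule pk)
    then show ?thesis by (simp add: fd_eq)
  qed
  have lin: "linear C'" by (rule has_derivative_linear[OF C'(1)])
  have "inj C'"
  proof (rule injI)
    fix a b assume "C' a = C' b"
    then have "fd k w a = fd k w b" using C'(2) by metis
    then have "fd y w a = fd y w b" using pD by metis
    then show "a = b" by (rule injD[OF y'(3)[OF y(2)]])
  qed
  then have "surj C'" by (rule linear_injective_imp_surjective[OF lin]) (rule refl)
  obtain b where b: "u = fd x z b" using u tangent_space_param[OF x(1,2)] x(3) by auto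
  obtain a where a: "b = C' a" using \<open>surj C'\<close> by (auto simp: surj_def)
  have "u = fd k w a" using a b C'(2) by simp
  then have "fd y w a = 0" using pD[of a] u(2) proj_eq_0_iff[of "fd k w a"] by metis
  then have "a = 0" using injD[OF y'(3)[OF y(2)], of a 0] fd_param_linear(5)[OF y(1,2)] by simp
  then show ?thesis using a b linear_0[OF lin] fd_param_linear(5)[OF x(1,2)] by simp
qed

text \<open>Injective maps between spaces of equal dimension are onto. Real linearity of
  \<open>f\<close> allows both the linear pairings with \<omega> and the antilinear ones with
  \<gamma>.\<close>

lemma T_onto:
  fixes f :: "complex ^ 'm \<Rightarrow> complex ^ 'n"
  assumes m: "m \<in> M" and f: "linear f" and inj: "\<And>u. u \<in> T m \<Longrightarrow> f u = 0 \<Longrightarrow> u = 0"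
  obtains u where "u \<in> T m" "f u = c"
proof -
  obtain U and x :: "complex ^ 'n \<Rightarrow> complex ^ 'm" and z
    where x: "local_param M U x" "z \<in> U" "m = x z" using obtain_chart[OF m] by metis
  note l = fd_param_linear[OF x(1,2)] and Tx = tangent_space_param[OF x(1,2), folded x(3)]
  have lin: "linear (f \<circ> fd x z)" by (rule linear_compose[OF l(1) f])
  have "inj (f \<circ> fd x z)"
  proof (subst linear_injective_0[OF lin], intro allI impI)
    fix a assume "(f \<circ> fd x z) a = 0"
    then have "fd x z a = fd x z 0" using inj[of "fd x z a"] Tx l(5) by simp
    then show "a = 0" by (rule injD[OF local_paramD(3)[OF x(1,2)]])
  qed
  then have "surj (f \<circ> fd x z)" by (rule linear_injective_imp_surjective[OF lin]) (rule refl)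
  then obtain a where "c = (f \<circ> fd x z) a" by (rule surjE)
  then show ?thesis using that[of "fd x z a"] Tx by simp
qed

text \<open>
  The tangent vector at \<open>m\<close> with the same projection to \<open>L\<close> as \<open>v\<close>. The real structure \<open>\<rho>'\<close>
  of the tangent space is \<open>u \<mapsto> lift m (\<tau> u)\<close>.
\<close>

definition lift :: "complex ^ 'm \<Rightarrow> complex ^ 'm \<Rightarrow> complex ^ 'm" where
  "lift m v = (THE t. t \<in> T m \<and> t - v \<in> L')"

lemma lift_unique:
  assumes "m \<in> M" "t \<in> T m" "t - v \<in> L'" shows "lift m v = t"
  unfolding lift_def
proof (rule the_equality)
  fix s assume s: "s \<in> T m \<and> s - v \<in> L'"
  have eq: "s - t = (s - v) - (t - v)" by simp
  have "s - t \<in> L'" unfolding eq using s assms(3) by (blast intro: vec.span_diff)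
  then have "s - t = 0" using T_Int_L'[OF assms(1)] T_subspace(4)[OF assms(1)] s assms(2) by blast
  then show "s = t" by simp
qed (use assms in simp)

text \<open>A vector is determined modulo \<open>L'\<close> by its pairings with the vectors
  \<open>e i\<close>. On the tangent space these pairings are injective by \<open>T_Int_L'\<close>,
  so they attain all values.\<close>

lemma lift_in:
  assumes "m \<in> M" shows "lift m v \<in> T m" "lift m v - v \<in> L'"
proof -
  obtain e :: "'n \<Rightarrow> complex ^ 'm" where e: "\<And>u. u \<in> L' \<longleftrightarrow> (\<forall>i. \<omega> u (e i) = 0)"
    using L'_annihilator by metis
  define f :: "complex ^ 'm \<Rightarrow> complex ^ 'n" where "f u = (\<chi> i. \<omega> u (e i))" for u
  have "linear f"
    by (rule linearI) (auto simp: f_def vec_eq_iff w_add_left linear_cmul[OF linear_w_left])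
  moreover have "u = 0" if "u \<in> T m" "f u = 0" for u
    using that by (intro T_Int_L'[OF assms]) (auto simp: e f_def vec_eq_iff)
  ultimately obtain t where t: "t \<in> T m" "f t = f v" using T_onto[OF assms] by metis
  then have "t - v \<in> L'" by (simp add: e w_diff_left f_def vec_eq_iff)
  with t have "lift m v = t" by (intro lift_unique assms)
  then show "lift m v \<in> T m" "lift m v - v \<in> L'" using t \<open>t - v \<in> L'\<close> by auto
qed

lemma lift_add: "m \<in> M \<Longrightarrow> lift m (u + v) = lift m u + lift m v"
proof (rule lift_unique)
  assume m: "m \<in> M"
  have "lift m u + lift m v - (u + v) = (lift m u - u) + (lift m v - v)" by simp
  then show "lift m u + lift m v - (u + v) \<in> L'"
    using vec.span_add[OF lift_in(2)[OF m] lift_in(2)[OF m]] by metis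
  show "lift m u + lift m v \<in> T m" by (intro T_subspace(2) lift_in m)
qed

lemma lift_scale: "m \<in> M \<Longrightarrow> lift m (c *s v) = c *s lift m v"
proof (rule lift_unique)
  assume m: "m \<in> M"
  show "c *s lift m v - c *s v \<in> L'"
    using vec.span_scale[OF lift_in(2)[OF m]] by (metis vec.scale_right_diff_distrib)
  show "c *s lift m v \<in> T m" by (intro T_subspace(3) lift_in m)
qed

lemma lift_tau_tau:
  assumes "m \<in> M" "u \<in> T m" shows "lift m (\<tau> (lift m (\<tau> u))) = u"
proof (rule lift_unique[OF assms])
  have "u - \<tau> (lift m (\<tau> u)) = - \<tau> (lift m (\<tau> u) - \<tau> u)" by (simp add: tau_diff)
  then show "u - \<tau> (lift m (\<tau> u)) \<in> L'" using vec.span_neg[OF tau_L'[OF lift_in(2)[OF assms(1)]]] by metis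
qed

text \<open>The fixed vectors of any competitor \<open>r\<close> project into \<open>L0\<close>,
  which makes them fixed by \<open>u \<mapsto> lift m (\<tau> u)\<close> too. Antilinearity extends
  the agreement to the whole tangent space.\<close>

lemma tangent_conj_eq:
  assumes m: "m \<in> M" and u: "u \<in> T m"
  shows "tangent_conj L0 L0' M m u = lift m (\<tau> u)"
proof -
  define r0 where "r0 = (\<lambda>u\<in>T m. lift m (\<tau> u))"
  have r0: "r0 u = lift m (\<tau> u)" if "u \<in> T m" for u using that by (simp add: r0_def)
  note T = T_subspace[OF m] and l = lift_in[OF m]
  have "tangent_conj L0 L0' M m = r0"
    unfolding tangent_conj_def
  proof (rule the_equality, intro conjI ballI allI)
    show "r0 \<in> extensional (T m)" by (simp add: r0_def)
    show "r0 u \<in> T m" if "u \<in> T m" for u using l that by (simp add: r0)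
    show "r0 (r0 u) = u" if "u \<in> T m" for u using that l by (simp add: r0 lift_tau_tau m)
    show "r0 (u + v) = r0 u + r0 v" if "u \<in> T m" "v \<in> T m" for u v
      using that T by (simp add: r0 tau_add lift_add m)
    show "r0 (c *s u) = cnj c *s r0 u" if "u \<in> T m" for c u
      using that T by (simp add: r0 tau_scale lift_scale m)
    show "p ` {u \<in> T m. r0 u = u} = L0"
    proof (intro equalityI subsetI)
      fix v assume "v \<in> p ` {u \<in> T m. r0 u = u}"
      then obtain u where u: "u \<in> T m" "r0 u = u" "v = p u" by auto
      then have "u - \<tau> u \<in> L'" using l(2)[of "\<tau> u"] by (simp add: r0)
      then have "\<tau> (p u) = p u" using proj_eq_iff[of u "\<tau> u"] by (simp add: proj_tau)
      then show "v \<in> L0" using L_fixset[OF proj_in(1)] u by simp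
    next
      fix v assume v: "v \<in> L0"
      have "p (lift m v) = p v" using proj_eq_iff l by blast
      also have "p v = v" using v by (intro proj_unique) (auto intro: vec.span_base vec.span_zero)
      finally have pl: "p (lift m v) = v" .
      then have "p (lift m v) = p (\<tau> (lift m v))" using v by (simp add: proj_tau tau_L0)
      then have "lift m v - \<tau> (lift m v) \<in> L'" using proj_eq_iff by blast
      then have "r0 (lift m v) = lift m v" using l by (simp add: r0 lift_unique m)
      then show "v \<in> p ` {u \<in> T m. r0 u = u}" using pl l by (intro image_eqI[of _ _ "lift m v"]) auto
    qed
  next
    fix r assume r: "r \<in> extensional (T m) \<and>
        (\<forall>u\<in>T m. r u \<in> T m \<and> r (r u) = u) \<and>
        (\<forall>u\<in>T m. \<forall>v\<in>T m. r (u + v) = r u + r v) \<and>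
        (\<forall>c. \<forall>u\<in>T m. r (c *s u) = cnj c *s r u) \<and> p ` {u \<in> T m. r u = u} = L0"
    have r1: "r u \<in> T m" "r (r u) = u" "r (c *s u) = cnj c *s r u" if "u \<in> T m" for u c using r that by auto
    have r2: "r (u + v) = r u + r v" if "u \<in> T m" "v \<in> T m" for u v using r that by auto
    have fixed: "lift m (\<tau> u) = u" if u: "u \<in> T m" "r u = u" for u
    proof -
      have "p u \<in> L0" using r u by blast
      then have "p (\<tau> u) = p u" by (simp add: proj_tau tau_L0)
      then have "u - \<tau> u \<in> L'" using proj_eq_iff by metis
      then show ?thesis using u by (intro lift_unique m)
    qed
    show "r = r0"
    proof (rule extensionalityI[of _ "T m"])
      fix u assume u: "u \<in> T m"
      \<comment> \<open>Real and imaginary parts of \<open>u\<close> with respect to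
        \<open>r\<close>. The difference is written with the factor -1 because additivity and
        antilinear homogeneity are the rules available for \<open>r\<close>.\<close>
      define a where "a = (1/2) *s (u + r u)"
      define b where "b = (-\<i>/2) *s (u + (-1) *s r u)"
      note ru = r1(1)[OF u]
      have ab: "a \<in> T m" "b \<in> T m" unfolding a_def b_def using u ru by (auto intro!: T)
      have ra: "r a = a" unfolding a_def using u ru by (simp add: r1 r2 T vec_eq_iff algebra_simps)
      have rb: "r b = b" unfolding b_def
        using u ru T(3)[OF ru, of "-1"] by (simp only: r1 r2 T) (simp add: vec_eq_iff algebra_simps)
      have eq: "u = a + \<i> *s b" by (simp add: a_def b_def vec_eq_iff field_simps)
      have "r u = a - \<i> *s b" unfolding eq using ab ra rb by (simp add: r1 r2 T)
      moreover have "lift m (\<tau> u) = a - \<i> *s b"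
        unfolding eq using fixed[OF ab(1) ra] fixed[OF ab(2) rb] by (simp add: tau_add tau_scale lift_add lift_scale m vec_eq_iff flip: vec.scale_minus_left)
      ultimately show "r u = r0 u" using u by (simp add: r0)
    qed (use r in \<open>auto simp: r0_def\<close>)
  qed
  then show ?thesis using u by (simp add: r0)
qed

section \<open>Dual vectors and the change of the potential under translations\<close>

lemma covector_real_part:
  assumes "m \<in> M" "\<sigma> \<in> Tstar m"
  shows "(\<lambda>u\<in>T m. \<sigma> u + cnj (\<sigma> (lift m (\<tau> u)))) \<in> Tstar m"
  unfolding cotangent_space_def
proof (intro CollectI conjI ballI allI)
  note s = cotangent_spaceD[OF assms(2)] and T = T_subspace[OF assms(1)] and l = lift_in[OF assms(1)]
  show "(\<lambda>u\<in>T m. \<sigma> u + cnj (\<sigma> (lift m (\<tau> u)))) (u + v) =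
     (\<lambda>u\<in>T m. \<sigma> u + cnj (\<sigma> (lift m (\<tau> u)))) u + (\<lambda>u\<in>T m. \<sigma> u + cnj (\<sigma> (lift m (\<tau> u)))) v"
    if "u \<in> T m" "v \<in> T m" for u v
    using that by (simp add: T tau_add lift_add assms s l)
  show "(\<lambda>u\<in>T m. \<sigma> u + cnj (\<sigma> (lift m (\<tau> u)))) (c *s u) = c * (\<lambda>u\<in>T m. \<sigma> u + cnj (\<sigma> (lift m (\<tau> u)))) u"
    if "u \<in> T m" for c u
    using that by (simp add: T tau_scale lift_scale assms s l algebra_simps)
qed simp

text \<open>Nondegeneracy of \<gamma> makes the pairings with a frame injective on the tangent
  space, hence onto.\<close>

lemma sharp_ex:
  assumes m: "m \<in> M" and \<eta>: "\<eta> \<in> Tstar m"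
  shows "\<exists>s\<in>T m. \<forall>u\<in>T m. g u s = \<eta> u"
proof -
  obtain U and x :: "complex ^ 'n \<Rightarrow> complex ^ 'm" and z
    where x: "local_param M U x" "z \<in> U" "m = x z" using obtain_chart[OF m] by metis
  note Tx = tangent_space_param[OF x(1,2), folded x(3)]
  define X where "X j = fd x z (axis j 1)" for j
  have Xexp: "fd x z a = (\<Sum>j\<in>UNIV. a $ j *s X j)" for a unfolding X_def by (rule fd_param_expand[OF x(1,2)])
  have \<eta>exp: "\<eta> (fd x z a) = (\<Sum>j\<in>UNIV. a $ j * \<eta> (X j))" for a
    unfolding X_def using cotangent_param_expand[OF x(1,2), of \<eta> a] \<eta> x(3) by simp
  have gexp: "g (fd x z a) s = (\<Sum>j\<in>UNIV. a $ j * g (X j) s)" for a s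
    unfolding Xexp by (simp add: g_sum_left g_scale_left)
  define f :: "complex ^ 'm \<Rightarrow> complex ^ 'n" where "f s = (\<chi> j. g (X j) s)" for s
  have "linear f"
    by (rule linearI) (auto simp: f_def vec_eq_iff g_add_right g_scale_right scaleR_eq_smult)
  moreover have "s = 0" if "s \<in> T m" "f s = 0" for s
    using that by (intro T_nondegenerate[OF m]) (auto simp: Tx gexp f_def vec_eq_iff)
  ultimately obtain s where s: "s \<in> T m" "f s = (\<chi> j. \<eta> (X j))" using T_onto[OF m] by metis
  then have "g u s = \<eta> u" if "u \<in> T m" for u using that Tx by (auto simp: gexp \<eta>exp f_def vec_eq_iff)
  then show ?thesis using s(1) by blast
qed

text \<open>This removes the description operators: to know the potential at \<sigma> it suffices to
  exhibit the vector dual to \<sigma> + \<rho>(\<sigma>).\<close>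

lemma potential_eq:
  assumes m: "m \<in> M" and \<sigma>: "\<sigma> \<in> Tstar m" and s: "s \<in> T m"
    and eq: "\<And>u. u \<in> T m \<Longrightarrow> g u s = \<sigma> u + cnj (\<sigma> (lift m (\<tau> u)))"
  shows "K (m, \<sigma>) = g m m + g s s"
proof -
  define \<eta> where "\<eta> = (\<lambda>u\<in>T m. \<sigma> u + cotangent_conj L0 L0' M m \<sigma> u)"
  have \<eta>: "\<eta> u = g u s" if "u \<in> T m" for u
    using that eq by (simp add: \<eta>_def cotangent_conj_def tangent_conj_eq[OF m])
  have "sharp \<omega> \<tau> M m \<eta> = s"
    unfolding sharp_def
  proof (rule the_equality)
    fix t assume t: "t \<in> T m \<and> (\<forall>u\<in>T m. g u t = \<eta> u)"
    have "t - s = 0"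
      by (rule T_nondegenerate[OF m]) (use t s \<eta> in \<open>auto simp: g_diff_right intro: T_subspace(4)[OF m]\<close>)
    then show "t = s" by simp
  qed (use s \<eta> in auto)
  then show ?thesis by (simp add: potential_def Let_def inverse_metric_def flip: \<eta>_def)
qed

lemma potential_ex:
  assumes m: "m \<in> M" and \<sigma>: "\<sigma> \<in> Tstar m"
  obtains s where "s \<in> T m" "\<And>u. u \<in> T m \<Longrightarrow> g u s = \<sigma> u + cnj (\<sigma> (lift m (\<tau> u)))"
    "K (m, \<sigma>) = g m m + g s s"
proof -
  obtain s where s: "s \<in> T m" "\<forall>u\<in>T m. g u s = (\<lambda>u\<in>T m. \<sigma> u + cnj (\<sigma> (lift m (\<tau> u)))) u"
    using sharp_ex[OF m covector_real_part[OF m \<sigma>]] by blast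
  then have "g u s = \<sigma> u + cnj (\<sigma> (lift m (\<tau> u)))" if "u \<in> T m" for u using that by simp
  then show ?thesis using that s(1) potential_eq[OF m \<sigma>] by blast
qed

lemma psi_translate_in:
  assumes m: "m \<in> M" and \<sigma>: "\<sigma> \<in> Tstar m"
  shows "(\<lambda>u\<in>T m. \<sigma> u + \<i> * psi \<omega> M m v u) \<in> Tstar m"
  unfolding cotangent_space_def
proof (intro CollectI conjI ballI allI)
  note s = cotangent_spaceD[OF \<sigma>] and T = T_subspace[OF m]
  show "(\<lambda>u\<in>T m. \<sigma> u + \<i> * psi \<omega> M m v u) (a + b) =
     (\<lambda>u\<in>T m. \<sigma> u + \<i> * psi \<omega> M m v u) a + (\<lambda>u\<in>T m. \<sigma> u + \<i> * psi \<omega> M m v u) b"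
    if "a \<in> T m" "b \<in> T m" for a b using that by (simp add: T s psi_def w_add_right algebra_simps)
  show "(\<lambda>u\<in>T m. \<sigma> u + \<i> * psi \<omega> M m v u) (c *s u) = c * (\<lambda>u\<in>T m. \<sigma> u + \<i> * psi \<omega> M m v u) u"
    if "u \<in> T m" for c u using that by (simp add: T s psi_def w_scale_right algebra_simps)
qed simp

text \<open>With t the lift of \<open>v\<close>, the dual vector passes from s to s - t, which adds
  - 2 Re \<gamma>(t, s) + \<gamma>(t, t). As t is fixed by the real structure of the tangent space,
  \<gamma>(t, s) = 2 Re \<sigma>(t), whence the constant 4. The other summand is \<gamma>(t, t) = Re
  (- 2 i \<omega>(v, t)).\<close>

lemma potential_translate:
  assumes m: "m \<in> M" and \<sigma>: "\<sigma> \<in> Tstar m" and v: "\<tau> v = v"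
  shows "K (m, \<lambda>u\<in>T m. \<sigma> u + \<i> * psi \<omega> M m v u) =
    K (m, \<sigma>) +
      complex_of_real (Re (- 4 * \<sigma> (lift m v) - 2 * \<i> * \<omega> v (lift m v)))"
proof -
  define t where "t = lift m v"
  note l = lift_in[OF m]
  have t: "t \<in> T m" "t - v \<in> L'" using l[of v] by (auto simp: t_def)
  obtain s where s: "s \<in> T m" "\<And>u. u \<in> T m \<Longrightarrow> g u s = \<sigma> u + cnj (\<sigma> (lift m (\<tau> u)))"
    "K (m, \<sigma>) = g m m + g s s" by (rule potential_ex[OF m \<sigma>]) (rule that, assumption+)
  have Tw: "\<omega> a b = 0" if "a \<in> T m" "b \<in> T m" for a b using T_lagrangean[OF m] that by blast
  \<comment> \<open>Paired with tangent vectors, \<open>v\<close> may be replaced by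
    \<open>- (t - v)\<close>, since the tangent space is isotropic. As \<open>t - v\<close> lies in
    the isotropic \<open>L'\<close>, the lift of \<open>\<tau> u\<close> may then be replaced by
    \<open>\<tau> u\<close>, and conjugation brings in \<open>\<tau> t\<close>.\<close>
  have \<delta>: "\<i> * \<omega> v u + cnj (\<i> * \<omega> v (lift m (\<tau> u))) = - g u t" if u: "u \<in> T m" for u
  proof -
    have vu: "\<omega> v u = - \<omega> (t - v) u" if "u \<in> T m" for u using Tw[OF t(1) that] by (simp add: w_diff_left)
    have "\<omega> (t - v) (lift m (\<tau> u)) = \<omega> (t - v) (\<tau> u)"
      using L'_isotropic[OF t(2) l(2)[of "\<tau> u"]] by (simp add: w_diff_right)
    then have "cnj (\<omega> v (lift m (\<tau> u))) = - cnj (\<omega> (t - v) (\<tau> u))" using vu[OF l(1)] by simp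
    also have "cnj (\<omega> (t - v) (\<tau> u)) = \<omega> (\<tau> (t - v)) u" using w_tau[of "t - v" "\<tau> u"] by simp
    also have "\<dots> = \<omega> (\<tau> t) u - \<omega> v u" unfolding tau_diff v by (rule w_diff_left)
    finally have c: "cnj (\<omega> v (lift m (\<tau> u))) = \<omega> v u - \<omega> (\<tau> t) u" by simp
    have "\<i> * \<omega> v u + cnj (\<i> * \<omega> v (lift m (\<tau> u))) = \<i> * \<omega> (\<tau> t) u"
      by (simp add: c algebra_simps)
    also have "\<dots> = - g u t" using w_antisym[of "\<tau> t" u] by (simp add: herm_def)
    finally show ?thesis .
  qed
  have new: "K (m, \<lambda>u\<in>T m. \<sigma> u + \<i> * psi \<omega> M m v u) = g m m + g (s - t) (s - t)"
  proof (rule potential_eq[OF m psi_translate_in[OF m \<sigma>]])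
    show "s - t \<in> T m" using s t by (intro T_subspace(4) m)
    fix u assume u: "u \<in> T m"
    show "g u (s - t) = (\<lambda>u\<in>T m. \<sigma> u + \<i> * psi \<omega> M m v u) u +
        cnj ((\<lambda>u\<in>T m. \<sigma> u + \<i> * psi \<omega> M m v u) (lift m (\<tau> u)))"
      using \<delta>[OF u] s(2)[OF u] u l by (simp add: g_diff_right psi_def algebra_simps)
  qed
  have "lift m (\<tau> t) = t"
  proof (rule lift_unique[OF m t(1)])
    have "t - \<tau> t = (t - v) - \<tau> (t - v)" by (simp add: tau_diff v)
    then show "t - \<tau> t \<in> L'" using vec.span_diff[OF t(2) tau_L'[OF t(2)]] by metis
  qed
  then have gts: "g t s = complex_of_real (2 * Re (\<sigma> t))"
    using s(2)[OF t(1)] by (simp add: complex_eq_iff)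
  then have gst: "g s t = complex_of_real (2 * Re (\<sigma> t))" using g_cnj[of t s] by simp
  \<comment> \<open>Both \<open>t - v\<close> and its conjugate \<open>\<tau> t - v\<close> lie in
    \<open>L'\<close>. Expanding their vanishing pairing evaluates
    \<open>\<omega> t (\<tau> t)\<close>.\<close>
  have gtt: "g t t = complex_of_real (Re (- 2 * \<i> * \<omega> v t))"
  proof -
    have "\<omega> (t - v) (\<tau> t - v) = 0"
      using L'_isotropic[OF t(2) tau_L'[OF t(2)]] by (simp add: tau_diff v)
    then have "\<omega> t (\<tau> t) = \<omega> v (\<tau> t) + \<omega> t v" by (simp add: w_diff_left w_diff_right w_refl algebra_simps)
    also have "\<dots> = cnj (\<omega> v t) - \<omega> v t" using w_tau[of v t] w_antisym[of t v] v by simp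
    finally show ?thesis by (simp add: herm_def complex_eq_iff)
  qed
  show ?thesis unfolding new s(3) t_def[symmetric]
    by (simp add: g_diff_left g_diff_right gts gst gtt)
qed

end

section \<open>Regularity of the potential in induced charts\<close>

lemma holo_on_fd:
  fixes f :: "complex ^ 'k \<Rightarrow> complex ^ 'l"
  assumes f: "holo_on f S" and S: "open S" shows "holo_on (\<lambda>z. fd f z a) S"
  unfolding holo_on_iff
proof
  fix i
  show "holo_fun (\<lambda>z. fd f z a $ i) S"
  proof (rule holo_fun_cong[OF S])
    have "holo_fun (\<lambda>z. f z $ i) S" using f by (simp add: holo_on_iff)
    then show "holo_fun (\<lambda>z. fd (\<lambda>z. f z $ i) z a) S" by (rule holo_fun_fd[OF _ S])
    show "fd (\<lambda>z. f z $ i) z a = fd f z a $ i" if "z \<in> S" for z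
      by (rule fd_nth[OF differentiableI[OF holo_on_has_derivative[OF f that]]])
  qed
qed

context special_geometry
begin

lemma holo_fun_w: "holo_on f S \<Longrightarrow> holo_fun (\<lambda>z. \<omega> (f z) v) S"
proof -
  assume f: "holo_on f S"
  have "\<omega> (f z) v = (\<Sum>a\<in>UNIV. \<omega> (axis a 1) v * f z $ a)" for z
    by (subst basis_expansion[of "f z", symmetric]) (simp only: w_sum_left w_scale_left mult.commute)
  then show ?thesis using f by (auto simp: holo_on_iff intro!: holo_fun_sum holo_fun_cmult)
qed

lemma twice_diff_g:
  assumes f: "holo_on f S" and h: "holo_on h S" and S: "open S"
  shows "twice_diff (\<lambda>z. g (f z) (h z)) S"
proof -
  have eq: "g (f z) (h z) = (\<Sum>a\<in>UNIV. cnj (h z $ a) * (\<i> * \<omega> (f z) (\<tau> (axis a 1))))" for z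
    by (subst basis_expansion[of "h z", symmetric]) (simp only: g_sum_right g_scale_right, simp add: herm_def)
  have "twice_diff (\<lambda>z. h z $ a) S" for a using h by (intro holo_fun_twice_diff S) (auto simp: holo_on_iff)
  moreover have "twice_diff (\<lambda>z. \<omega> (f z) (\<tau> (axis a 1))) S" for a by (intro holo_fun_twice_diff S holo_fun_w f)
  ultimately show ?thesis unfolding eq
    by (intro twice_diff_sum twice_diff_mult twice_diff_cnj twice_diff_const S)
qed

lemma holo_on_frame:
  fixes x :: "complex ^ 'n \<Rightarrow> complex ^ 'm"
  assumes U: "local_param M U x"
  shows "holo_on (\<lambda>Z :: complex ^ ('n + 'n). fd x (base_coord Z) a) (cot_dom U)"
    and "holo_on (\<lambda>Z :: complex ^ ('n + 'n). x (base_coord Z)) (cot_dom U)"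
proof -
  note U' = local_paramD[OF U]
  have sub: "base_coord ` cot_dom U \<subseteq> U" by (auto simp: cot_dom_def)
  have "holo_on (\<lambda>z. fd x z a) U" by (rule holo_on_fd[OF U'(2,1)])
  then show "holo_on (\<lambda>Z :: complex ^ ('n + 'n). fd x (base_coord Z) a) (cot_dom U)"
    by (rule holo_on_compose[OF holo_on_base_coord _ sub])
  show "holo_on (\<lambda>Z :: complex ^ ('n + 'n). x (base_coord Z)) (cot_dom U)"
    by (rule holo_on_compose[OF holo_on_base_coord U'(2) sub])
qed

lemmas holo_fun_linear_system = linear_system_closed[where P = "\<lambda>f. holo_fun f S" and S = S for S,
    OF holo_fun_const holo_fun_add holo_fun_mult holo_fun_inverse holo_fun_cong]

context
  fixes U and x :: "complex ^ 'n \<Rightarrow> complex ^ 'm" and e :: "'n \<Rightarrow> complex ^ 'm"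
    and X :: "complex ^ ('n + 'n) \<Rightarrow> 'n \<Rightarrow> complex ^ 'm"
  assumes U: "local_param M U x"
    and eL: "\<And>i. e i \<in> L0'" and e: "\<And>u. u \<in> L' \<longleftrightarrow> (\<forall>i. \<omega> u (e i) = 0)"
  defines "X \<equiv> \<lambda>Z j. fd x (base_coord Z) (axis j 1)"
begin

lemma frame_expand: "Z \<in> cot_dom U \<Longrightarrow> fd x (base_coord Z) a = (\<Sum>j\<in>UNIV. a $ j *s X Z j)"
  unfolding X_def by (rule fd_param_expand[OF U]) (simp add: cot_dom_def)

lemma frame_T: "Z \<in> cot_dom U \<Longrightarrow> T (x (base_coord Z)) = range (\<lambda>a :: complex ^ 'n. \<Sum>j\<in>UNIV. a $ j *s X Z j)"
  using tangent_space_param[OF U, of "base_coord Z"] by (simp add: cot_dom_def frame_expand cong: image_cong)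

lemma frame_in: "Z \<in> cot_dom U \<Longrightarrow> X Z j \<in> T (x (base_coord Z))"
  using tangent_space_param[OF U, of "base_coord Z"] by (simp add: cot_dom_def X_def)

lemma base_in: "Z \<in> cot_dom U \<Longrightarrow> x (base_coord Z) \<in> M"
  using local_paramD(5)[OF U] by (auto simp: cot_dom_def)

lemma frame_inj:
  assumes Z: "Z \<in> cot_dom U" and "(\<Sum>j\<in>UNIV. a j *s X Z j) = 0" shows "a = (\<lambda>_. 0)"
proof -
  have z: "base_coord Z \<in> U" using Z by (simp add: cot_dom_def)
  have "fd x (base_coord Z) (\<chi> j. a j) = fd x (base_coord Z) 0"
    using assms(2) by (simp add: frame_expand[OF Z])
  then have "(\<chi> j. a j) = 0" by (rule injD[OF local_paramD(3)[OF U z]])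
  then show ?thesis by (simp add: vec_eq_iff fun_eq_iff)
qed

lemma frame_open: "open (cot_dom U :: (complex ^ ('n + 'n)) set)"
  by (rule open_cot_dom[OF local_paramD(1)[OF U]])

lemma holo_fun_frame_w: "holo_fun (\<lambda>Z. \<omega> (X Z j) v) (cot_dom U)"
  unfolding X_def by (rule holo_fun_w[OF holo_on_frame(1)[OF U]])

text \<open>The choice in \<open>inv_into\<close> hides how this depends on \<open>Z\<close>; the
  dependence becomes visible through the linear system \<open>lift_coord_system\<close>.\<close>

definition lift_coord :: "complex ^ ('n + 'n) \<Rightarrow> complex ^ 'm \<Rightarrow> complex ^ 'n" where
  "lift_coord Z v = inv_into UNIV (fd x (base_coord Z)) (lift (x (base_coord Z)) v)"

lemma fd_lift_coord:
  assumes "Z \<in> cot_dom U" shows "fd x (base_coord Z) (lift_coord Z v) = lift (x (base_coord Z)) v"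
  using lift_in(1)[OF base_in[OF assms]] tangent_space_param[OF U, of "base_coord Z"] assms
  unfolding lift_coord_def by (intro f_inv_into_f) (simp add: cot_dom_def)

lemma lift_coord_system:
  assumes Z: "Z \<in> cot_dom U"
  shows "(\<Sum>j\<in>UNIV. \<omega> (X Z j) (e i) * lift_coord Z v $ j) = \<omega> v (e i)"
proof -
  have "\<omega> (lift (x (base_coord Z)) v - v) (e i) = 0" using lift_in(2)[OF base_in[OF Z]] e by blast
  then show ?thesis unfolding fd_lift_coord[OF Z, symmetric] frame_expand[OF Z]
    by (simp add: w_diff_left w_sum_left w_scale_left mult.commute)
qed

text \<open>Transversality of the tangent space to \<open>L'\<close>, in the form that makes the
  coefficient matrix invertible.\<close>

lemma frame_w_inj:
  assumes Z: "Z \<in> cot_dom U" and c: "\<And>i. (\<Sum>j\<in>UNIV. \<omega> (X Z j) (e i) * c j) = 0"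
  shows "c = (\<lambda>_. 0)"
proof -
  define u where "u = (\<Sum>j\<in>UNIV. c j *s X Z j)"
  have "u \<in> L'" unfolding e using c by (simp add: u_def w_sum_left w_scale_left mult.commute)
  moreover have "u \<in> T (x (base_coord Z))" unfolding frame_T[OF Z] u_def
    by (rule image_eqI[of _ _ "\<chi> j. c j"]) simp_all
  ultimately have "u = 0" using T_Int_L'[OF base_in[OF Z]] by blast
  then show ?thesis unfolding u_def by (rule frame_inj[OF Z])
qed

text \<open>Two linear systems in succession. The first gives the coordinates of the lifts of the
  conjugated frame vectors. The second gives the dual vector; its matrix is the Gram matrix of
  \<gamma>, and its right-hand sides are built from the first solution.\<close>

lemma twice_diff_potential_aux: "twice_diff (K \<circ> cot_param M x) (cot_dom U)"
proof -
  note op = frame_open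
  note system = linear_system_closed[where P = "\<lambda>f. twice_diff f (cot_dom U)" and S = "cot_dom U",
      OF twice_diff_const twice_diff_add[OF op] twice_diff_mult[OF op] twice_diff_inverse[OF op]]
  \<comment> \<open>The vectors \<open>e i\<close> are real, so the right-hand sides of the first
    system are conjugates of holomorphic functions.\<close>
  have tau: "\<omega> (\<tau> u) (e i) = cnj (\<omega> u (e i))" for u i using w_tau[of u "e i"] tau_L0(2)[OF eL] by simp
  have B: "twice_diff (\<lambda>Z. lift_coord Z (\<tau> (X Z k)) $ j) (cot_dom U)" for k j
  proof (rule system[where A = "\<lambda>Z i j. \<omega> (X Z j) (e i)" and b = "\<lambda>Z i. \<omega> (\<tau> (X Z k)) (e i)"
        and s = "\<lambda>Z j. lift_coord Z (\<tau> (X Z k)) $ j"])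
    show "twice_diff (\<lambda>Z. \<omega> (\<tau> (X Z k)) (e i)) (cot_dom U)" for i
      unfolding tau by (intro twice_diff_cnj op holo_fun_twice_diff holo_fun_frame_w)
  qed (auto intro: twice_diff_cong[OF op] holo_fun_twice_diff[OF holo_fun_frame_w op] frame_w_inj lift_coord_system)
  \<comment> \<open>The value of \<sigma> + \<rho>(\<sigma>) on the frame vector
    \<open>X Z j\<close>.\<close>
  define b where "b Z j = Z $ Inr j + cnj (\<Sum>k\<in>UNIV. lift_coord Z (\<tau> (X Z j)) $ k * Z $ Inr k)" for Z j
  have b2: "twice_diff (\<lambda>Z. b Z j) (cot_dom U)" for j
    unfolding b_def
    by (intro twice_diff_sum twice_diff_mult twice_diff_add twice_diff_cnj op B holo_fun_twice_diff holo_fun_nth)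
  \<comment> \<open>\<open>R\<close> stands for the conjugated coordinates of the dual vector,
    because \<gamma> is antilinear in its second argument.\<close>
  define Q where "Q Z R \<longleftrightarrow> (\<forall>j. (\<Sum>k\<in>UNIV. g (X Z j) (X Z k) * R k) = b Z j) \<and>
      (K \<circ> cot_param M x) Z = g (x (base_coord Z)) (x (base_coord Z)) + (\<Sum>k\<in>UNIV. cnj (R k) * b Z k)" for Z R
  \<comment> \<open>The implication makes the statement total in \<open>Z\<close>, so that a choice
    function exists; its values outside \<open>cot_dom U\<close> are arbitrary.\<close>
  have ex: "\<exists>R. Z \<in> cot_dom U \<longrightarrow> Q Z R" for Z
  proof (cases "Z \<in> cot_dom U")
    case True
    define m where "m = x (base_coord Z)"
    have m: "m \<in> M" unfolding m_def by (rule base_in[OF True])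
    obtain \<sigma> where \<sigma>: "\<sigma> \<in> Tstar m" "cot_param M x Z = (m, \<sigma>)"
      "\<And>a. \<sigma> (fd x (base_coord Z) a) = (\<Sum>j\<in>UNIV. a $ j * Z $ Inr j)"
      by (rule cot_param_cases[OF U True, folded m_def]) (rule that, assumption+)
    obtain s where s: "s \<in> T m" "\<And>u. u \<in> T m \<Longrightarrow> g u s = \<sigma> u + cnj (\<sigma> (lift m (\<tau> u)))"
      "K (m, \<sigma>) = g m m + g s s" by (rule potential_ex[OF m \<sigma>(1)]) (rule that, assumption+)
    obtain S :: "complex ^ 'n" where S: "s = (\<Sum>j\<in>UNIV. S $ j *s X Z j)"
      using s(1) unfolding m_def frame_T[OF True] by auto
    have gs: "g (X Z j) s = b Z j" for j
      using s(2)[OF frame_in[OF True, of j, folded m_def]] \<sigma>(3)[of "axis j 1"]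
        \<sigma>(3)[of "lift_coord Z (\<tau> (X Z j))", unfolded fd_lift_coord[OF True], folded m_def]
      by (simp add: b_def sum_axis X_def)
    have 1: "(\<Sum>k\<in>UNIV. g (X Z j) (X Z k) * cnj (S $ k)) = b Z j" for j
      using gs[of j] by (simp add: S g_sum_right g_scale_right mult.commute)
    have "g s s = (\<Sum>k\<in>UNIV. S $ k * b Z k)" by (subst (1) S) (simp add: g_sum_left g_scale_left gs)
    then show ?thesis using 1 s(3) \<sigma>(2) by (intro exI[of _ "\<lambda>k. cnj (S $ k)"]) (simp add: m_def Q_def)
  qed simp
  obtain R where "\<forall>Z. Z \<in> cot_dom U \<longrightarrow> Q Z (R Z)"
    using choice[OF allI, OF ex] by (rule exE)
  then have R: "\<And>Z j. Z \<in> cot_dom U \<Longrightarrow> (\<Sum>k\<in>UNIV. g (X Z j) (X Z k) * R Z k) = b Z j"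
    "\<And>Z. Z \<in> cot_dom U \<Longrightarrow> (K \<circ> cot_param M x) Z =
        g (x (base_coord Z)) (x (base_coord Z)) + (\<Sum>k\<in>UNIV. cnj (R Z k) * b Z k)"
    by (simp_all add: Q_def)
  have R2: "twice_diff (\<lambda>Z. R Z k) (cot_dom U)" for k
  proof (rule system[where A = "\<lambda>Z j k. g (X Z j) (X Z k)" and b = b and s = R])
    show "twice_diff f' (cot_dom U)" if "twice_diff f (cot_dom U)" "\<And>Z. Z \<in> cot_dom U \<Longrightarrow> f Z = f' Z" for f f'
      by (rule twice_diff_cong[OF op that])
    show "twice_diff (\<lambda>Z. g (X Z j) (X Z k)) (cot_dom U)" for j k
      unfolding X_def by (intro twice_diff_g holo_on_frame U op)
    show "a = (\<lambda>_. 0)" if Z: "Z \<in> cot_dom U" and a: "\<And>j. (\<Sum>k\<in>UNIV. g (X Z j) (X Z k) * a k) = 0" for Z a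
    proof -
      define u where "u = (\<Sum>k\<in>UNIV. cnj (a k) *s X Z k)"
      have gu: "g (X Z j) u = 0" for j using a by (simp add: u_def g_sum_right g_scale_right mult.commute)
      have "u = 0"
      proof (rule T_nondegenerate[OF base_in[OF Z]])
        show "u \<in> T (x (base_coord Z))" unfolding frame_T[OF Z] u_def
          by (rule image_eqI[of _ _ "\<chi> j. cnj (a j)"]) simp_all
        fix v assume "v \<in> T (x (base_coord Z))"
        then show "g v u = 0" unfolding frame_T[OF Z] by (auto simp: g_sum_left g_scale_left gu)
      qed
      then have "(\<lambda>k. cnj (a k)) = (\<lambda>_. 0)" unfolding u_def by (rule frame_inj[OF Z])
      then show ?thesis by (simp add: fun_eq_iff)
    qed
  qed (simp_all add: b2 R(1))
  have "twice_diff (\<lambda>Z. g (x (base_coord Z)) (x (base_coord Z)) + (\<Sum>k\<in>UNIV. cnj (R Z k) * b Z k)) (cot_dom U)"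
    by (intro twice_diff_add twice_diff_sum twice_diff_mult twice_diff_cnj op R2 b2 twice_diff_g holo_on_frame U)
  then show ?thesis by (rule twice_diff_cong[OF op _ R(2)[symmetric]])
qed

text \<open>The vector \<open>v\<close> to be lifted is constant, so no conjugates enter the system
  for its coordinates and the solution is holomorphic.\<close>

lemma potential_translate_chart_aux:
  assumes v: "\<tau> v = v"
  shows "\<exists>H. holo_fun H (cot_dom U) \<and> (\<forall>Z\<in>cot_dom U.
     K (tr v (cot_param M x Z)) =
       (K \<circ> cot_param M x) Z + complex_of_real (Re (H Z)))"
proof -
  have a: "holo_fun (\<lambda>Z. lift_coord Z v $ j) (cot_dom U)" for j
    by (rule holo_fun_linear_system[where A = "\<lambda>Z i j. \<omega> (X Z j) (e i)" and b = "\<lambda>Z i. \<omega> v (e i)"])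
       (simp_all add: frame_open holo_fun_frame_w lift_coord_system frame_w_inj)
  \<comment> \<open>The function of \<open>potential_translate\<close> in coordinates. The second
    sign is reversed because the arguments of \<omega> are exchanged.\<close>
  define H where "H Z = (-4) * (\<Sum>j\<in>UNIV. lift_coord Z v $ j * Z $ Inr j) +
      2 * \<i> * (\<Sum>j\<in>UNIV. lift_coord Z v $ j * \<omega> (X Z j) v)" for Z
  have "holo_fun H (cot_dom U)" unfolding H_def[abs_def]
    by (intro holo_fun_add holo_fun_cmult holo_fun_sum holo_fun_mult a holo_fun_nth holo_fun_frame_w)
  moreover have "K (tr v (cot_param M x Z)) =
       (K \<circ> cot_param M x) Z + complex_of_real (Re (H Z))" if Z: "Z \<in> cot_dom U" for Z
  proof -
    define m where "m = x (base_coord Z)"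
    have m: "m \<in> M" unfolding m_def by (rule base_in[OF Z])
    obtain \<sigma> where \<sigma>: "\<sigma> \<in> Tstar m" "cot_param M x Z = (m, \<sigma>)"
      "\<And>a. \<sigma> (fd x (base_coord Z) a) = (\<Sum>j\<in>UNIV. a $ j * Z $ Inr j)"
      by (rule cot_param_cases[OF U Z, folded m_def]) (rule that, assumption+)
    have la: "lift m v = fd x (base_coord Z) (lift_coord Z v)" by (simp add: m_def fd_lift_coord[OF Z])
    have 1: "\<sigma> (lift m v) = (\<Sum>j\<in>UNIV. lift_coord Z v $ j * Z $ Inr j)" unfolding la by (rule \<sigma>(3))
    have 2: "\<omega> v (lift m v) = - (\<Sum>j\<in>UNIV. lift_coord Z v $ j * \<omega> (X Z j) v)"
      unfolding w_antisym[of v "lift m v"] unfolding la frame_expand[OF Z] by (simp add: w_sum_left w_scale_left)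
    have 3: "- 4 * \<sigma> (lift m v) - 2 * \<i> * \<omega> v (lift m v) = H Z" unfolding H_def 1 2 by simp
    have "tr v (cot_param M x Z) = (m, \<lambda>u\<in>T m. \<sigma> u + \<i> * psi \<omega> M m v u)"
      using \<sigma>(1,2) m by (simp add: fibre_translation_def cotangent_bundle_def)
    then show ?thesis using potential_translate[OF m \<sigma>(1) v] \<sigma>(2) unfolding 3 by simp
  qed
  ultimately show ?thesis by blast
qed

end

lemma twice_diff_potential:
  fixes x :: "complex ^ 'n \<Rightarrow> complex ^ 'm"
  assumes "local_param M U x"
  shows "twice_diff (K \<circ> cot_param M x) (cot_dom U)"
  by (rule L'_annihilator) (rule twice_diff_potential_aux[OF assms])

lemma potential_translate_chart:
  fixes x :: "complex ^ 'n \<Rightarrow> complex ^ 'm"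
  assumes "local_param M U x" "v \<in> fixset \<tau>"
  obtains H where "holo_fun H (cot_dom U)" "\<And>Z. Z \<in> cot_dom U \<Longrightarrow>
     K (tr v (cot_param M x Z)) =
       (K \<circ> cot_param M x) Z + complex_of_real (Re (H Z))"
proof -
  have v: "\<tau> v = v" using assms by (simp add: fixset_def)
  obtain e :: "'n \<Rightarrow> complex ^ 'm" where e: "\<And>i. e i \<in> L0'" "\<And>u. u \<in> L' \<longleftrightarrow> (\<forall>i. \<omega> u (e i) = 0)"
    by (rule L'_annihilator) (rule that, assumption+)
  show ?thesis using potential_translate_chart_aux[OF assms(1) e v] that by blast
qed

section \<open>Translations in charts\<close>

lemma fibre_translation_in:
  assumes "P \<in> TM" shows "tr v P \<in> TM"
  using assms by (auto simp: fibre_translation_def cotangent_bundle_def psi_translate_in)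

context
  fixes U W and x y :: "complex ^ 'n \<Rightarrow> complex ^ 'm" and v h A f
  assumes U: "local_param M U x" and W: "local_param M W y"
  defines "A \<equiv> {z\<in>U. x z \<in> y ` W}" and "h \<equiv> \<lambda>z. the_inv_into W y (x z)"
    and "f \<equiv> local_expr M x W y (tr v)"
begin

text \<open>Translations preserve fibres, so the base points alone decide.\<close>

lemma local_dom_translation: "local_dom M U x W y (tr v) = cot_dom A"
proof -
  have "tr v (cot_param M x Z) \<in> cot_param M y ` cot_dom W \<longleftrightarrow> x (base_coord Z) \<in> y ` W"
    if Z: "Z \<in> cot_dom U" for Z
  proof -
    have "fst (tr v (cot_param M x Z)) = x (base_coord Z)"
      using cot_param_in_bundle[OF U Z] by (simp add: fibre_translation_def cot_param_def)
    moreover have "tr v (cot_param M x Z) \<in> Sigma M (Tstar)"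
      using fibre_translation_in[OF cot_param_in_bundle[OF U Z]] by (simp add: cotangent_bundle_def)
    ultimately show ?thesis unfolding cot_param_image[OF W]
      by (cases "tr v (cot_param M x Z)") auto
  qed
  then show ?thesis unfolding local_dom_def A_def by (auto simp: cot_dom_def)
qed

lemma h_app: "h z = the_inv_into W y (x z)"
  by (simp add: h_def)

lemmas tn = transition[OF U W, folded A_def h_app]

lemma cot_dom_A: "open (cot_dom A :: (complex ^ ('n + 'n)) set)" "Z \<in> cot_dom A \<Longrightarrow> Z \<in> cot_dom U"
    "Z \<in> cot_dom A \<Longrightarrow> base_coord Z \<in> A"
  by (rule open_cot_dom[OF tn(1)]) (auto simp: cot_dom_def A_def)

text \<open>The law for the fibre coordinates is stated implicitly, through a tangent vector with
  coordinates \<open>b\<close> in \<open>x\<close> and \<open>c\<close> in \<open>y\<close>. Taking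
  a basis vector for \<open>c\<close> solves for the new coordinates; keeping \<open>b\<close>
  constant gives an identity that can be differentiated.\<close>

lemma local_expr_translation:
  assumes Z: "Z \<in> cot_dom A"
  shows "f Z \<in> cot_dom W" "cot_param M y (f Z) = tr v (cot_param M x Z)"
    "base_coord (f Z) = h (base_coord Z)"
    "fd y (h (base_coord Z)) c = fd x (base_coord Z) b \<Longrightarrow>
      (\<Sum>j\<in>UNIV. c $ j * f Z $ Inr j) = (\<Sum>j\<in>UNIV. b $ j * Z $ Inr j) + \<i> * \<omega> v (fd x (base_coord Z) b)"
proof -
  have mem: "tr v (cot_param M x Z) \<in> cot_param M y ` cot_dom W"
    using Z local_dom_translation by (auto simp: local_dom_def)
  show fW: "f Z \<in> cot_dom W" unfolding f_def local_expr_def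
    by (rule the_inv_into_into[OF cot_param_inj[OF W] mem]) simp
  show eq: "cot_param M y (f Z) = tr v (cot_param M x Z)" unfolding f_def local_expr_def
    by (rule f_the_inv_into_f[OF cot_param_inj[OF W] mem])
  have ZU: "Z \<in> cot_dom U" by (rule cot_dom_A(2)[OF Z])
  have zA: "base_coord Z \<in> A" by (rule cot_dom_A(3)[OF Z])
  obtain \<sigma> where s: "\<sigma> \<in> Tstar (x (base_coord Z))" "cot_param M x Z = (x (base_coord Z), \<sigma>)"
    "\<And>a. \<sigma> (fd x (base_coord Z) a) = (\<Sum>j\<in>UNIV. a $ j * Z $ Inr j)"
    by (rule cot_param_cases[OF U ZU]) (rule that, assumption+)
  obtain \<sigma>' where s': "cot_param M y (f Z) = (y (base_coord (f Z)), \<sigma>')"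
    "\<And>a. \<sigma>' (fd y (base_coord (f Z)) a) = (\<Sum>j\<in>UNIV. a $ j * f Z $ Inr j)"
    by (rule cot_param_cases[OF W fW]) (rule that, assumption+)
  have tv: "tr v (cot_param M x Z) =
      (x (base_coord Z), \<lambda>u\<in>T (x (base_coord Z)). \<sigma> u + \<i> * psi \<omega> M (x (base_coord Z)) v u)"
    using cot_param_in_bundle[OF U ZU] s(2) by (simp add: fibre_translation_def)
  have "y (base_coord (f Z)) = y (h (base_coord Z))" using eq s'(1) tv tn(4)[OF zA] by simp
  moreover have "h (base_coord Z) \<in> W" using tn(3) zA by blast
  ultimately show b: "base_coord (f Z) = h (base_coord Z)"
    using inj_onD[OF local_paramD(4)[OF W]] fW by (simp add: cot_dom_def)
  assume c: "fd y (h (base_coord Z)) c = fd x (base_coord Z) b"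
  have in_T: "fd x (base_coord Z) b \<in> T (x (base_coord Z))"
    using tangent_space_param[OF U, of "base_coord Z"] ZU by (simp add: cot_dom_def)
  have "(\<Sum>j\<in>UNIV. c $ j * f Z $ Inr j) = \<sigma>' (fd x (base_coord Z) b)"
    using s'(2)[of c] unfolding b c by simp
  also have "\<sigma>' = (\<lambda>u\<in>T (x (base_coord Z)). \<sigma> u + \<i> * psi \<omega> M (x (base_coord Z)) v u)"
    using eq s'(1) tv by simp
  finally show "(\<Sum>j\<in>UNIV. c $ j * f Z $ Inr j) = (\<Sum>j\<in>UNIV. b $ j * Z $ Inr j) + \<i> * \<omega> v (fd x (base_coord Z) b)"
    using in_T by (simp add: psi_def s(3))
qed

lemma holo_on_h_base: "holo_on (\<lambda>Z :: complex ^ ('n + 'n). h (base_coord Z)) (cot_dom A)"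
  by (rule holo_on_compose[OF holo_on_base_coord tn(2)]) (auto simp: cot_dom_def)

lemma holo_on_local_expr_translation: "holo_on f (cot_dom A)"
proof -
  define A' where "A' = {w\<in>W. y w \<in> x ` U}"
  \<comment> \<open>The inverse change of chart, whose derivative expresses the frame of
    \<open>y\<close> in that of \<open>x\<close>.\<close>
  define k where "k w = the_inv_into U x (y w)" for w
  note tr' = transition[OF W U, folded A'_def k_def]
  have hA': "h z \<in> A'" if "z \<in> A" for z
    using that tn(3) tn(4)[OF that] by (auto simp: A'_def A_def)
  have kh: "k (h z) = z" if "z \<in> A" for z
    unfolding k_def tn(4)[OF that] by (rule the_inv_into_f_f[OF local_paramD(4)[OF U]]) (use that in \<open>simp add: A_def\<close>)
  have sub: "(\<lambda>Z :: complex ^ ('n + 'n). h (base_coord Z)) ` cot_dom A \<subseteq> A'" using hA' by (auto simp: cot_dom_def)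
  have inl: "holo_fun (\<lambda>Z. f Z $ Inl i) (cot_dom A)" for i
  proof (rule holo_fun_cong[OF cot_dom_A(1)])
    show "holo_fun (\<lambda>Z. h (base_coord Z) $ i) (cot_dom A)" using holo_on_h_base by (simp add: holo_on_iff)
    show "h (base_coord Z) $ i = f Z $ Inl i" if "Z \<in> cot_dom A" for Z
      unfolding local_expr_translation(3)[OF that, symmetric] by (rule base_coord_nth)
  qed
  have inr: "holo_fun (\<lambda>Z. f Z $ Inr i) (cot_dom A)" for i
  proof (rule holo_fun_cong[OF cot_dom_A(1)])
    have "holo_on (\<lambda>Z :: complex ^ ('n + 'n). fd k (h (base_coord Z)) (axis i 1)) (cot_dom A)"
      by (rule holo_on_compose[OF holo_on_h_base holo_on_fd[OF tr'(2,1)] sub])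
    then have 1: "holo_fun (\<lambda>Z :: complex ^ ('n + 'n). fd k (h (base_coord Z)) (axis i 1) $ j) (cot_dom A)" for j
      by (simp add: holo_on_iff)
    have "holo_on (\<lambda>Z :: complex ^ ('n + 'n). fd y (h (base_coord Z)) (axis i 1)) (cot_dom A)"
      by (rule holo_on_compose[OF holo_on_h_base holo_on_fd[OF local_paramD(2,1)[OF W]]])
         (use sub in \<open>auto simp: A'_def\<close>)
    then have 2: "holo_fun (\<lambda>Z :: complex ^ ('n + 'n). \<omega> (fd y (h (base_coord Z)) (axis i 1)) v) (cot_dom A)"
      by (rule holo_fun_w)
    show "holo_fun (\<lambda>Z. (\<Sum>j\<in>UNIV. fd k (h (base_coord Z)) (axis i 1) $ j * Z $ Inr j) +
        (- \<i>) * \<omega> (fd y (h (base_coord Z)) (axis i 1)) v) (cot_dom A)"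
      by (intro holo_fun_add holo_fun_sum holo_fun_mult holo_fun_cmult 1 2 holo_fun_nth)
    show "(\<Sum>j\<in>UNIV. fd k (h (base_coord Z)) (axis i 1) $ j * Z $ Inr j) +
        (- \<i>) * \<omega> (fd y (h (base_coord Z)) (axis i 1)) v = f Z $ Inr i" if Z: "Z \<in> cot_dom A" for Z
    proof -
      note zA = cot_dom_A(3)[OF Z]
      have eq: "fd y (h (base_coord Z)) (axis i 1) = fd x (base_coord Z) (fd k (h (base_coord Z)) (axis i 1))"
        using tr'(5)[OF hA'[OF zA]] kh[OF zA] by simp
      show ?thesis
        using local_expr_translation(4)[OF Z eq] unfolding eq[symmetric] sum_axis
        by (simp add: w_antisym[of v])
    qed
  qed
  show ?thesis unfolding holo_on_iff
  proof
    fix I :: "'n + 'n" show "holo_fun (\<lambda>Z. f Z $ I) (cot_dom A)" using inl inr by (cases I) auto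
  qed
qed

text \<open>Differentiating the law for the fibre coordinates leaves, besides the expected term,
  second derivatives of the change of chart and of \<omega>(x, v). They are collected in
  \<open>S\<close>, which is symmetric and so drops out of the alternating form.\<close>

lemma Omega_translation:
  assumes Z: "Z \<in> cot_dom A"
  shows "Omega_form (fd f Z a) (fd f Z b) = Omega_form a b"
proof -
  define z where "z = base_coord Z"
  have z: "z \<in> A" unfolding z_def by (rule cot_dom_A(3)[OF Z])
  have hj: "holo_fun (\<lambda>z. h z $ j) A" for j using tn(2) by (simp add: holo_on_iff)
  have fdh: "fd (\<lambda>z. h z $ j) z' c = fd h z' c $ j" if "z' \<in> A" for j z' c
    by (rule fd_nth[OF differentiableI[OF holo_on_has_derivative[OF tn(2) that]]])
  \<comment> \<open>A primitive for the translation: its differential is - \<omega>(v, dx), so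
    translating by \<open>v\<close> subtracts i times this differential.\<close>
  define \<psi> where "\<psi> z = \<omega> (x z) v" for z
  have \<psi>: "holo_fun \<psi> A" unfolding \<psi>_def
    by (rule holo_fun_subset[OF holo_fun_w[OF local_paramD(2)[OF U]]]) (simp add: A_def)
  have fd\<psi>: "fd \<psi> z' c = \<omega> (fd x z' c) v" if "z' \<in> A" for z' c
  proof -
    have "(x has_derivative fd x z') (at z')"
      using that by (intro holo_on_has_derivative[OF local_paramD(2)[OF U]]) (simp add: A_def)
    from has_derivative_compose[OF this linear_imp_has_derivative[OF linear_w_left[of v]]]
    show ?thesis unfolding \<psi>_def by (simp add: fd_eq)
  qed
  note fD = holo_on_has_derivative[OF holo_on_local_expr_translation]
  have inl: "fd f Z a $ Inl j = fd h z (base_coord a) $ j" for a j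
  proof -
    have "(h has_derivative fd h z) (at (base_coord Z))" using holo_on_has_derivative[OF tn(2) z] by (simp add: z_def)
    from has_derivative_nth[OF has_derivative_compose[OF base_coord_has_derivative this], of j]
    have "((\<lambda>Z. f Z $ Inl j) has_derivative (\<lambda>a. fd h z (base_coord a) $ j)) (at Z)"
    proof (rule has_derivative_transform_within_open[OF _ cot_dom_A(1) Z])
      show "h (base_coord \<xi>) $ j = f \<xi> $ Inl j" if "\<xi> \<in> cot_dom A" for \<xi>
        unfolding local_expr_translation(3)[OF that, symmetric] by (rule base_coord_nth)
    qed
    from fun_cong[OF has_derivative_unique[OF this has_derivative_nth[OF fD[OF Z]]], of a] show ?thesis by simp
  qed
  define S where "S a b = (-\<i>) * hess \<psi> z a b - (\<Sum>j\<in>UNIV. hess (\<lambda>z. h z $ j) z a b * f Z $ Inr j)" for a b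
  have S: "S a b = S b a" for a b
    unfolding S_def hess_def holo_fun_second_symmetric[OF \<psi> tn(1) z, where b=b and a=a]
    using holo_fun_second_symmetric[OF hj tn(1) z, where b=b and a=a] by simp
  have main: "(\<Sum>j\<in>UNIV. fd h z b $ j * fd f Z a $ Inr j) = (\<Sum>j\<in>UNIV. b $ j * a $ Inr j) + S (base_coord a) b" for a and b :: "complex ^ 'n"
  proof -
    have d1: "((\<lambda>Z. fd (\<lambda>z. h z $ j) (base_coord Z) b) has_derivative (\<lambda>a. hess (\<lambda>z. h z $ j) z (base_coord a) b)) (at Z)" for j
      unfolding hess_def
      by (rule has_derivative_compose[OF base_coord_has_derivative])
         (use holo_fun_has_derivative[OF holo_fun_fd[OF hj tn(1)] z] in \<open>simp add: z_def\<close>)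
    have d2: "((\<lambda>Z. fd \<psi> (base_coord Z) b) has_derivative (\<lambda>a. hess \<psi> z (base_coord a) b)) (at Z)"
      unfolding hess_def
      by (rule has_derivative_compose[OF base_coord_has_derivative])
         (use holo_fun_has_derivative[OF holo_fun_fd[OF \<psi> tn(1)] z] in \<open>simp add: z_def\<close>)
    have d3: "((\<lambda>Z. (\<Sum>j\<in>UNIV. fd (\<lambda>z. h z $ j) (base_coord Z) b * f Z $ Inr j) + \<i> * fd \<psi> (base_coord Z) b) has_derivative
        (\<lambda>a. (\<Sum>j\<in>UNIV. fd (\<lambda>z. h z $ j) (base_coord Z) b * fd f Z a $ Inr j + hess (\<lambda>z. h z $ j) z (base_coord a) b * f Z $ Inr j) +
          \<i> * hess \<psi> z (base_coord a) b)) (at Z)"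
      by (intro has_derivative_add has_derivative_sum has_derivative_mult has_derivative_mult_right d1 d2 has_derivative_nth fD[OF Z])
    \<comment> \<open>By the law for the fibre coordinates, the function differentiated in
      \<open>d3\<close> is linear in the old fibre coordinates with constant coefficients
      \<open>b\<close>. Comparing the two derivatives gives \<open>main\<close>.\<close>
    have d4: "((\<lambda>Z. (\<Sum>j\<in>UNIV. fd (\<lambda>z. h z $ j) (base_coord Z) b * f Z $ Inr j) + \<i> * fd \<psi> (base_coord Z) b) has_derivative
        (\<lambda>a. \<Sum>j\<in>UNIV. b $ j * a $ Inr j)) (at Z)"
    proof (rule has_derivative_transform_within_open[OF _ cot_dom_A(1) Z])
      show "((\<lambda>Z :: complex ^ ('n + 'n). \<Sum>j\<in>UNIV. b $ j * Z $ Inr j) has_derivative (\<lambda>a. \<Sum>j\<in>UNIV. b $ j * a $ Inr j)) (at Z)"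
        by (intro has_derivative_sum has_derivative_mult_right bounded_linear_imp_has_derivative[OF bounded_linear_vec_nth])
      show "(\<Sum>j\<in>UNIV. b $ j * \<xi> $ Inr j) =
          (\<Sum>j\<in>UNIV. fd (\<lambda>z. h z $ j) (base_coord \<xi>) b * f \<xi> $ Inr j) + \<i> * fd \<psi> (base_coord \<xi>) b" if \<xi>: "\<xi> \<in> cot_dom A" for \<xi>
        using local_expr_translation(4)[OF \<xi> tn(5)[OF cot_dom_A(3)[OF \<xi>]]] w_antisym[of v "fd x (base_coord \<xi>) b"]
        by (simp add: fdh[OF cot_dom_A(3)[OF \<xi>]] fd\<psi>[OF cot_dom_A(3)[OF \<xi>]])
    qed
    have "(\<Sum>j\<in>UNIV. fd (\<lambda>z. h z $ j) (base_coord Z) b * fd f Z a $ Inr j + hess (\<lambda>z. h z $ j) z (base_coord a) b * f Z $ Inr j) +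
          \<i> * hess \<psi> z (base_coord a) b = (\<Sum>j\<in>UNIV. b $ j * a $ Inr j)"
      by (rule fun_cong[OF has_derivative_unique[OF d3 d4], of a])
    then show ?thesis
      unfolding S_def z_def[symmetric] sum.distrib by (simp add: fdh[OF z] algebra_simps)
  qed
  have "Omega_form (fd f Z a) (fd f Z b) =
     (\<Sum>j\<in>UNIV. fd h z (base_coord a) $ j * fd f Z b $ Inr j) - (\<Sum>j\<in>UNIV. fd h z (base_coord b) $ j * fd f Z a $ Inr j)"
    unfolding Omega_form_def inl by (simp add: sum_subtractf mult.commute)
  also have "\<dots> = (\<Sum>j\<in>UNIV. base_coord a $ j * b $ Inr j) - (\<Sum>j\<in>UNIV. base_coord b $ j * a $ Inr j)"
    unfolding main using S[of "base_coord a" "base_coord b"] by simp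
  also have "\<dots> = Omega_form a b"
    unfolding Omega_form_def base_coord_nth by (simp add: sum_subtractf mult.commute)
  finally show ?thesis .
qed

text \<open>The change of chart is absorbed by \<open>levi_pullback\<close> and the translation by
  \<open>levi_add_pluriharmonic\<close>. For \<open>v = 0\<close> this is the independence of the
  metric from the chart.\<close>

lemma metric_translation:
  assumes Z: "Z \<in> cot_dom A" and v: "v \<in> fixset \<tau>"
  shows "G y (f Z) (fd f Z a) (fd f Z b) = G x Z a b"
proof -
  let ?Kx = "K \<circ> cot_param M x" and ?Ky = "K \<circ> cot_param M y"
  have opU: "open (cot_dom U :: (complex ^ ('n + 'n)) set)" and opW: "open (cot_dom W :: (complex ^ ('n + 'n)) set)"
    using local_paramD(1)[OF U] local_paramD(1)[OF W] by (auto intro: open_cot_dom)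
  note Kx = twice_diff_potential[OF U] and Ky = twice_diff_potential[OF W]
  obtain H where H: "holo_fun H (cot_dom U)" "\<And>Z. Z \<in> cot_dom U \<Longrightarrow>
     K (tr v (cot_param M x Z)) = ?Kx Z + complex_of_real (Re (H Z))"
    by (rule potential_translate_chart[OF U v]) (rule that, assumption+)
  note ZU = cot_dom_A(2)[OF Z]
  have "G y (f Z) (fd f Z a) (fd f Z b) = levi ?Ky (f Z) (fd f Z a) (fd f Z b)"
    unfolding metric_G_def by (rule levi_eq_wirtinger[OF Ky opW local_expr_translation(1)[OF Z]])
  also have "\<dots> = levi (\<lambda>Z. ?Ky (f Z)) Z a b"
    by (rule levi_pullback[OF holo_on_local_expr_translation cot_dom_A(1) _ opW Ky Z, symmetric])
       (auto intro: local_expr_translation(1))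
  also have "levi (\<lambda>Z. ?Ky (f Z)) Z = levi (\<lambda>Z. ?Kx Z + complex_of_real (Re (H Z))) Z"
    by (rule levi_cong[OF cot_dom_A(1) Z]) (simp add: local_expr_translation(2) H(2)[OF cot_dom_A(2), unfolded comp_apply])
  also have "levi (\<lambda>Z. ?Kx Z + complex_of_real (Re (H Z))) Z a b = levi ?Kx Z a b"
    by (rule levi_add_pluriharmonic[OF Kx opU ZU H(1)])
  also have "\<dots> = G x Z a b"
    unfolding metric_G_def by (rule levi_eq_wirtinger[OF Kx opU ZU, symmetric])
  finally show ?thesis .
qed

end

end

section \<open>Affine groups\<close>

text \<open>Elements of \<open>Aff_group\<close> are given by linear maps of the ambient space, so
  the inverse of \<open>A\<close> on \<open>X\<close> has to extend to one. A linear left inverse on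
  \<open>X\<close> provides the extension.\<close>

lemma linear_inverse_on_subspace:
  assumes X: "subspace X" and A: "linear A" "bij_betw A X X"
  obtains B where "linear B" "bij_betw B X X" "\<And>x. x \<in> X \<Longrightarrow> B (A x) = x" "\<And>x. x \<in> X \<Longrightarrow> A (B x) = x"
proof -
  obtain B where B: "linear B" "\<And>x. x \<in> X \<Longrightarrow> B (A x) = x"
    using linear_exists_left_inverse_on[OF A(1) X] A(2) by (auto simp: bij_betw_def)
  have AB: "A (B x) = x" "B x \<in> X" if x: "x \<in> X" for x
  proof -
    obtain y where y: "y \<in> X" "x = A y" using A(2) x by (auto simp: bij_betw_def)
    show "A (B x) = x" "B x \<in> X" using y B(2) by auto
  qed
  have "bij_betw B X X"
    by (rule bij_betw_byWitness[where f' = A]) (use AB B A in \<open>auto simp: bij_betw_def\<close>)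
  then show ?thesis using that B AB by blast
qed

lemma affine_map_in_Bij:
  assumes X: "subspace X" and A: "linear A" "bij_betw A X X" and v: "v \<in> X"
  shows "(\<lambda>x\<in>X. A x + v) \<in> Bij X"
proof -
  obtain B where B: "bij_betw B X X" "\<And>x. x \<in> X \<Longrightarrow> B (A x) = x" "\<And>x. x \<in> X \<Longrightarrow> A (B x) = x"
    by (rule linear_inverse_on_subspace[OF X A]) (rule that, assumption+)
  have AX: "A x \<in> X" "B x \<in> X" if "x \<in> X" for x using A(2) B(1) that by (auto simp: bij_betw_def)
  have "bij_betw (\<lambda>x\<in>X. A x + v) X X"
    by (rule bij_betw_byWitness[where f' = "\<lambda>y. B (y - v)"])
       (auto simp: AX B subspace_add[OF X] subspace_diff[OF X] v)
  then show ?thesis by (simp add: Bij_def)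
qed

lemma group_Aff_group:
  assumes X: "subspace X" shows "group (Aff_group X)"
proof -
  let ?H = "{\<lambda>x\<in>X. A x + v | A v. linear A \<and> bij_betw A X X \<and> v \<in> X}"
  interpret B: group "BijGroup X" by (rule group_BijGroup)
  have HB: "?H \<subseteq> Bij X" using affine_map_in_Bij[OF X] by blast
  have "subgroup ?H (BijGroup X)"
  proof (rule B.subgroupI)
    show "?H \<subseteq> carrier (BijGroup X)" using HB by (simp add: BijGroup_def)
    have "(\<lambda>x\<in>X. id x + 0) \<in> ?H"
      using subspace_0[OF X] linear_id by blast
    then show "?H \<noteq> {}" by blast
  next
    fix f assume "f \<in> ?H"
    then obtain A v where A: "f = (\<lambda>x\<in>X. A x + v)" "linear A" "bij_betw A X X" "v \<in> X" by blast
    obtain B where B: "linear B" "bij_betw B X X" "\<And>x. x \<in> X \<Longrightarrow> B (A x) = x" "\<And>x. x \<in> X \<Longrightarrow> A (B x) = x"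
      by (rule linear_inverse_on_subspace[OF X A(2,3)]) (rule that, assumption+)
    have BX: "B x \<in> X" if "x \<in> X" for x using B(2) that by (auto simp: bij_betw_def)
    have fB: "f \<in> Bij X" unfolding A(1) by (rule affine_map_in_Bij[OF X A(2-4)])
    have "inv_into X f y = B y + - B v" if y: "y \<in> X" for y
    proof (rule inv_into_f_eq)
      show "inj_on f X" using fB by (simp add: Bij_def bij_betw_def)
      show "B y + - B v \<in> X" using BX[OF y] BX[OF A(4)] subspace_diff[OF X] by simp
      then show "f (B y + - B v) = y"
        using y A(4) by (simp add: A(1) linear_diff[OF A(2)] B(4))
    qed
    then have "inv\<^bsub>BijGroup X\<^esub> f = (\<lambda>x\<in>X. B x + - B v)"
      unfolding inv_BijGroup[OF fB] by (intro restrict_ext) simp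
    moreover have "- B v \<in> X" using subspace_neg[OF X BX[OF A(4)]] .
    ultimately show "inv\<^bsub>BijGroup X\<^esub> f \<in> ?H" using B(1,2) by blast
  next
    fix f f' assume ff: "f \<in> ?H" "f' \<in> ?H"
    then obtain A v A' v' where A: "f = (\<lambda>x\<in>X. A x + v)" "linear A" "bij_betw A X X" "v \<in> X"
      "f' = (\<lambda>x\<in>X. A' x + v')" "linear A'" "bij_betw A' X X" "v' \<in> X" by blast
    have AX: "A x \<in> X" "A' x \<in> X" if "x \<in> X" for x using A that by (auto simp: bij_betw_def)
    have "f \<otimes>\<^bsub>BijGroup X\<^esub> f' = compose X f f'" using ff HB by (simp add: BijGroup_def subset_eq)
    also have "\<dots> = (\<lambda>x\<in>X. (A \<circ> A') x + (A v' + v))"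
      unfolding compose_def
      by (rule restrict_ext) (simp add: A(1,5) AX A(4,8) subspace_add[OF X] linear_add[OF A(2)] add.assoc)
    finally show "f \<otimes>\<^bsub>BijGroup X\<^esub> f' \<in> ?H"
      using linear_compose[OF A(6,2)] bij_betw_trans[OF A(7,3)] subspace_add[OF X AX(1)[OF A(8)] A(4)] by blast
  qed
  then show ?thesis unfolding Aff_group_def by (rule subgroup.subgroup_is_group) (rule group_BijGroup)
qed

context special_geometry
begin

section \<open>The group of automorphisms\<close>

abbreviation Aut where "Aut \<equiv> Aut_sd \<omega> \<tau> L L' M"
abbreviation SD where "SD \<equiv> sd_group \<omega> \<tau> L L' M"
abbreviation inverse_map ("_\<inverse>" [1000] 1000) where "\<phi>\<inverse> \<equiv> inv_into UNIV \<phi>"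

lemma AutD:
  assumes "\<phi> \<in> Aut"
  shows "Vector_Spaces.linear (*s) (*s) \<phi>" "bij \<phi>" "\<omega> (\<phi> u) (\<phi> v) = \<omega> u v" "\<phi> (\<tau> u) = \<tau> (\<phi> u)"
    "\<phi> ` M = M" "\<phi> ` L = L" "\<phi> ` L' = L'" "\<phi> (u + v) = \<phi> u + \<phi> v" "\<phi> (u - v) = \<phi> u - \<phi> v"
    "\<phi> (c *s u) = c *s \<phi> u" "\<phi>\<inverse> (\<phi> u) = u" "\<phi> (\<phi>\<inverse> u) = u" "linear \<phi>"
proof -
  show l: "Vector_Spaces.linear (*s) (*s) \<phi>" and b: "bij \<phi>" and "\<omega> (\<phi> u) (\<phi> v) = \<omega> u v" "\<phi> (\<tau> u) = \<tau> (\<phi> u)"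
    "\<phi> ` M = M" "\<phi> ` L = L" "\<phi> ` L' = L'" using assms by (auto simp: Aut_sd_def)
  show l': "linear \<phi>" using l by (simp add: complex_linear_vec)
  show "\<phi> (u + v) = \<phi> u + \<phi> v" "\<phi> (u - v) = \<phi> u - \<phi> v" by (simp_all add: linear_add[OF l'] linear_diff[OF l'])
  show "\<phi> (c *s u) = c *s \<phi> u" by (rule vec.linear_scale[OF l])
  show "\<phi>\<inverse> (\<phi> u) = u" "\<phi> (\<phi>\<inverse> u) = u" using b by (auto simp: bij_def surj_f_inv_f)
qed

lemma Aut_id: "id \<in> Aut"
  by (auto simp: Aut_sd_def vec.linear_id)

lemma Aut_comp: "\<phi> \<in> Aut \<Longrightarrow> \<psi> \<in> Aut \<Longrightarrow> \<phi> \<circ> \<psi> \<in> Aut"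
proof -
  assume *: "\<phi> \<in> Aut" "\<psi> \<in> Aut"
  have im: "(\<lambda>x. \<phi> (\<psi> x)) ` S = S" if "\<phi> ` S = S" "\<psi> ` S = S" for S
    using that by (simp only: image_image[symmetric])
  show ?thesis
    unfolding Aut_sd_def
    by (simp add: im AutD[OF *(1)] AutD[OF *(2)] bij_comp Vector_Spaces.linear_iff vec.vector_space_axioms)
qed

lemma Aut_inverse:
  assumes "\<phi> \<in> Aut" shows "\<phi>\<inverse> \<in> Aut"
proof -
  note a = AutD[OF assms]
  have eqI: "u = v" if "\<phi> u = \<phi> v" for u v using that a(11) by metis
  have im: "\<phi>\<inverse> ` S = S" if "\<phi> ` S = S" for S
  proof -
    have "\<phi>\<inverse> ` S = \<phi>\<inverse> ` \<phi> ` S" by (simp only: that)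
    also have "\<dots> = S" by (simp add: image_image a(11))
    finally show ?thesis .
  qed
  show ?thesis unfolding Aut_sd_def
  proof (intro CollectI conjI allI)
    show "Vector_Spaces.linear (*s) (*s) \<phi>\<inverse>"
    proof -
      have "\<phi>\<inverse> (u + v) = \<phi>\<inverse> u + \<phi>\<inverse> v" for u v by (rule eqI) (simp add: a(8,12))
      moreover have "\<phi>\<inverse> (c *s u) = c *s \<phi>\<inverse> u" for c u by (rule eqI) (simp add: a(10,12))
      ultimately show ?thesis by (simp add: Vector_Spaces.linear_iff vec.vector_space_axioms)
    qed
    show "bij \<phi>\<inverse>" using a(2) by (rule bij_imp_bij_inv)
    show "\<omega> (\<phi>\<inverse> u) (\<phi>\<inverse> v) = \<omega> u v" for u v using a(3)[of "\<phi>\<inverse> u" "\<phi>\<inverse> v"] by (simp add: a(12))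
    show "\<phi>\<inverse> (\<tau> u) = \<tau> (\<phi>\<inverse> u)" for u by (rule eqI) (simp add: a(4,12))
  qed (rule im, rule a)+
qed

lemma Aut_fixset: "\<phi> \<in> Aut \<Longrightarrow> v \<in> fixset \<tau> \<Longrightarrow> \<phi> v \<in> fixset \<tau>"
  using AutD(4)[of \<phi> v] by (simp add: fixset_def)

lemma group_sd: "group SD"
proof (rule groupI)
  note f = subspace_add[OF subspace_fixset] subspace_0[OF subspace_fixset] subspace_neg[OF subspace_fixset]
  fix x assume x: "x \<in> carrier SD"
  then obtain v \<phi> where v: "x = (v, \<phi>)" "v \<in> fixset \<tau>" "\<phi> \<in> Aut" by (auto simp: sd_group_def)
  note a = AutD[OF v(3)]
  show "\<one>\<^bsub>SD\<^esub> \<otimes>\<^bsub>SD\<^esub> x = x" by (simp add: sd_group_def v(1))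
  have "(- \<phi>\<inverse> v, \<phi>\<inverse>) \<in> carrier SD"
    using v by (simp add: sd_group_def f Aut_fixset Aut_inverse)
  moreover have "(- \<phi>\<inverse> v, \<phi>\<inverse>) \<otimes>\<^bsub>SD\<^esub> x = \<one>\<^bsub>SD\<^esub>"
    by (simp add: sd_group_def v(1) fun_eq_iff a)
  ultimately show "\<exists>y\<in>carrier SD. y \<otimes>\<^bsub>SD\<^esub> x = \<one>\<^bsub>SD\<^esub>"
    by blast
next
  show "\<one>\<^bsub>SD\<^esub> \<in> carrier SD"
    by (simp add: sd_group_def Aut_id subspace_0[OF subspace_fixset])
next
  fix x y assume "x \<in> carrier SD" "y \<in> carrier SD"
  then show "x \<otimes>\<^bsub>SD\<^esub> y \<in> carrier SD"
    by (auto simp: sd_group_def Aut_comp Aut_fixset subspace_add[OF subspace_fixset])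
next
  fix x y z assume "x \<in> carrier SD" "y \<in> carrier SD" "z \<in> carrier SD"
  then show "x \<otimes>\<^bsub>SD\<^esub> y \<otimes>\<^bsub>SD\<^esub> z =
      x \<otimes>\<^bsub>SD\<^esub> (y \<otimes>\<^bsub>SD\<^esub> z)"
    by (auto simp: sd_group_def AutD(8) add.assoc)
qed

lemma Aut_bij_fixset: "\<phi> \<in> Aut \<Longrightarrow> bij_betw \<phi> (fixset \<tau>) (fixset \<tau>)"
  by (rule bij_betw_byWitness[where f' = "\<phi>\<inverse>"]) (auto simp: AutD Aut_fixset Aut_inverse)

lemma sd_to_Aff_hom: "sd_to_Aff \<tau> \<in> hom SD (Aff_group (fixset \<tau>))"
proof (rule homI)
  have aff: "sd_to_Aff \<tau> (v, \<phi>) \<in> Bij (fixset \<tau>)" if "v \<in> fixset \<tau>" "\<phi> \<in> Aut" for v \<phi>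
    unfolding sd_to_Aff_def using that
    by (simp add: affine_map_in_Bij[OF subspace_fixset] AutD(13) Aut_bij_fixset)
  fix x assume "x \<in> carrier SD"
  then obtain v \<phi> where x: "x = (v, \<phi>)" "v \<in> fixset \<tau>" "\<phi> \<in> Aut" by (auto simp: sd_group_def)
  show "sd_to_Aff \<tau> x \<in> carrier (Aff_group (fixset \<tau>))"
    using x(2,3) AutD(13)[OF x(3)] Aut_bij_fixset[OF x(3)] by (auto simp: Aff_group_def sd_to_Aff_def x(1))
  fix y assume "y \<in> carrier SD"
  then obtain v' \<phi>' where y: "y = (v', \<phi>')" "v' \<in> fixset \<tau>" "\<phi>' \<in> Aut" by (auto simp: sd_group_def)
  have "sd_to_Aff \<tau> x \<otimes>\<^bsub>Aff_group (fixset \<tau>)\<^esub> sd_to_Aff \<tau> y = compose (fixset \<tau>) (sd_to_Aff \<tau> x) (sd_to_Aff \<tau> y)"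
    using aff x y by (simp add: Aff_group_def BijGroup_def)
  also have "\<dots> = sd_to_Aff \<tau> (x \<otimes>\<^bsub>SD\<^esub> y)"
    unfolding x(1) y(1) sd_to_Aff_def compose_def
    by (auto simp: sd_group_def fun_eq_iff AutD(8)[OF x(3)] Aut_fixset[OF y(3)] y(2) subspace_add[OF subspace_fixset])
  finally show "sd_to_Aff \<tau> (x \<otimes>\<^bsub>SD\<^esub> y) = sd_to_Aff \<tau> x \<otimes>\<^bsub>Aff_group (fixset \<tau>)\<^esub> sd_to_Aff \<tau> y" ..
qed

text \<open>The value at 0 recovers \<open>v\<close>, and \<phi> is determined by its restriction
  because \<open>fixset \<tau>\<close> spans the whole space over the complex numbers.\<close>

lemma sd_to_Aff_inj: "inj_on (sd_to_Aff \<tau>) (carrier SD)"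
proof (rule inj_onI)
  fix x y assume "x \<in> carrier SD" "y \<in> carrier SD" and eq: "sd_to_Aff \<tau> x = sd_to_Aff \<tau> y"
  then obtain v \<phi> v' \<phi>' where x: "x = (v, \<phi>)" "\<phi> \<in> Aut" and y: "y = (v', \<phi>')" "\<phi>' \<in> Aut"
    by (auto simp: sd_group_def)
  have *: "\<phi> u + v = \<phi>' u + v'" if "u \<in> fixset \<tau>" for u
    using fun_cong[OF eq, of u] that by (simp add: x(1) y(1) sd_to_Aff_def)
  have v: "v = v'" using *[of 0] linear_0[OF AutD(13)[OF x(2)]] linear_0[OF AutD(13)[OF y(2)]] subspace_0[OF subspace_fixset] by simp
  have "\<phi> u = \<phi>' u" for u
  proof -
    obtain a b where "a \<in> fixset \<tau>" "b \<in> fixset \<tau>" "u = a + \<i> *s b" by (rule real_imag_decompose)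
    then show ?thesis using *[of a] *[of b] v by (simp add: AutD(8,10)[OF x(2)] AutD(8,10)[OF y(2)])
  qed
  then show "x = y" using v x y by auto
qed

section \<open>Point transformations\<close>

text \<open>Both \<phi> and its inverse are linear, hence continuous, and map \<open>M\<close> onto
  itself, so relative openness and the homeomorphism property carry over.\<close>

lemma local_param_Aut:
  fixes x :: "complex ^ 'n \<Rightarrow> complex ^ 'm"
  assumes \<phi>: "\<phi> \<in> Aut" and U: "local_param M U x"
  shows "local_param M U (\<phi> \<circ> x)" and "z \<in> U \<Longrightarrow> fd (\<phi> \<circ> x) z a = \<phi> (fd x z a)"
proof -
  note a = AutD[OF \<phi>] and U' = local_paramD[OF U]
  have cont: "continuous_on S \<phi>" "continuous_on S \<phi>\<inverse>" for S
    using a(13) AutD(13)[OF Aut_inverse[OF \<phi>]] by (auto intro: linear_continuous_on linear_linear[THEN iffD2])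
  have der: "((\<phi> \<circ> x) has_derivative (\<lambda>a. \<phi> (fd x z a))) (at z)" if "z \<in> U" for z
    unfolding comp_def
    by (rule has_derivative_compose[OF holo_on_has_derivative[OF U'(2) that] linear_imp_has_derivative[OF a(13)]])
  show fd: "fd (\<phi> \<circ> x) z a = \<phi> (fd x z a)" if "z \<in> U" for z a by (simp add: fd_eq[OF der[OF that]])
  show "local_param M U (\<phi> \<circ> x)"
    unfolding local_param_def
  proof (intro conjI ballI)
    show "open U" by (rule U'(1))
    show "holo_on (\<phi> \<circ> x) U" unfolding holo_on_def
      using der fd_param_linear[OF U] a
      by (auto simp: complex_linear_vec intro!: exI[of _ "\<lambda>a. \<phi> (fd x _ a)"] dest: has_derivative_linear)
    show "inj (fd (\<phi> \<circ> x) z)" if "z \<in> U" for z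
      using U'(3)[OF that] a(11) by (intro injI) (metis fd[OF that] injD)
    obtain Q where Q: "open Q" "x ` U = M \<inter> Q" using U'(6) by (auto simp: openin_open)
    have "\<phi> ` Q = \<phi>\<inverse> -` Q" using a(11,12) by (auto simp: image_iff) metis
    then have "open (\<phi> ` Q)" using open_vimage[OF Q(1) cont(2)] by simp
    moreover have "(\<phi> \<circ> x) ` U = M \<inter> \<phi> ` Q"
    proof -
      have "(\<phi> \<circ> x) ` U = \<phi> ` (M \<inter> Q)" by (simp only: image_comp[symmetric] Q(2))
      also have "\<dots> = M \<inter> \<phi> ` Q" using a(2,5) by (simp add: image_Int bij_is_inj)
      finally show ?thesis .
    qed
    ultimately show "openin (top_of_set M) ((\<phi> \<circ> x) ` U)" by (auto simp: openin_open)
    obtain y where y: "homeomorphism U (x ` U) x y" using U by (auto simp: local_param_def)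
    have "homeomorphism (x ` U) ((\<phi> \<circ> x) ` U) \<phi> \<phi>\<inverse>"
      unfolding homeomorphism_def using cont a(11,12) by (auto simp: image_iff)
    from homeomorphism_compose[OF y this] show "\<exists>y. homeomorphism U ((\<phi> \<circ> x) ` U) (\<phi> \<circ> x) y" by blast
  qed
qed

lemma T_Aut:
  assumes \<phi>: "\<phi> \<in> Aut" and m: "m \<in> M" shows "T (\<phi> m) = \<phi> ` T m"
proof -
  obtain U and x :: "complex ^ 'n \<Rightarrow> complex ^ 'm" and z
    where x: "local_param M U x" "z \<in> U" "m = x z" using obtain_chart[OF m] by metis
  have "T ((\<phi> \<circ> x) z) = range (fd (\<phi> \<circ> x) z)" by (rule tangent_space_param[OF local_param_Aut(1)[OF \<phi> x(1)] x(2)])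
  also have "\<dots> = \<phi> ` range (fd x z)" by (auto simp: local_param_Aut(2)[OF \<phi> x(1,2)])
  finally show ?thesis using tangent_space_param[OF x(1,2)] x(3) by simp
qed

lemma T_Aut_inverse:
  assumes "\<phi> \<in> Aut" "m \<in> M" "u \<in> T (\<phi> m)" shows "\<phi>\<inverse> u \<in> T m"
  using assms T_Aut[OF assms(1,2)] AutD(11)[OF assms(1)] by auto

lemma Aut_M: "\<phi> \<in> Aut \<Longrightarrow> m \<in> M \<Longrightarrow> \<phi> m \<in> M"
  using AutD(5)[of \<phi>] by blast

lemma point_transformation_eq:
  "m \<in> M \<Longrightarrow> \<sigma> \<in> Tstar m \<Longrightarrow>
    point_transformation M \<phi> (m, \<sigma>) = (\<phi> m, \<lambda>u\<in>T (\<phi> m). \<sigma> (\<phi>\<inverse> u))"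
  by (simp add: point_transformation_def cotangent_bundle_def)

lemma point_transformation_in:
  assumes \<phi>: "\<phi> \<in> Aut" and m: "m \<in> M" and \<sigma>: "\<sigma> \<in> Tstar m"
  shows "(\<lambda>u\<in>T (\<phi> m). \<sigma> (\<phi>\<inverse> u)) \<in> Tstar (\<phi> m)"
  unfolding cotangent_space_def
proof (intro CollectI conjI ballI allI)
  note T = T_subspace[OF Aut_M[OF \<phi> m]] and a = AutD[OF Aut_inverse[OF \<phi>]] and s = cotangent_spaceD[OF \<sigma>]
  show "(\<lambda>u\<in>T (\<phi> m). \<sigma> (\<phi>\<inverse> u)) (u + v) = (\<lambda>u\<in>T (\<phi> m). \<sigma> (\<phi>\<inverse> u)) u + (\<lambda>u\<in>T (\<phi> m). \<sigma> (\<phi>\<inverse> u)) v"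
    if "u \<in> T (\<phi> m)" "v \<in> T (\<phi> m)" for u v
    using that by (simp add: T a(8) s(2) T_Aut_inverse[OF \<phi> m])
  show "(\<lambda>u\<in>T (\<phi> m). \<sigma> (\<phi>\<inverse> u)) (c *s u) = c * (\<lambda>u\<in>T (\<phi> m). \<sigma> (\<phi>\<inverse> u)) u"
    if "u \<in> T (\<phi> m)" for c u
    using that by (simp add: T a(10) s(3) T_Aut_inverse[OF \<phi> m])
qed simp

text \<open>An automorphism respects the tangent spaces, \<tau> and \<open>L'\<close>, hence the
  lifts. It therefore carries the dual vector \<open>s\<close> to \<open>\<phi> s\<close>, and
  \<gamma> is preserved.\<close>

lemma potential_Aut:
  assumes \<phi>: "\<phi> \<in> Aut" and P: "P \<in> TM"
  shows "K (point_transformation M \<phi> P) = K P"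
proof -
  obtain m \<sigma> where m: "m \<in> M" and \<sigma>: "\<sigma> \<in> Tstar m" and P: "P = (m, \<sigma>)"
    using P by (auto simp: cotangent_bundle_def)
  note a = AutD[OF \<phi>]
  have g: "g (\<phi> u) (\<phi> v) = g u v" for u v unfolding herm_def a(4)[symmetric] a(3) ..
  obtain s where s: "s \<in> T m" "\<And>u. u \<in> T m \<Longrightarrow> g u s = \<sigma> u + cnj (\<sigma> (lift m (\<tau> u)))"
    "K (m, \<sigma>) = g m m + g s s" by (rule potential_ex[OF m \<sigma>]) (rule that, assumption+)
  have lift: "lift (\<phi> m) (\<phi> v) = \<phi> (lift m v)" for v
  proof (rule lift_unique[OF Aut_M[OF \<phi> m]])
    show "\<phi> (lift m v) \<in> T (\<phi> m)" unfolding T_Aut[OF \<phi> m] by (intro imageI lift_in m)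
    have "\<phi> (lift m v - v) \<in> L'" using lift_in(2)[OF m, of v] a(7) by blast
    then show "\<phi> (lift m v) - \<phi> v \<in> L'" by (simp add: a(9))
  qed
  have "K (\<phi> m, \<lambda>u\<in>T (\<phi> m). \<sigma> (\<phi>\<inverse> u)) = g (\<phi> m) (\<phi> m) + g (\<phi> s) (\<phi> s)"
  proof (rule potential_eq[OF Aut_M[OF \<phi> m] point_transformation_in[OF \<phi> m \<sigma>]])
    show "\<phi> s \<in> T (\<phi> m)" unfolding T_Aut[OF \<phi> m] by (intro imageI s)
    fix u assume "u \<in> T (\<phi> m)"
    then obtain u' where u': "u' \<in> T m" "u = \<phi> u'" unfolding T_Aut[OF \<phi> m] by auto
    have in1: "\<phi> u' \<in> T (\<phi> m)" "\<phi> (lift m (\<tau> u')) \<in> T (\<phi> m)"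
      unfolding T_Aut[OF \<phi> m] by (intro imageI u' lift_in m)+
    show "g u (\<phi> s) = (\<lambda>u\<in>T (\<phi> m). \<sigma> (\<phi>\<inverse> u)) u + cnj ((\<lambda>u\<in>T (\<phi> m). \<sigma> (\<phi>\<inverse> u)) (lift (\<phi> m) (\<tau> u)))"
      unfolding u'(2) a(4)[symmetric] lift g using in1 s(2)[OF u'(1)] by (simp add: a(11))
  qed
  then show ?thesis unfolding P point_transformation_eq[OF m \<sigma>] s(3) g .
qed

text \<open>The inverse of \<phi> in the lift undoes \<phi> on the frame of
  \<open>\<phi> \<circ> x\<close>, so the fibre coordinates stay the same.\<close>

lemma cot_param_Aut:
  fixes x :: "complex ^ 'n \<Rightarrow> complex ^ 'm"
  assumes \<phi>: "\<phi> \<in> Aut" and U: "local_param M U x" and Z: "Z \<in> cot_dom U"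
  shows "cot_param M (\<phi> \<circ> x) Z = point_transformation M \<phi> (cot_param M x Z)"
proof -
  have z: "base_coord Z \<in> U" using Z by (simp add: cot_dom_def)
  then have m: "x (base_coord Z) \<in> M" using local_paramD(5)[OF U] by blast
  obtain \<sigma> where s: "\<sigma> \<in> Tstar (x (base_coord Z))" "cot_param M x Z = (x (base_coord Z), \<sigma>)"
    "\<And>a. \<sigma> (fd x (base_coord Z) a) = (\<Sum>j\<in>UNIV. a $ j * Z $ Inr j)"
    by (rule cot_param_cases[OF U Z]) (rule that, assumption+)
  have "cot_param M (\<phi> \<circ> x) Z = ((\<phi> \<circ> x) (base_coord Z), \<lambda>u\<in>T (\<phi> (x (base_coord Z))). \<sigma> (\<phi>\<inverse> u))"
  proof (rule cot_param_eqI[OF local_param_Aut(1)[OF \<phi> U] Z])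
    show "(\<lambda>u\<in>T (\<phi> (x (base_coord Z))). \<sigma> (\<phi>\<inverse> u)) \<in> Tstar ((\<phi> \<circ> x) (base_coord Z))"
      using point_transformation_in[OF \<phi> m s(1)] by simp
    fix i
    have "\<phi> (fd x (base_coord Z) (axis i 1)) \<in> T (\<phi> (x (base_coord Z)))"
      unfolding T_Aut[OF \<phi> m] tangent_space_param[OF U z] by blast
    then show "(\<lambda>u\<in>T (\<phi> (x (base_coord Z))). \<sigma> (\<phi>\<inverse> u)) (fd (\<phi> \<circ> x) (base_coord Z) (axis i 1)) = Z $ Inr i"
      by (simp add: local_param_Aut(2)[OF \<phi> U z] AutD(11)[OF \<phi>] s(3) sum_axis)
  qed
  then show ?thesis unfolding s(2) point_transformation_eq[OF m s(1)] by simp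
qed

section \<open>The action\<close>

lemma sd_action_compose:
  "P \<in> TM \<Longrightarrow> act (v, \<phi>) P = tr v (point_transformation M \<phi> P)"
  by (simp add: sd_action_def compose_def)

lemma sd_action_eq:
  assumes "\<phi> \<in> Aut" "m \<in> M" "\<sigma> \<in> Tstar m"
  shows "act (v, \<phi>) (m, \<sigma>) = (\<phi> m, \<lambda>u\<in>T (\<phi> m). \<sigma> (\<phi>\<inverse> u) + \<i> * \<omega> v u)"
proof -
  have "(\<phi> m, \<lambda>u\<in>T (\<phi> m). \<sigma> (\<phi>\<inverse> u)) \<in> TM"
    using point_transformation_in[OF assms] Aut_M[OF assms(1,2)] by (simp add: cotangent_bundle_def)
  moreover have "(m, \<sigma>) \<in> TM" using assms by (simp add: cotangent_bundle_def)
  ultimately show ?thesis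
    by (auto simp: sd_action_compose point_transformation_eq assms fibre_translation_def psi_def intro!: restrict_ext)
qed

lemma sd_action_in:
  assumes "\<phi> \<in> Aut" "P \<in> TM"
  shows "act (v, \<phi>) P \<in> TM"
proof -
  obtain m \<sigma> where "m \<in> M" "\<sigma> \<in> Tstar m" "P = (m, \<sigma>)" using assms by (auto simp: cotangent_bundle_def)
  then have "point_transformation M \<phi> P \<in> TM"
    using point_transformation_in[OF assms(1)] Aut_M[OF assms(1)] by (simp add: point_transformation_eq cotangent_bundle_def)
  then show ?thesis unfolding sd_action_compose[OF assms(2)] by (rule fibre_translation_in)
qed

text \<open>The semidirect law comes from the invariance of \<omega>: pairing \<open>v'\<close> with
  the preimage of \<open>u\<close> is pairing \<open>\<phi> v'\<close> with \<open>u\<close>, so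
  moving a translation past \<phi> replaces \<open>v'\<close> by \<open>\<phi> v'\<close>.\<close>

lemma sd_action_mult:
  assumes \<phi>: "\<phi> \<in> Aut" and \<psi>: "\<psi> \<in> Aut" and P: "P \<in> TM"
  shows "act (v, \<phi>) (act (v', \<psi>) P) = act (v + \<phi> v', \<phi> \<circ> \<psi>) P"
proof -
  obtain m \<sigma> where m: "m \<in> M" and \<sigma>: "\<sigma> \<in> Tstar m" and P': "P = (m, \<sigma>)"
    using P by (auto simp: cotangent_bundle_def)
  let ?\<sigma> = "\<lambda>u\<in>T (\<psi> m). \<sigma> (\<psi>\<inverse> u) + \<i> * \<omega> v' u"
  have "(\<psi> m, ?\<sigma>) \<in> TM" using sd_action_in[OF \<psi> P, of v'] by (simp add: P' sd_action_eq \<psi> m \<sigma>)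
  then have s': "\<psi> m \<in> M" "?\<sigma> \<in> Tstar (\<psi> m)" by (auto simp: cotangent_bundle_def)
  have inv: "(\<phi> \<circ> \<psi>)\<inverse> u = \<psi>\<inverse> (\<phi>\<inverse> u)" for u
    using o_inv_distrib[OF AutD(2)[OF \<phi>] AutD(2)[OF \<psi>]] by (simp add: fun_eq_iff)
  have w: "\<omega> (\<phi> v') u = \<omega> v' (\<phi>\<inverse> u)" for u
    using AutD(3)[OF \<phi>, of v' "\<phi>\<inverse> u"] by (simp add: AutD(12)[OF \<phi>])
  have "?\<sigma> (\<phi>\<inverse> u) = \<sigma> (\<psi>\<inverse> (\<phi>\<inverse> u)) + \<i> * \<omega> v' (\<phi>\<inverse> u)" if "u \<in> T (\<phi> (\<psi> m))" for u
    using T_Aut_inverse[OF \<phi> s'(1) that] by simp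
  then show ?thesis
    unfolding P' sd_action_eq[OF \<psi> m \<sigma>] sd_action_eq[OF \<phi> s'] sd_action_eq[OF Aut_comp[OF \<phi> \<psi>] m \<sigma>]
    by (auto intro!: restrict_ext simp: inv w w_add_left algebra_simps)
qed

lemma sd_action_one: "P \<in> TM \<Longrightarrow> act (0, id) P = P"
  by (auto simp: cotangent_bundle_def sd_action_eq[OF Aut_id] inv_id
      intro!: extensionalityI[of _ "T _"] dest: cotangent_spaceD(1))

lemma sd_action_inverse:
  assumes "\<phi> \<in> Aut" "P \<in> TM"
  shows "act (- \<phi>\<inverse> v, \<phi>\<inverse>) (act (v, \<phi>) P) = P"
    "act (v, \<phi>) (act (- \<phi>\<inverse> v, \<phi>\<inverse>) P) = P"
proof -
  have "\<phi>\<inverse> \<circ> \<phi> = id" "\<phi> \<circ> \<phi>\<inverse> = id" by (auto simp: fun_eq_iff AutD(11,12)[OF assms(1)])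
  moreover have "v + \<phi> (- \<phi>\<inverse> v) = 0" using linear_neg[OF AutD(13)[OF assms(1)]] by (simp add: AutD(12)[OF assms(1)])
  ultimately show "act (- \<phi>\<inverse> v, \<phi>\<inverse>) (act (v, \<phi>) P) = P"
    "act (v, \<phi>) (act (- \<phi>\<inverse> v, \<phi>\<inverse>) P) = P"
    by (simp_all add: sd_action_mult assms Aut_inverse sd_action_one)
qed

lemma sd_action_bij:
  assumes "\<phi> \<in> Aut" shows "bij_betw (act (v, \<phi>)) TM TM"
  by (rule bij_betw_byWitness[where f' = "act (- \<phi>\<inverse> v, \<phi>\<inverse>)"])
     (auto simp: sd_action_inverse sd_action_in assms Aut_inverse)

lemma sd_action_group_action: "group_action SD TM (act)"
proof -
  have bij: "act (v, \<phi>) \<in> Bij TM" if "\<phi> \<in> Aut" for v \<phi>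
    using sd_action_bij[OF that] by (simp add: Bij_def sd_action_def compose_def)
  have "act \<in> hom SD (BijGroup TM)"
  proof (rule homI)
    fix x assume "x \<in> carrier SD"
    then obtain v \<phi> where x: "x = (v, \<phi>)" "\<phi> \<in> Aut" by (auto simp: sd_group_def)
    show "act x \<in> carrier (BijGroup TM)" using bij x by (simp add: BijGroup_def)
    fix y assume "y \<in> carrier SD"
    then obtain v' \<psi> where y: "y = (v', \<psi>)" "\<psi> \<in> Aut" by (auto simp: sd_group_def)
    have "act x \<otimes>\<^bsub>BijGroup TM\<^esub> act y =
        compose TM (act x) (act y)"
      using bij x y by (simp add: BijGroup_def)
    also have "\<dots> = act (v + \<phi> v', \<phi> \<circ> \<psi>)"
    proof (rule extensionalityI)
      show "act (v + \<phi> v', \<phi> \<circ> \<psi>) \<in> extensional TM" by (simp add: sd_action_def compose_def)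
    qed (simp_all add: compose_def x y sd_action_mult)
    finally show "act (x \<otimes>\<^bsub>SD\<^esub> y) =
        act x \<otimes>\<^bsub>BijGroup TM\<^esub> act y"
      by (simp add: sd_group_def x(1) y(1))
  qed
  then show ?thesis
    by (intro group_action.intro group_hom.intro group_hom_axioms.intro group_sd group_BijGroup)
qed

text \<open>\<open>\<Phi>\<close> has to agree with the action on the bundle only, so that the lemma
  also covers the inverse map given by \<open>the_inv_into\<close>.\<close>

lemma local_dom_Aut:
  fixes x y :: "complex ^ 'n \<Rightarrow> complex ^ 'm"
  assumes \<phi>: "\<phi> \<in> Aut" and U: "local_param M U x" and \<Phi>: "\<And>P. P \<in> TM \<Longrightarrow> \<Phi> P = act (v, \<phi>) P"
  shows "local_dom M U x W y \<Phi> = local_dom M U (\<phi> \<circ> x) W y (tr v)"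
    "Z \<in> cot_dom U \<Longrightarrow> local_expr M x W y \<Phi> Z = local_expr M (\<phi> \<circ> x) W y (tr v) Z"
proof -
  have eq: "\<Phi> (cot_param M x Z) = tr v (cot_param M (\<phi> \<circ> x) Z)" if "Z \<in> cot_dom U" for Z
    using cot_param_in_bundle[OF U that] by (simp add: \<Phi> sd_action_compose cot_param_Aut[OF \<phi> U that])
  then show "local_dom M U x W y \<Phi> = local_dom M U (\<phi> \<circ> x) W y (tr v)"
    by (auto simp: local_dom_def)
  show "Z \<in> cot_dom U \<Longrightarrow> local_expr M x W y \<Phi> Z = local_expr M (\<phi> \<circ> x) W y (tr v) Z"
    by (simp add: local_expr_def eq)
qed

lemma sd_action_charts:
  fixes x y :: "complex ^ 'n \<Rightarrow> complex ^ 'm"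
  assumes \<phi>: "\<phi> \<in> Aut" and v: "v \<in> fixset \<tau>" and U: "local_param M U x" and W: "local_param M W y"
    and \<Phi>: "\<And>P. P \<in> TM \<Longrightarrow> \<Phi> P = act (v, \<phi>) P"
  shows "open (local_dom M U x W y \<Phi>)" "holo_on (local_expr M x W y \<Phi>) (local_dom M U x W y \<Phi>)"
    "Z \<in> local_dom M U x W y \<Phi> \<Longrightarrow>
       Omega_form (fd (local_expr M x W y \<Phi>) Z a) (fd (local_expr M x W y \<Phi>) Z b) = Omega_form a b"
    "Z \<in> local_dom M U x W y \<Phi> \<Longrightarrow>
       G y (local_expr M x W y \<Phi> Z)
         (fd (local_expr M x W y \<Phi>) Z a) (fd (local_expr M x W y \<Phi>) Z b) = G x Z a b"
proof -
  let ?x = "\<phi> \<circ> x" and ?f = "local_expr M x W y \<Phi>" and ?f' = "local_expr M (\<phi> \<circ> x) W y (tr v)"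
  note U' = local_param_Aut(1)[OF \<phi> U]
  have le: "local_dom M U x W y \<Phi> = local_dom M U ?x W y (tr v)"
    "Z \<in> cot_dom U \<Longrightarrow> ?f Z = ?f' Z" for Z
    by (rule local_dom_Aut[OF \<phi> U \<Phi>]; assumption)+
  let ?A = "{z \<in> U. ?x z \<in> y ` W}"
  have D: "local_dom M U x W y \<Phi> = cot_dom ?A"
    unfolding le(1) by (rule local_dom_translation[OF U' W])
  have AU: "Z \<in> cot_dom U" if "Z \<in> cot_dom ?A" for Z :: "complex ^ ('n + 'n)" using that by (simp add: cot_dom_def)
  show op: "open (local_dom M U x W y \<Phi>)" unfolding D by (rule cot_dom_A(1)[OF U' W])
  have opA: "open (cot_dom ?A :: (complex ^ ('n + 'n)) set)" by (rule cot_dom_A(1)[OF U' W])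
  have ff: "?f' Z = ?f Z" if "Z \<in> cot_dom ?A" for Z using le(2)[OF AU[OF that]] by simp
  have "holo_on ?f' (cot_dom ?A)" by (rule holo_on_local_expr_translation[OF U' W])
  then show "holo_on ?f (local_dom M U x W y \<Phi>)" unfolding D holo_on_iff
    by (intro allI holo_fun_cong[OF opA arg_cong2[OF ff refl, of _ "\<lambda>u i. u $ i"]]) auto
  assume "Z \<in> local_dom M U x W y \<Phi>"
  then have Z: "Z \<in> cot_dom ?A" unfolding D .
  have fd: "fd ?f Z = fd ?f' Z" by (rule fd_cong[OF opA Z]) (simp add: ff)
  show "Omega_form (fd ?f Z a) (fd ?f Z b) = Omega_form a b"
    unfolding fd by (rule Omega_translation[OF U' W Z])
  have "G y (?f Z) (fd ?f Z a) (fd ?f Z b) = G ?x Z a b"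
    unfolding fd ff[OF Z, symmetric] by (rule metric_translation[OF U' W Z v])
  \<comment> \<open>The way back from \<open>\<phi> \<circ> x\<close> to \<open>x\<close>: at equal
    coordinates the potential has equal values, by \<open>potential_Aut\<close>.\<close>
  also have "\<dots> = G x Z a b"
  proof -
    have opU: "open (cot_dom U :: (complex ^ ('n + 'n)) set)" by (rule open_cot_dom[OF local_paramD(1)[OF U]])
    have "levi (K \<circ> cot_param M ?x) Z = levi (K \<circ> cot_param M x) Z"
      by (rule levi_cong[OF opU AU[OF Z]])
         (simp add: cot_param_Aut[OF \<phi> U] potential_Aut[OF \<phi> cot_param_in_bundle[OF U]])
    then show ?thesis unfolding metric_G_def
      by (simp add: levi_eq_wirtinger[OF twice_diff_potential[OF U'] opU AU[OF Z]]
          levi_eq_wirtinger[OF twice_diff_potential[OF U] opU AU[OF Z]])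
  qed
  finally show "G y (?f Z) (fd ?f Z a) (fd ?f Z b) = G x Z a b" .
qed

lemma sd_action_automorphism:
  assumes \<phi>: "\<phi> \<in> Aut" and v: "v \<in> fixset \<tau>"
  shows "pseudo_hyperkaehler_automorphism n \<omega> \<tau> L0 L0' M (act (v, \<phi>))"
  unfolding pseudo_hyperkaehler_automorphism_def
proof (intro conjI)
  note b = sd_action_bij[OF \<phi>, of v]
  show "bij_betw (act (v, \<phi>)) TM TM" by (rule b)
  show "holomorphic_on_bundle n M (act (v, \<phi>))"
    unfolding holomorphic_on_bundle_def using sd_action_charts(1,2)[OF \<phi> v _ _ refl] by blast
  \<comment> \<open>On the bundle the inverse map is the action of the inverse group element, so its
    holomorphy is another instance of \<open>sd_action_charts\<close>.\<close>
  have inv: "the_inv_into TM (act (v, \<phi>)) P = act (- \<phi>\<inverse> v, \<phi>\<inverse>) P"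
    if "P \<in> TM" for P
    by (rule the_inv_into_f_eq)
       (use b that in \<open>simp_all add: bij_betw_def sd_action_inverse \<phi> sd_action_in Aut_inverse\<close>)
  have "- \<phi>\<inverse> v \<in> fixset \<tau>" by (rule subspace_neg[OF subspace_fixset Aut_fixset[OF Aut_inverse[OF \<phi>] v]])
  then show "holomorphic_on_bundle n M (the_inv_into TM (act (v, \<phi>)))"
    unfolding holomorphic_on_bundle_def using sd_action_charts(1,2)[OF Aut_inverse[OF \<phi>] _ _ _ inv] by blast
  show "preserves_G n \<omega> \<tau> L0 L0' M (act (v, \<phi>))"
    unfolding preserves_G_def Let_def using sd_action_charts(4)[OF \<phi> v _ _ refl] by blast
  show "preserves_Omega n M (act (v, \<phi>))"
    unfolding preserves_Omega_def Let_def using sd_action_charts(3)[OF \<phi> v _ _ refl] by blast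
qed

lemma sd_action_point_transformation:
  assumes \<phi>: "\<phi> \<in> Aut" shows "act (0, \<phi>) = point_transformation M \<phi>"
proof (rule extensionalityI)
  show "act (0, \<phi>) \<in> extensional TM" by (simp add: sd_action_def compose_def)
  show "point_transformation M \<phi> \<in> extensional TM" by (simp add: point_transformation_def)
  fix P assume "P \<in> TM"
  then obtain m \<sigma> where "m \<in> M" "\<sigma> \<in> Tstar m" "P = (m, \<sigma>)" by (auto simp: cotangent_bundle_def)
  then show "act (0, \<phi>) P = point_transformation M \<phi> P"
    by (simp add: sd_action_eq[OF \<phi>] point_transformation_eq)
qed

lemma sd_action_fibre:
  assumes "m \<in> M" "\<sigma> \<in> Tstar m"
  shows "act (v, id) (m, \<sigma>) = (m, \<lambda>u\<in>T m. \<sigma> u + \<i> * psi \<omega> M m v u)"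
  by (auto simp: sd_action_eq[OF Aut_id assms] psi_def inv_id intro!: restrict_ext)

text \<open>For uniqueness, the difference of two solutions annihilates the tangent space and so
  lies in it, the tangent space being Lagrangean. As it is also real, \<gamma> pairs it to 0 with
  all tangent vectors, and nondegeneracy applies.\<close>

lemma ex1_fibre_translation:
  assumes m: "m \<in> M" and \<sigma>: "\<sigma> \<in> Tstar m" and \<sigma>': "\<sigma>' \<in> Tstar m"
  shows "\<exists>!v. v \<in> fixset \<tau> \<and> act (v, id) (m, \<sigma>) = (m, \<sigma>')"
proof -
  have char: "act (v, id) (m, \<sigma>) = (m, \<sigma>') \<longleftrightarrow> (\<forall>u\<in>T m. \<sigma> u + \<i> * \<omega> v u = \<sigma>' u)" for v
    using cotangent_spaceD(1)[OF \<sigma>']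
    by (auto simp: sd_action_fibre[OF m \<sigma>] psi_def intro!: extensionalityI[of _ "T m"])
  show ?thesis unfolding char
  proof (rule ex_ex1I)
    have "(\<lambda>u\<in>T m. \<sigma> u - \<sigma>' u) \<in> Tstar m"
      using T_subspace[OF m] by (auto simp: cotangent_space_def cotangent_spaceD[OF \<sigma>] cotangent_spaceD[OF \<sigma>'] algebra_simps)
    from sharp_ex[OF m this] obtain t where t: "t \<in> T m" "\<And>u. u \<in> T m \<Longrightarrow> g u t = \<sigma> u - \<sigma>' u" by auto
    \<comment> \<open>The summand \<open>t\<close> makes the vector real and pairs to 0 with tangent
      vectors, so \<open>\<tau> t\<close> alone contributes.\<close>
    have "t + \<tau> t \<in> fixset \<tau>" by (simp add: fixset_def tau_add add.commute)
    moreover have "\<sigma> u + \<i> * \<omega> (t + \<tau> t) u = \<sigma>' u" if u: "u \<in> T m" for u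
    proof -
      have "\<omega> t u = 0" using T_lagrangean[OF m, of t] t(1) u by blast
      then have "\<i> * \<omega> (t + \<tau> t) u = - g u t" using w_antisym[of "\<tau> t" u] by (simp add: w_add_left herm_def)
      then show ?thesis using t(2)[OF u] by simp
    qed
    ultimately show "\<exists>v. v \<in> fixset \<tau> \<and> (\<forall>u\<in>T m. \<sigma> u + \<i> * \<omega> v u = \<sigma>' u)" by blast
  next
    fix v v' assume v: "v \<in> fixset \<tau> \<and> (\<forall>u\<in>T m. \<sigma> u + \<i> * \<omega> v u = \<sigma>' u)"
      "v' \<in> fixset \<tau> \<and> (\<forall>u\<in>T m. \<sigma> u + \<i> * \<omega> v' u = \<sigma>' u)"
    have 0: "\<omega> (v - v') u = 0" if "u \<in> T m" for u
    proof -
      have "\<sigma> u + \<i> * \<omega> v u = \<sigma> u + \<i> * \<omega> v' u" using v that by simp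
      then show ?thesis by (simp add: w_diff_left)
    qed
    have "v - v' = 0"
    proof (rule T_nondegenerate[OF m])
      show "v - v' \<in> T m" using T_lagrangean[OF m] 0 by blast
      show "g u (v - v') = 0" if "u \<in> T m" for u
        using 0[OF that] v w_antisym[of "v - v'" u] by (simp add: herm_def fixset_def tau_diff)
    qed
    then show "v = v'" by simp
  qed
qed

end

theorem proposition2p1:
  fixes \<omega> :: "complex ^ 'm \<Rightarrow> complex ^ 'm \<Rightarrow> complex"
    and \<tau> :: "complex ^ 'm \<Rightarrow> complex ^ 'm"
    and L0 L0' L L' M :: "(complex ^ 'm) set"
  assumes dim: "CARD('m) = 2 * CARD('n::finite)"
    and data: "fundamental_data \<omega> \<tau>"
    and split: "lagrangean_splitting \<omega> \<tau> L0 L0'"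
    and L: "L = cspan L0" and L': "L' = cspan L0'"
    and lagr: "lagrangean_submanifold TYPE('n) \<omega> M"
    and kaehler: "pseudo_kaehler_submanifold TYPE('n) \<omega> \<tau> M"
    and genpos: "general_position TYPE('n) L L' M"
  shows
    "sd_to_Aff \<tau> \<in> hom (sd_group \<omega> \<tau> L L' M) (Aff_group (fixset \<tau>)) \<and>
     inj_on (sd_to_Aff \<tau>) (carrier (sd_group \<omega> \<tau> L L' M)) \<and>
     group (Aff_group (fixset \<tau>)) \<and>
     group_action (sd_group \<omega> \<tau> L L' M) (cotangent_bundle M) (sd_action \<omega> M) \<and>
     (\<forall>g \<in> carrier (sd_group \<omega> \<tau> L L' M).
        pseudo_hyperkaehler_automorphism TYPE('n) \<omega> \<tau> L0 L0' M (sd_action \<omega> M g)) \<and>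
     (\<forall>\<phi> \<in> Aut_sd \<omega> \<tau> L L' M. sd_action \<omega> M (0, \<phi>) = point_transformation M \<phi>) \<and>
     (\<forall>v \<in> fixset \<tau>. \<forall>m \<in> M. \<forall>\<sigma> \<in> cotangent_space M m.
        sd_action \<omega> M (v, id) (m, \<sigma>) = (m, \<lambda>u\<in>tangent_space M m. \<sigma> u + \<i> * psi \<omega> M m v u) \<and>
        (\<lambda>u\<in>tangent_space M m. \<sigma> u + \<i> * psi \<omega> M m v u) \<in> cotangent_space M m) \<and>
     (\<forall>m \<in> M. \<forall>\<sigma> \<in> cotangent_space M m. \<forall>\<sigma>' \<in> cotangent_space M m.
        \<exists>!v. v \<in> fixset \<tau> \<and> sd_action \<omega> M (v, id) (m, \<sigma>) = (m, \<sigma>'))"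
proof -
  interpret special_geometry \<omega> \<tau> L0 L0' "TYPE('n)" M
    using dim data split lagr kaehler genpos unfolding L L' by unfold_locales
  show ?thesis
    unfolding L L'
    by (intro conjI ballI sd_to_Aff_hom sd_to_Aff_inj group_Aff_group subspace_fixset sd_action_group_action
          sd_action_point_transformation sd_action_fibre psi_translate_in ex1_fibre_translation)
       (auto simp: sd_group_def intro: sd_action_automorphism)
qed

end
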